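(* Let $V:\mathbb{R}\to\mathbb{R}$ be of class $C^2$ with $V''\le 0$, and suppose there are $\delta,u_{\max}>0$ such that $V(u_{\max})=0$ and $V'(v)\le-\delta$ for every $v\in[0,u_{\max}]$. Let $\eta:\mathbb{R}\to\mathbb{R}$ satisfy $\eta(x)\ge 0$ for every $x\in\mathbb{R}$, $\eta(x)=0$ for every $x>0$, $\int_{\mathbb{R}}\eta(x)\,dx=1$, let $\eta$ be Lipschitz continuous on $]-\infty,0]$, and suppose there is a constant $D>0$ such that $\eta(y)\le D\,\eta'(y)$ for a.e. $y\in\,]-\infty,0[$. Let $u_0\in L^\infty(\mathbb{R})$ satisfy $\mathrm{TotVar}(u_0)<\infty$, $u_0(x)\in[0,u_{\max}]$ for a.e. $x\in\mathbb{R}$, $\inf u_0>0$, and $\mathrm{Lip}^-u_0\le L$ for some $L>0$. For $\varepsilon>0$ set $\eta_\varepsilon(x):=\eta(x/\varepsilon)/\varepsilon$ and let $u_\varepsilon$ be the solution of the Cauchy problem $$\partial_t u_\varepsilon+\partial_x\big[u_\varepsilon V(u_\varepsilon*\eta_\varepsilon)\big]=0\ \text{ on }\mathbb{R}_+\times\mathbb{R},\qquad u_\varepsilon(0,\cdot)=u_0 .$$ If $$\varepsilon<\frac{\inf u_0}{2DL},$$ then $$\mathrm{Lip}^-u_\varepsilon(t,\cdot)\le\frac{L}{2\delta Lt+1}<\frac{1}{2\delta t}\qquad\text{for every }t\ge 0$$ (at $t=0$ the rightmost term is understood as $+\infty$).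
   Context: For $f:\mathbb{R}\to\mathbb{R}$, $\mathrm{Lip}^-f:=-\inf_{x<y}\frac{f(y)-f(x)}{y-x}$; for an element of $L^\infty(\mathbb{R})$ this is understood for a suitable representative. $\mathrm{TotVar}$ denotes total variation (of a suitable representative) and $\inf u_0$ is the essential infimum. The symbol $*$ denotes convolution in the space variable only: $(u*\eta_\varepsilon)(t,x)=\int_{\mathbb{R}}u(t,x-y)\eta_\varepsilon(y)\,dy$. Let $\mathcal{D}:=\{u_0\in L^\infty(\mathbb{R}):\mathrm{TotVar}(u_0)<\infty,\ u_0(x)\in[0,u_{\max}]\text{ for a.e. }x\}$. The solution of the Cauchy problem is the trajectory $u_\varepsilon(t,\cdot)=S^\varepsilon_tu_0$, where $S^\varepsilon:[0,+\infty[\times\mathcal{D}\to\mathcal{D}$ is the unique semigroup, continuous in $L^1_{\mathrm{loc}}$, each of whose trajectories $t\mapsto S^\varepsilon_tu_0$ is a distributional solution of the Cauchy problem. *)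

theory Defs
  imports "HOL-Analysis.Analysis" "HOL-Probability.Essential_Supremum"
begin

text \<open>
  Elements of \<open>L\<^sup>\<infinity>(\<real>)\<close> are represented by Borel functions \<^typ>\<open>real \<Rightarrow> real\<close>, every notion
  below being invariant under equality almost everywhere unless it is explicitly pointwise.
\<close>

definition ae_eq :: "(real \<Rightarrow> real) \<Rightarrow> (real \<Rightarrow> real) \<Rightarrow> bool" (infix "=\<^sub>a\<^sub>e" 50) where
  "u =\<^sub>a\<^sub>e v \<longleftrightarrow> (AE x in lborel. u x = v x)"

text \<open>Pointwise; for an \<open>L\<^sup>\<infinity>\<close> element, to be applied to a suitable representative.\<close>

definition Lip_minus :: "(real \<Rightarrow> real) \<Rightarrow> ereal" where
  "Lip_minus f = - Inf {ereal ((f y - f x) / (y - x)) | x y. x < y}"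

text \<open>Pointwise; for an \<open>L\<^sup>\<infinity>\<close> element, to be applied to a suitable representative.\<close>

definition tot_var :: "(real \<Rightarrow> real) \<Rightarrow> ereal" where
  "tot_var f =
     Sup {ereal (\<Sum>i<n. \<bar>f (x (Suc i)) - f (x i)\<bar>) | (n :: nat) (x :: nat \<Rightarrow> real). mono x}"

definition ess_inf :: "(real \<Rightarrow> real) \<Rightarrow> ereal" where
  "ess_inf u = - esssup lborel (\<lambda>x. - ereal (u x))"

definition data_set :: "real \<Rightarrow> (real \<Rightarrow> real) set" where
  "data_set umax =
     {u. u \<in> borel_measurable borel
       \<and> (AE x in lborel. u x \<in> {0..umax})
       \<and> (\<exists>v. v =\<^sub>a\<^sub>e u \<and> tot_var v < \<infinity>)}"

definition convolution :: "(real \<Rightarrow> real) \<Rightarrow> (real \<Rightarrow> real) \<Rightarrow> real \<Rightarrow> real" where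
  "convolution u k x = (LINT y|lborel. u (x - y) * k y)"

definition rescale :: "real \<Rightarrow> (real \<Rightarrow> real) \<Rightarrow> real \<Rightarrow> real" where
  "rescale \<epsilon> k x = k (x / \<epsilon>) / \<epsilon>"

primrec Ck_plane :: "nat \<Rightarrow> (real \<times> real \<Rightarrow> real) \<Rightarrow> bool" where
  "Ck_plane 0 f \<longleftrightarrow> continuous_on UNIV f"
| "Ck_plane (Suc k) f \<longleftrightarrow>
     (\<exists>ft fx. Ck_plane k ft \<and> Ck_plane k fx \<and>
        (\<forall>p. (f has_derivative (\<lambda>h. ft p * fst h + fx p * snd h)) (at p)))"

definition test_function :: "(real \<times> real \<Rightarrow> real) \<Rightarrow> bool" where
  "test_function \<phi> \<longleftrightarrow> (\<forall>k. Ck_plane k \<phi>) \<and> (\<exists>K. compact K \<and> (\<forall>p. p \<notin> K \<longrightarrow> \<phi> p = 0))"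

text \<open>
  Distributional solutions of \<open>\<partial>\<^sub>t u + \<partial>\<^sub>x [u V(u * k)] = 0\<close> on \<open>t > 0\<close> with initial datum
  \<open>u0\<close>. A test function is given on the whole plane and need not vanish on the line \<open>t = 0\<close>, which
  produces the initial term. The trajectories considered below are bounded by a constant and
  continuous in time with values in \<open>L\<^sup>1\<^sub>l\<^sub>o\<^sub>c\<close>; hence the inner integral is a compactly
  supported, continuous function of \<open>t\<close>, and no joint measurability of \<open>(t, x) \<mapsto> u t x\<close>
  is needed.
\<close>

definition distributional_solution ::
    "(real \<Rightarrow> real) \<Rightarrow> (real \<Rightarrow> real) \<Rightarrow> (real \<Rightarrow> real) \<Rightarrow> (real \<Rightarrow> real \<Rightarrow> real) \<Rightarrow> bool" where
  "distributional_solution V k u0 u \<longleftrightarrow>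
     (\<forall>\<phi>. test_function \<phi> \<longrightarrow>
        (LINT t:{0..}|lborel. (LINT x|lborel.
            u t x * deriv (\<lambda>s. \<phi> (s, x)) t
          + u t x * V (convolution (u t) k x) * deriv (\<lambda>y. \<phi> (t, y)) x))
        + (LINT x|lborel. u0 x * \<phi> (0, x)) = 0)"

definition L1loc_tendsto :: "(nat \<Rightarrow> real \<Rightarrow> real) \<Rightarrow> (real \<Rightarrow> real) \<Rightarrow> bool" where
  "L1loc_tendsto u v \<longleftrightarrow>
     (\<forall>R. (\<lambda>n. LINT x:{-R..R}|lborel. \<bar>u n x - v x\<bar>) \<longlonglongrightarrow> 0)"

text \<open>
  A semigroup \<open>S: [0, \<infinity>) \<times> D \<rightarrow> D\<close> that is continuous in \<open>L\<^sup>1\<^sub>l\<^sub>o\<^sub>c\<close> and whose trajectories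
  solve the Cauchy problem with kernel \<open>k\<close>. Continuity is sequential, the topology being metrizable;
  applied to constant sequences it shows that \<open>S t\<close> respects equality almost everywhere.
\<close>

definition solution_semigroup ::
    "(real \<Rightarrow> real) \<Rightarrow> real \<Rightarrow> (real \<Rightarrow> real) \<Rightarrow>
      (real \<Rightarrow> (real \<Rightarrow> real) \<Rightarrow> real \<Rightarrow> real) \<Rightarrow> bool" where
  "solution_semigroup V umax k S \<longleftrightarrow>
     (\<forall>t\<ge>0. \<forall>u\<in>data_set umax. S t u \<in> data_set umax)
   \<and> (\<forall>u\<in>data_set umax. S 0 u =\<^sub>a\<^sub>e u)
   \<and> (\<forall>s\<ge>0. \<forall>t\<ge>0. \<forall>u\<in>data_set umax. S (s + t) u =\<^sub>a\<^sub>e S s (S t u))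
   \<and> (\<forall>\<tau> t v u. (\<forall>n. 0 \<le> \<tau> n) \<longrightarrow> \<tau> \<longlonglongrightarrow> t \<longrightarrow>
        (\<forall>n. v n \<in> data_set umax) \<longrightarrow> u \<in> data_set umax \<longrightarrow> L1loc_tendsto v u \<longrightarrow>
        L1loc_tendsto (\<lambda>n. S (\<tau> n) (v n)) (S t u))
   \<and> (\<forall>u\<in>data_set umax. distributional_solution V k u (\<lambda>t. S t u))"

end

theory Submission
  imports Defs
begin

text \<open>
  Write \<open>k = \<eta>\<^sub>\<epsilon>\<close>, \<open>w = u * k\<close> and \<open>q = - V'(w) \<ge> \<delta>\<close>. For a smooth solution the slope
  \<open>p = u\<^sub>x\<close> evolves along the characteristics \<open>X' = V(w)\<close> by
  \<open>p' = 2 q p w\<^sub>x - u V''(w) w\<^sub>x\<^sup>2 + u q w\<^sub>x\<^sub>x\<close>. Consider a point where \<open>p\<close> attains its minimum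
  \<open>- m\<close>. As \<open>w\<^sub>x\<close> is an average of \<open>p\<close>, \<open>w\<^sub>x + m \<ge> 0\<close>. The number \<open>w\<^sub>x\<^sub>x\<close> is the integral of
  \<open>p + m\<close> against \<open>k'\<close>, and the kernel satisfies \<open>k' \<ge> k / (\<epsilon> D)\<close>; hence
  \<open>w\<^sub>x\<^sub>x \<ge> (w\<^sub>x + m) / (\<epsilon> D)\<close>. By concavity the second term has a sign, and what remains is
  \<open>p' \<ge> q (2 m\<^sup>2 + (w\<^sub>x + m) (u / (\<epsilon> D) - 2 m))\<close>. Now \<open>inf u\<close> does not decrease and
  \<open>m \<le> L\<close>, so the smallness of \<open>\<epsilon>\<close> makes the last product nonnegative. Thus
  \<open>m' \<le> - 2 \<delta> m\<^sup>2\<close>, whose solution with \<open>m(0) = L\<close> is \<open>L / (2 \<delta> L t + 1)\<close>.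

  To make this rigorous one has to relate distributional trajectories of the semigroup to
  characteristics. The velocity \<open>V(w)\<close> is Lipschitz in space for every bounded \<open>u\<close>, so the
  characteristics exist, and a commutator estimate shows that the mass between two of them is conserved
  (\<open>mass_conservation\<close>). The reciprocal of the mean density between two nearby characteristics solves a
  linear differential equation up to a small error. For continuous data this yields a version \<open>v\<close> of
  the trajectory, defined at every point, that satisfies the expected equation along characteristics
  (\<open>u_AE_eq_v\<close>, \<open>v_along_X\<close>). No second derivatives are available, and a minimum need not be
  attained. The computation above is therefore carried out with difference quotients along pairs of
  characteristics, where it holds up to an error proportional to their distance
  (\<open>one_sided_rate\<close>), and extremal quantities are treated by \<open>family_nonpos_by_halving\<close>: a family of
  functions is nonpositive if every exponential bound on the whole family can be halved. In this way one
  obtains the lower bound, the Lipschitz bound and finally the one-sided bound for Lipschitz data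
  (\<open>v_lower_bound\<close>, \<open>v_lipschitz\<close>, \<open>v_one_sided_lipschitz\<close>).

  General data are averaged over short intervals, which preserves all hypotheses. The semigroup is
  continuous in \<open>L\<^sup>1\<^sub>l\<^sub>o\<^sub>c\<close>, and the one-sided bound passes to almost everywhere limits
  (\<open>one_sided_lipschitz_representative\<close>).
\<close>

section \<open>Translations and averages of integrable functions\<close>

lemma integrable_translate:
  fixes f :: "real \<Rightarrow> real"
  assumes "integrable lborel f"
  shows "integrable lborel (\<lambda>x. f (x + h))"
  using lborel_integrable_real_affine[OF assms, of 1 h] by (simp add: add.commute)

lemma integral_translate:
  fixes f :: "real \<Rightarrow> real"
  shows "(LINT x|lborel. f (x + h)) = (LINT x|lborel. f x)"
  using lborel_integral_real_affine[of 1 f h] by (simp add: add.commute)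

lemma integrable_reflect:
  fixes f :: "real \<Rightarrow> real"
  assumes "integrable lborel f"
  shows "integrable lborel (\<lambda>y. f (x - y))"
  using lborel_integrable_real_affine[OF assms, of "-1" x] by simp

lemma integral_reflect:
  fixes f :: "real \<Rightarrow> real"
  shows "(LINT y|lborel. f (x - y)) = (LINT y|lborel. f y)"
  using lborel_integral_real_affine[of "-1" f x] by simp

definition L1_continuous :: "(real \<Rightarrow> real) \<Rightarrow> bool" where
  "L1_continuous f \<longleftrightarrow> (\<forall>h. h \<longlonglongrightarrow> 0 \<longrightarrow> (\<lambda>n::nat. LINT x|lborel. \<bar>f (x + h n) - f x\<bar>) \<longlonglongrightarrow> 0)"

lemma L1_continuous_approx:
  fixes f :: "real \<Rightarrow> real"
  assumes f: "integrable lborel f"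
    and approx: "\<And>e. e > 0 \<Longrightarrow> \<exists>g. integrable lborel g \<and> L1_continuous g \<and> (LINT x|lborel. \<bar>f x - g x\<bar>) < e"
  shows "L1_continuous f"
  unfolding L1_continuous_def
proof (intro allI impI)
  fix h :: "nat \<Rightarrow> real" assume h: "h \<longlonglongrightarrow> 0"
  show "(\<lambda>n. LINT x|lborel. \<bar>f (x + h n) - f x\<bar>) \<longlonglongrightarrow> 0"
  proof (rule LIMSEQ_I)
    fix e :: real assume e: "e > 0"
    then obtain g where g: "integrable lborel g" "L1_continuous g" "(LINT x|lborel. \<bar>f x - g x\<bar>) < e/3"
      using approx[of "e/3"] by auto
    have "(\<lambda>n. LINT x|lborel. \<bar>g (x + h n) - g x\<bar>) \<longlonglongrightarrow> 0"
      using g(2) h by (auto simp: L1_continuous_def)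
    from LIMSEQ_D[OF this, of "e/3"] e obtain N where
      N: "\<And>n. n \<ge> N \<Longrightarrow> \<bar>LINT x|lborel. \<bar>g (x + h n) - g x\<bar>\<bar> < e/3" by auto
    show "\<exists>no. \<forall>n\<ge>no. norm ((LINT x|lborel. \<bar>f (x + h n) - f x\<bar>) - 0) < e"
    proof (intro exI allI impI)
      fix n assume n: "n \<ge> N"
      note [simp] = f g(1) integrable_translate[OF f] integrable_translate[OF g(1)]
      have "(LINT x|lborel. \<bar>f (x + h n) - f x\<bar>) \<le>
        (LINT x|lborel. \<bar>f (x + h n) - g (x + h n)\<bar> + \<bar>g (x + h n) - g x\<bar> + \<bar>f x - g x\<bar>)"
        by (intro integral_mono integrable_abs Bochner_Integration.integrable_add Bochner_Integration.integrable_diff) auto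
      also have "\<dots> = (LINT x|lborel. \<bar>f (x + h n) - g (x + h n)\<bar>) + (LINT x|lborel. \<bar>g (x + h n) - g x\<bar>)
         + (LINT x|lborel. \<bar>f x - g x\<bar>)"
        by (subst Bochner_Integration.integral_add | simp)+
      also have "(LINT x|lborel. \<bar>f (x + h n) - g (x + h n)\<bar>) = (LINT x|lborel. \<bar>f x - g x\<bar>)"
        by (rule integral_translate[where f="\<lambda>x. \<bar>f x - g x\<bar>"])
      finally have "(LINT x|lborel. \<bar>f (x + h n) - f x\<bar>) < e" using g(3) N[OF n] by linarith
      moreover have "(LINT x|lborel. \<bar>f (x + h n) - f x\<bar>) \<ge> 0" by simp
      ultimately show "norm ((LINT x|lborel. \<bar>f (x + h n) - f x\<bar>) - 0) < e" by simp
    qed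
  qed
qed

text \<open>
  The indicator of an open set is lower semicontinuous, so the positive part of
  \<open>1\<^sub>U(x) - 1\<^sub>U(x + h)\<close> tends to \<open>0\<close> pointwise below the integrable function \<open>1\<^sub>U\<close>. The two
  integrals agree, hence the negative part has the same integral.
\<close>

lemma L1_continuous_open:
  assumes "open U" "emeasure lborel U < \<infinity>"
  shows "L1_continuous (\<lambda>x. c * indicator U x)"
  unfolding L1_continuous_def
proof (intro allI impI)
  fix h :: "nat \<Rightarrow> real" assume h: "h \<longlonglongrightarrow> 0"
  let ?I = "indicator U :: real \<Rightarrow> real"
  have [measurable]: "U \<in> sets borel" using assms(1) by simp
  have i: "integrable lborel ?I" using assms by (auto intro!: integrable_real_indicator)
  note [simp] = i integrable_translate[OF i]
  have lim: "(\<lambda>n. LINT x|lborel. max 0 (?I x - ?I (x + h n))) \<longlonglongrightarrow> (LINT x::real|lborel. (0::real))"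
  proof (rule integral_dominated_convergence[where w="?I"])
    show "AE x in lborel. (\<lambda>n. max 0 (?I x - ?I (x + h n))) \<longlonglongrightarrow> 0"
    proof (rule AE_I2)
      fix x :: real
      show "(\<lambda>n. max 0 (?I x - ?I (x + h n))) \<longlonglongrightarrow> 0"
      proof (cases "x \<in> U")
        case True
        have "(\<lambda>n. x + h n) \<longlonglongrightarrow> x" using tendsto_add[OF tendsto_const h, of x] by simp
        then have "\<forall>\<^sub>F n in sequentially. x + h n \<in> U" using assms(1) True by (rule topological_tendstoD)
        then have "\<forall>\<^sub>F n in sequentially. max 0 (?I x - ?I (x + h n)) = 0" by eventually_elim simp
        then show ?thesis by (simp add: tendsto_eventually)
      qed (auto simp: indicator_def)
    qed
  qed (auto simp: indicator_def)
  have eq: "(LINT x|lborel. \<bar>c * ?I (x + h n) - c * ?I x\<bar>) = \<bar>c\<bar> * (2 * (LINT x|lborel. max 0 (?I x - ?I (x + h n))))" for n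
  proof -
    have m: "integrable lborel (\<lambda>x. max 0 (?I x - ?I (x + h n)))"
      by (rule integrable_max) auto
    have "(LINT x|lborel. \<bar>c * ?I (x + h n) - c * ?I x\<bar>) = (LINT x|lborel. \<bar>c\<bar> * (2 * max 0 (?I x - ?I (x + h n)) + (?I (x + h n) - ?I x)))"
      by (intro Bochner_Integration.integral_cong) (auto simp: indicator_def)
    also have "\<dots> = \<bar>c\<bar> * (2 * (LINT x|lborel. max 0 (?I x - ?I (x + h n))) + ((LINT x|lborel. ?I (x + h n)) - (LINT x|lborel. ?I x)))"
      using m by simp
    also have "(LINT x|lborel. ?I (x + h n)) = (LINT x|lborel. ?I x)" by (rule integral_translate)
    finally show ?thesis by simp
  qed
  show "(\<lambda>n. LINT x|lborel. \<bar>c * ?I (x + h n) - c * ?I x\<bar>) \<longlonglongrightarrow> 0"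
    unfolding eq using tendsto_mult[OF tendsto_const tendsto_mult[OF tendsto_const lim], of "\<bar>c\<bar>" 2] by simp
qed

text \<open>
  Translation is continuous in \<open>L\<^sup>1\<close>: outer regularity passes from open to measurable sets, and
  the property is stable under sums and limits in \<open>L\<^sup>1\<close>.
\<close>

lemma integrable_L1_continuous:
  fixes f :: "real \<Rightarrow> real"
  assumes "integrable lborel f"
  shows "L1_continuous f"
  using assms
proof (induction f rule: integrable_induct)
  case (base A c)
  have A[measurable]: "A \<in> sets borel" using base by simp
  have iA: "integrable lborel (indicator A :: real \<Rightarrow> real)" using base by (auto intro!: integrable_real_indicator)
  show ?case
  proof (rule L1_continuous_approx)
    show "integrable lborel (\<lambda>x. indicator A x *\<^sub>R c)" using iA by simp
    fix e :: real assume e: "e > 0"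
    define e' where "e' = e / (\<bar>c\<bar> + 1)"
    have e': "e' > 0" using e by (simp add: e'_def)
    obtain U where U: "open U" "A \<subseteq> U" "emeasure lborel (U - A) < ennreal e'"
      using outer_regular_lborel[OF A e'] by blast
    have [measurable]: "U \<in> sets borel" using U by simp
    have "emeasure lborel U = emeasure lborel A + emeasure lborel (U - A)"
      using U(2) by (subst plus_emeasure) (auto intro: arg_cong[where f="emeasure lborel"])
    then have fU: "emeasure lborel U < \<infinity>" using U(3) base(2)
      by (metis ennreal_add_less_top ennreal_less_top infinity_ennreal_def order_less_trans)
    have iU: "integrable lborel (indicator U :: real \<Rightarrow> real)" using fU by (auto intro!: integrable_real_indicator)
    have fD: "emeasure lborel (U - A) < \<infinity>" using U(3) by (metis ennreal_less_top infinity_ennreal_def order_less_trans)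
    have mD: "measure lborel (U - A) < e'" using U(3) fD e'
      by (simp add: emeasure_eq_ennreal_measure ennreal_less_iff)
    have "(LINT x|lborel. \<bar>indicator A x *\<^sub>R c - c * indicator U x\<bar>) = (LINT x|lborel. \<bar>c\<bar> * indicator (U - A) x)"
      using U(2) by (intro Bochner_Integration.integral_cong) (auto simp: indicator_def)
    also have "\<dots> = \<bar>c\<bar> * measure lborel (U - A)" by simp
    also have "\<dots> \<le> \<bar>c\<bar> * e'" using mD by (intro mult_left_mono) auto
    also have "\<dots> < e" using e by (simp add: e'_def field_simps)
    finally show "\<exists>g. integrable lborel g \<and> L1_continuous g \<and> (LINT x|lborel. \<bar>indicator A x *\<^sub>R c - g x\<bar>) < e"
      using L1_continuous_open[OF U(1) fU, of c] iU by (intro exI[of _ "\<lambda>x. c * indicator U x"]) auto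
  qed
next
  case (add f g)
  show ?case
    unfolding L1_continuous_def
  proof (intro allI impI)
    fix h :: "nat \<Rightarrow> real" assume h: "h \<longlonglongrightarrow> 0"
    note [simp] = add.hyps integrable_translate[OF add.hyps(1)] integrable_translate[OF add.hyps(2)]
    have "(\<lambda>n. (LINT x|lborel. \<bar>f (x + h n) - f x\<bar>) + (LINT x|lborel. \<bar>g (x + h n) - g x\<bar>)) \<longlonglongrightarrow> 0 + 0"
      using add.IH h by (intro tendsto_add) (auto simp: L1_continuous_def)
    moreover have "(LINT x|lborel. \<bar>f (x + h n) + g (x + h n) - (f x + g x)\<bar>) \<le>
       (LINT x|lborel. \<bar>f (x + h n) - f x\<bar>) + (LINT x|lborel. \<bar>g (x + h n) - g x\<bar>)" for n
    proof -
      have "(LINT x|lborel. \<bar>f (x + h n) + g (x + h n) - (f x + g x)\<bar>) \<le>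
        (LINT x|lborel. \<bar>f (x + h n) - f x\<bar> + \<bar>g (x + h n) - g x\<bar>)"
        by (intro integral_mono integrable_abs Bochner_Integration.integrable_add Bochner_Integration.integrable_diff) simp_all
      also have "\<dots> = (LINT x|lborel. \<bar>f (x + h n) - f x\<bar>) + (LINT x|lborel. \<bar>g (x + h n) - g x\<bar>)"
        by (intro Bochner_Integration.integral_add integrable_abs Bochner_Integration.integrable_diff) simp_all
      finally show ?thesis .
    qed
    ultimately show "(\<lambda>n. LINT x|lborel. \<bar>f (x + h n) + g (x + h n) - (f x + g x)\<bar>) \<longlonglongrightarrow> 0"
      using Lim_null_comparison[of "\<lambda>n. LINT x|lborel. \<bar>f (x + h n) + g (x + h n) - (f x + g x)\<bar>"
          "\<lambda>n. (LINT x|lborel. \<bar>f (x + h n) - f x\<bar>) + (LINT x|lborel. \<bar>g (x + h n) - g x\<bar>)" sequentially]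
      by simp
  qed
next
  case (lim f s)
  show ?case
  proof (rule L1_continuous_approx)
    show "integrable lborel f" by fact
    fix e :: real assume e: "e > 0"
    have [measurable]: "f \<in> borel_measurable borel" using lim.hyps(4) by auto
    have [measurable]: "\<And>i. s i \<in> borel_measurable borel" using lim.hyps(1) by auto
    have "(\<lambda>i. LINT x|lborel. \<bar>f x - s i x\<bar>) \<longlonglongrightarrow> (LINT x::real|lborel. (0::real))"
    proof (rule integral_dominated_convergence[where w="\<lambda>x. 3 * \<bar>f x\<bar>"])
      show "AE x in lborel. (\<lambda>i. \<bar>f x - s i x\<bar>) \<longlonglongrightarrow> 0"
      proof (rule AE_I2)
        fix x :: real
        have "(\<lambda>i. s i x) \<longlonglongrightarrow> f x" using lim.hyps(2) by simp
        from tendsto_rabs[OF tendsto_diff[OF tendsto_const this, of "f x"]]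
        show "(\<lambda>i. \<bar>f x - s i x\<bar>) \<longlonglongrightarrow> 0" by simp
      qed
      fix i show "AE x in lborel. norm \<bar>f x - s i x\<bar> \<le> 3 * \<bar>f x\<bar>"
      proof (rule AE_I2)
        fix x :: real have "\<bar>s i x\<bar> \<le> 2 * \<bar>f x\<bar>" using lim.hyps(3)[of x i] by simp
        then show "norm \<bar>f x - s i x\<bar> \<le> 3 * \<bar>f x\<bar>" by simp
      qed
    qed (use lim.hyps(4) in auto)
    from LIMSEQ_D[OF this e] obtain i where "norm ((LINT x|lborel. \<bar>f x - s i x\<bar>) - (LINT x::real|lborel. (0::real))) < e" by auto
    then show "\<exists>g. integrable lborel g \<and> L1_continuous g \<and> (LINT x|lborel. \<bar>f x - g x\<bar>) < e"
      using lim.hyps(1) lim.IH by (intro exI[of _ "s i"]) auto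
  qed
qed

lemma integrable_translation_modulus:
  fixes f :: "real \<Rightarrow> real"
  assumes f: "integrable lborel f" and e: "e > 0"
  obtains d where "d > 0" "\<And>h. \<bar>h\<bar> < d \<Longrightarrow> (LINT x|lborel. \<bar>f (x + h) - f x\<bar>) < e"
proof (rule ccontr)
  note thesisI = that
  assume "\<not> thesis"
  then have *: "\<exists>h. \<bar>h\<bar> < d \<and> (LINT x|lborel. \<bar>f (x + h) - f x\<bar>) \<ge> e" if dp: "d > 0" for d
    using thesisI[OF dp] \<open>\<not> thesis\<close> by (meson linorder_not_less)
  then have "\<exists>h. \<bar>h\<bar> < inverse (real (Suc n)) \<and> (LINT x|lborel. \<bar>f (x + h) - f x\<bar>) \<ge> e" for n
    using *[of "inverse (real (Suc n))"] by simp
  then obtain h where h: "\<And>n. \<bar>h n\<bar> < inverse (real (Suc n))" "\<And>n. (LINT x|lborel. \<bar>f (x + h n) - f x\<bar>) \<ge> e"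
    by metis
  have "h \<longlonglongrightarrow> 0"
    by (rule Lim_null_comparison[OF _ LIMSEQ_inverse_real_of_nat]) (use h(1) in \<open>auto intro!: always_eventually less_imp_le\<close>)
  with integrable_L1_continuous[OF f] have "(\<lambda>n. LINT x|lborel. \<bar>f (x + h n) - f x\<bar>) \<longlonglongrightarrow> 0"
    by (auto simp: L1_continuous_def)
  then have "e \<le> 0" using h(2) by (intro tendsto_lowerbound[of _ 0 sequentially e]) auto
  with e show False by simp
qed

lemma integrable_pair_shift:
  fixes g k :: "real \<Rightarrow> real" and \<sigma> :: real
  assumes g: "integrable lborel g" and k: "integrable lborel k" and \<sigma>: "\<sigma> = 1 \<or> \<sigma> = -1"
  shows "integrable (lborel \<Otimes>\<^sub>M lborel) (\<lambda>(z, s). g z * k (z + \<sigma> * s))"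
proof (rule lborel_pair.Fubini_integrable)
  have [measurable]: "g \<in> borel_measurable borel" "k \<in> borel_measurable borel" using g k by auto
  show "(\<lambda>(z, s). g z * k (z + \<sigma> * s)) \<in> borel_measurable (lborel \<Otimes>\<^sub>M lborel)" by measurable
  have \<sigma>0: "\<sigma> \<noteq> 0" "\<bar>\<sigma>\<bar> = 1" using \<sigma> by auto
  have ik: "integrable lborel (\<lambda>s. k (z + \<sigma> * s))" for z
    using lborel_integrable_real_affine[OF k \<sigma>0(1)] .
  have eq: "(LINT s|lborel. norm (k (z + \<sigma> * s))) = (LINT s|lborel. norm (k s))" for z
    using lborel_integral_real_affine[OF \<sigma>0(1), of "\<lambda>s. norm (k s)" z] \<sigma>0(2) by simp
  show "AE z in lborel. integrable lborel (\<lambda>s. case (z, s) of (z, s) \<Rightarrow> g z * k (z + \<sigma> * s))"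
    using ik by auto
  have "integrable lborel (\<lambda>z. norm (g z) * (LINT s|lborel. norm (k s)))"
    using g by (intro integrable_mult_left integrable_norm)
  then show "integrable lborel (\<lambda>z. LINT s|lborel. norm (case (z, s) of (z, s) \<Rightarrow> g z * k (z + \<sigma> * s)))"
    by (simp add: norm_mult eq del: real_norm_def)
qed

lemma integrable_indicator_Icc: "integrable lborel (indicator {a..b::real} :: real \<Rightarrow> real)"
  by (rule integrable_real_indicator) (auto simp: emeasure_lborel_Icc_eq)

lemma set_integral_translate:
  fixes f :: "real \<Rightarrow> real"
  shows "(LINT z:{x..y}|lborel. f (z - s)) = (LINT z:{x - s..y - s}|lborel. f z)"
proof -
  have "(LINT z:{x..y}|lborel. f (z - s)) = (LINT z|lborel. indicator {x - s..y - s} (z + (- s)) *\<^sub>R f (z + (- s)))"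
    unfolding set_lebesgue_integral_def
    by (intro Bochner_Integration.integral_cong) (auto simp: indicator_def)
  also have "\<dots> = (LINT z:{x - s..y - s}|lborel. f z)"
    unfolding set_lebesgue_integral_def by (rule integral_translate[where f="\<lambda>z. indicator {x - s..y - s} z *\<^sub>R f z"])
  finally show ?thesis .
qed

lemma set_integral_bound_interval:
  fixes f :: "real \<Rightarrow> real"
  assumes "x \<le> y" "\<And>z. x \<le> z \<Longrightarrow> z \<le> y \<Longrightarrow> \<bar>f z\<bar> \<le> c"
  shows "\<bar>LINT z:{x..y}|lborel. f z\<bar> \<le> c * (y - x)"
proof -
  have c: "0 \<le> c" using assms(2)[of x] assms(1) by linarith
  have "\<bar>LINT z:{x..y}|lborel. f z\<bar> \<le> (LINT z|lborel. \<bar>indicator {x..y} z *\<^sub>R f z\<bar>)"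
    unfolding set_lebesgue_integral_def by (rule integral_abs_bound)
  also have "\<dots> \<le> (LINT z|lborel. c * indicator {x..y} z)"
  proof (rule integral_mono_AE')
    show "integrable lborel (\<lambda>z. c * indicator {x..y} z)" using integrable_indicator_Icc by simp
  qed (use assms c in \<open>auto simp: indicator_def\<close>)
  also have "\<dots> = c * (y - x)" using assms(1) by simp
  finally show ?thesis .
qed

definition steklov :: "real \<Rightarrow> (real \<Rightarrow> real) \<Rightarrow> real \<Rightarrow> real" where
  "steklov h f x = (LINT s:{0..h}|lborel. f (x + s)) / h"

text \<open>
  By Fubini the error is an average of the translation errors \<open>\<parallel>f(\<cdot> + s) - f\<parallel>\<close> in \<open>L\<^sup>1\<close> over
  \<open>0 \<le> s \<le> h\<close>.
\<close>

lemma steklov_L1: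
  fixes f :: "real \<Rightarrow> real"
  assumes f: "integrable lborel f" and e: "e > 0"
  obtains d where "d > 0" "\<And>h. 0 < h \<Longrightarrow> h < d \<Longrightarrow>
    (LINT x|lborel. \<bar>steklov h f x - f x\<bar>) \<le> e"
proof -
  obtain d where d: "d > 0" "\<And>h. \<bar>h\<bar> < d \<Longrightarrow> (LINT x|lborel. \<bar>f (x + h) - f x\<bar>) < e"
    using integrable_translation_modulus[OF f e] by blast
  have "(LINT x|lborel. \<bar>(LINT s:{0..h}|lborel. f (x + s)) / h - f x\<bar>) \<le> e" if h: "0 < h" "h < d" for h
  proof -
    let ?I = "indicator {0..h} :: real \<Rightarrow> real"
    have [measurable]: "f \<in> borel_measurable borel" using f by auto
    have iI: "integrable lborel ?I" by (auto intro!: integrable_real_indicator simp: emeasure_lborel_Icc_eq)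
    have p1: "integrable (lborel \<Otimes>\<^sub>M lborel) (\<lambda>(s, x). ?I s * f (s + x))"
      using integrable_pair_shift[OF iI f, of 1] by simp
    have p2: "integrable (lborel \<Otimes>\<^sub>M lborel) (\<lambda>(s, x). ?I s * f x)"
    proof (rule lborel_pair.Fubini_integrable)
      show "integrable lborel (\<lambda>x. LINT y|lborel. norm (case (x, y) of (s, x) \<Rightarrow> indicat_real {0..h} s * f x))"
        using iI by (simp add: abs_mult)
    qed (use f in auto)
    have p3: "integrable (lborel \<Otimes>\<^sub>M lborel) (\<lambda>(s, x). ?I s * \<bar>f (s + x) - f x\<bar>)"
    proof -
      have "integrable (lborel \<Otimes>\<^sub>M lborel) (\<lambda>p. norm ((case p of (s, x) \<Rightarrow> ?I s * f (s + x)) - (case p of (s, x) \<Rightarrow> ?I s * f x)))"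
        by (rule integrable_norm[OF Bochner_Integration.integrable_diff[OF p1 p2]])
      then show ?thesis by (rule Bochner_Integration.integrable_cong[THEN iffD1, rotated 2]) (auto simp: indicator_def)
    qed
    have slice1: "AE x in lborel. integrable lborel (\<lambda>s. ?I s * f (s + x))"
      using lborel_pair.AE_integrable_snd[OF p1] .
    have slice3: "AE x in lborel. integrable lborel (\<lambda>s. ?I s * \<bar>f (s + x) - f x\<bar>)"
      using lborel_pair.AE_integrable_snd[OF p3] .
    have int3: "integrable lborel (\<lambda>x. LINT s|lborel. ?I s * \<bar>f (s + x) - f x\<bar>)"
      using lborel_pair.integrable_snd[OF p3] .
    have "(LINT x|lborel. \<bar>(LINT s:{0..h}|lborel. f (x + s)) / h - f x\<bar>)
       \<le> (LINT x|lborel. (LINT s|lborel. ?I s * \<bar>f (s + x) - f x\<bar>) / h)"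
    proof (rule integral_mono_AE')
      show "integrable lborel (\<lambda>x. (LINT s|lborel. ?I s * \<bar>f (s + x) - f x\<bar>) / h)" using int3 by simp
      show "AE x in lborel. \<bar>(LINT s:{0..h}|lborel. f (x + s)) / h - f x\<bar> \<le> (LINT s|lborel. ?I s * \<bar>f (s + x) - f x\<bar>) / h"
        using slice1 slice3
      proof eventually_elim
        fix x assume i1: "integrable lborel (\<lambda>s. ?I s * f (s + x))" and i3: "integrable lborel (\<lambda>s. ?I s * \<bar>f (s + x) - f x\<bar>)"
        have i2: "integrable lborel (\<lambda>s. ?I s * f x)" using iI by simp
        have "(LINT s|lborel. ?I s * f x) = h * f x" using h by simp
        then have "(LINT s:{0..h}|lborel. f (x + s)) / h - f x = ((LINT s|lborel. ?I s * f (s + x)) - (LINT s|lborel. ?I s * f x)) / h"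
          using h by (simp add: set_lebesgue_integral_def field_simps)
        also have "(LINT s|lborel. ?I s * f (s + x)) - (LINT s|lborel. ?I s * f x) = (LINT s|lborel. ?I s * (f (s + x) - f x))"
          by (subst Bochner_Integration.integral_diff[symmetric, OF i1 i2]) (simp add: algebra_simps)
        finally have "\<bar>(LINT s:{0..h}|lborel. f (x + s)) / h - f x\<bar> = \<bar>LINT s|lborel. ?I s * (f (s + x) - f x)\<bar> / h" using h by simp
        also have "\<bar>LINT s|lborel. ?I s * (f (s + x) - f x)\<bar> \<le> (LINT s|lborel. norm (?I s * (f (s + x) - f x)))"
          using integral_norm_bound[of lborel "\<lambda>s. ?I s * (f (s + x) - f x)"] by simp
        also have "(LINT s|lborel. norm (?I s * (f (s + x) - f x))) = (LINT s|lborel. ?I s * \<bar>f (s + x) - f x\<bar>)"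
          by (simp add: abs_mult)
        finally show "\<bar>(LINT s:{0..h}|lborel. f (x + s)) / h - f x\<bar> \<le> (LINT s|lborel. ?I s * \<bar>f (s + x) - f x\<bar>) / h"
          using h by (simp add: divide_right_mono)
      qed
      show "AE x in lborel. 0 \<le> (LINT s|lborel. ?I s * \<bar>f (s + x) - f x\<bar>) / h"
        using h by (auto intro!: divide_nonneg_pos integral_nonneg_AE)
    qed
    also have "\<dots> = (LINT s|lborel. LINT x|lborel. ?I s * \<bar>f (s + x) - f x\<bar>) / h"
      using lborel_pair.Fubini_integral[OF p3] by simp
    also have "\<dots> = (LINT s|lborel. ?I s * (LINT x|lborel. \<bar>f (s + x) - f x\<bar>)) / h"
      by simp
    also have "(LINT s|lborel. ?I s * (LINT x|lborel. \<bar>f (s + x) - f x\<bar>)) \<le> (LINT s|lborel. ?I s * e)"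
    proof (rule integral_mono_AE')
      show "integrable lborel (\<lambda>s. ?I s * e)" using iI by simp
      show "AE s in lborel. ?I s * (LINT x|lborel. \<bar>f (s + x) - f x\<bar>) \<le> ?I s * e"
      proof (rule AE_I2)
        fix s :: real
        show "?I s * (LINT x|lborel. \<bar>f (s + x) - f x\<bar>) \<le> ?I s * e"
          using d(2)[of s] h by (auto simp: indicator_def add.commute intro: less_imp_le)
      qed
    qed (use e in auto)
    also have "(LINT s|lborel. ?I s * e) / h = e" using h by simp
    finally show ?thesis using h by (simp add: divide_right_mono)
  qed
  with d(1) that show ?thesis unfolding steklov_def by blast
qed

lemma integrable_bounded_mult:
  fixes u k :: "real \<Rightarrow> real"
  assumes u: "u \<in> borel_measurable borel" "\<And>x. \<bar>u x\<bar> \<le> M" and k: "integrable lborel k"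
  shows "integrable lborel (\<lambda>s. u s * k s)"
proof (rule Bochner_Integration.integrable_bound[of _ "\<lambda>s. M * k s"])
  show "integrable lborel (\<lambda>s. M * k s)" using k by simp
  show "(\<lambda>s. u s * k s) \<in> borel_measurable lborel" using u(1) k by auto
  show "AE s in lborel. norm (u s * k s) \<le> norm (M * k s)"
  proof (rule AE_I2)
    fix s show "norm (u s * k s) \<le> norm (M * k s)"
      using u(2)[of s] by (auto simp: abs_mult intro!: mult_right_mono)
  qed
qed

lemma integral_bounded_mult_le:
  fixes u k :: "real \<Rightarrow> real"
  assumes u: "u \<in> borel_measurable borel" "\<And>x. \<bar>u x\<bar> \<le> M" and k: "integrable lborel k"
  shows "\<bar>LINT s|lborel. u s * k s\<bar> \<le> M * (LINT s|lborel. \<bar>k s\<bar>)"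
proof -
  have "\<bar>LINT s|lborel. u s * k s\<bar> \<le> (LINT s|lborel. \<bar>u s * k s\<bar>)"
    by (rule integral_abs_bound)
  also have "\<dots> \<le> (LINT s|lborel. M * \<bar>k s\<bar>)"
    using k u(2) by (intro integral_mono integrable_abs integrable_bounded_mult[OF u k])
      (auto simp: abs_mult intro!: mult_right_mono)
  finally show ?thesis by simp
qed

lemma steklov_abs_le:
  assumes "\<And>x. \<bar>f x\<bar> \<le> M" "0 < h"
  shows "\<bar>steklov h f x\<bar> \<le> M"
  using set_integral_bound_interval[of 0 h "\<lambda>s. f (x + s)" M] assms
  by (simp add: steklov_def pos_divide_le_eq)

lemma steklov_L1loc_tendsto:
  assumes f: "f \<in> borel_measurable borel" "\<And>x. \<bar>f x\<bar> \<le> M"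
  shows "L1loc_tendsto (\<lambda>n. steklov (inverse (real (Suc n))) f) f"
  unfolding L1loc_tendsto_def
proof
  fix R :: real
  let ?h = "\<lambda>n. inverse (real (Suc n))"
  have [measurable]: "f \<in> borel_measurable borel" by fact
  define g where "g x = indicator {-R..R + 1} x * f x" for x
  have gi: "integrable lborel g"
    unfolding g_def using integrable_bounded_mult[OF f integrable_indicator_Icc] by (simp add: mult.commute)
  have [measurable]: "g \<in> borel_measurable borel" using gi by auto
  have Ai: "integrable lborel (\<lambda>x. steklov (?h n) g x)" for n
  proof -
    have "integrable (lborel \<Otimes>\<^sub>M lborel) (\<lambda>(s, x). indicator {0..?h n} s * g (s + 1 * x))"
      by (rule integrable_pair_shift[OF integrable_indicator_Icc gi]) simp
    from lborel_pair.integrable_snd[OF this] show ?thesis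
      by (simp add: steklov_def set_lebesgue_integral_def add.commute)
  qed
  have bound: "(LINT x:{-R..R}|lborel. \<bar>steklov (?h n) f x - f x\<bar>) \<le> (LINT x|lborel. \<bar>steklov (?h n) g x - g x\<bar>)" for n
    unfolding set_lebesgue_integral_def
  proof (rule integral_mono_AE')
    show "integrable lborel (\<lambda>x. \<bar>steklov (?h n) g x - g x\<bar>)" using Ai gi by auto
    show "AE x in lborel. indicator {-R..R} x *\<^sub>R \<bar>steklov (?h n) f x - f x\<bar> \<le> \<bar>steklov (?h n) g x - g x\<bar>"
    proof (rule AE_I2)
      fix x :: real
      show "indicator {-R..R} x *\<^sub>R \<bar>steklov (?h n) f x - f x\<bar> \<le> \<bar>steklov (?h n) g x - g x\<bar>"
      proof (cases "x \<in> {-R..R}")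
        case True
        have "?h n \<le> 1" by (simp add: inverse_le_1_iff)
        then have "(LINT s:{0..?h n}|lborel. g (x + s)) = (LINT s:{0..?h n}|lborel. f (x + s))"
          unfolding set_lebesgue_integral_def
          by (intro Bochner_Integration.integral_cong) (use True in \<open>auto simp: indicator_def g_def\<close>)
        moreover have "g x = f x" using True by (simp add: g_def)
        ultimately show ?thesis using True by (simp add: steklov_def)
      qed simp
    qed
  qed simp
  have lim: "(\<lambda>n. LINT x|lborel. \<bar>steklov (?h n) g x - g x\<bar>) \<longlonglongrightarrow> 0"
  proof (rule LIMSEQ_I)
    fix e :: real assume e: "0 < e"
    then have "0 < e / 2" by simp
    from steklov_L1[OF gi this] obtain d where d: "d > 0" "\<And>h. 0 < h \<Longrightarrow> h < d \<Longrightarrow>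
      (LINT x|lborel. \<bar>steklov h g x - g x\<bar>) \<le> e / 2" by blast
    obtain n0 where n0: "inverse (real (Suc n0)) < d" using reals_Archimedean[OF d(1)] by auto
    show "\<exists>no. \<forall>n\<ge>no. norm ((LINT x|lborel. \<bar>steklov (?h n) g x - g x\<bar>) - 0) < e"
    proof (intro exI allI impI)
      fix n assume n: "n0 \<le> n"
      have "?h n \<le> ?h n0" using n by (intro le_imp_inverse_le) auto
      with n0 have "?h n < d" by linarith
      with d(2)[of "?h n"] have "(LINT x|lborel. \<bar>steklov (?h n) g x - g x\<bar>) \<le> e / 2" by simp
      moreover have "0 \<le> (LINT x|lborel. \<bar>steklov (?h n) g x - g x\<bar>)" by simp
      ultimately show "norm ((LINT x|lborel. \<bar>steklov (?h n) g x - g x\<bar>) - 0) < e" using e by simp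
    qed
  qed
  have nn: "0 \<le> (LINT x:{-R..R}|lborel. \<bar>steklov (?h n) f x - f x\<bar>)" for n
    unfolding set_lebesgue_integral_def by (intro integral_nonneg_AE) auto
  show "(\<lambda>n. LINT x:{-R..R}|lborel. \<bar>steklov (?h n) f x - f x\<bar>) \<longlonglongrightarrow> 0"
    by (rule Lim_null_comparison[OF always_eventually[OF allI] lim]) (use bound nn in simp)
qed

lemma L1loc_tendsto_AE_subseq:
  assumes [measurable]: "\<And>n. fn n \<in> borel_measurable borel" "f \<in> borel_measurable borel"
    and bd: "\<And>n. AE x in lborel. \<bar>fn n x\<bar> \<le> M" "AE x in lborel. \<bar>f x\<bar> \<le> M"
    and lim: "L1loc_tendsto fn f"
  obtains r :: "nat \<Rightarrow> nat" where "strict_mono r"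
    "AE x in lborel. x \<in> {-R..R} \<longrightarrow> (\<lambda>n. fn (r n) x) \<longlonglongrightarrow> f x"
proof -
  let ?I = "indicator {-R..R} :: real \<Rightarrow> real"
  have i: "integrable lborel (\<lambda>x. ?I x * (fn n x - f x))" for n
  proof (rule Bochner_Integration.integrable_bound[OF integrable_mult_right[OF integrable_indicator_Icc]])
    show "AE x in lborel. norm (?I x * (fn n x - f x)) \<le> norm (2 * M * indicator {-R..R} x)"
      using bd(1)[of n] bd(2) by eventually_elim (auto simp: indicator_def)
  qed measurable
  have "(\<lambda>n. LINT x|lborel. norm (?I x * (fn n x - f x))) \<longlonglongrightarrow> 0"
    using lim by (simp add: L1loc_tendsto_def set_lebesgue_integral_def abs_mult)
  from tendsto_L1_AE_subseq[OF i this] obtain r :: "nat \<Rightarrow> nat" where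
    r: "strict_mono r" "AE x in lborel. (\<lambda>n. ?I x * (fn (r n) x - f x)) \<longlonglongrightarrow> 0" by blast
  from r(2) have "AE x in lborel. x \<in> {-R..R} \<longrightarrow> (\<lambda>n. fn (r n) x) \<longlonglongrightarrow> f x"
  proof eventually_elim
    case (elim x)
    show ?case
    proof
      assume "x \<in> {-R..R}"
      with elim have "(\<lambda>n. fn (r n) x - f x) \<longlonglongrightarrow> 0" by simp
      then show "(\<lambda>n. fn (r n) x) \<longlonglongrightarrow> f x" by (rule LIM_zero_cancel)
    qed
  qed
  with r(1) show thesis by (rule that)
qed

text \<open>
  The averages of \<open>f\<close> converge to \<open>f\<close> in \<open>L\<^sup>1\<^sub>l\<^sub>o\<^sub>c\<close>, and therefore almost everywhere along a
  subsequence. If they also converge at every point, the limit is a version of \<open>f\<close>. This is how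
  the trajectories below receive a continuous version.
\<close>

lemma AE_eq_limit_of_averages:
  fixes f v :: "real \<Rightarrow> real"
  assumes f: "f \<in> borel_measurable borel" "\<And>x. \<bar>f x\<bar> \<le> M"
    and lim: "\<And>x. (\<lambda>n. steklov (inverse (real (Suc n))) f x) \<longlonglongrightarrow> v x"
  shows "AE x in lborel. f x = v x"
proof -
  let ?A = "\<lambda>n. steklov (inverse (real (Suc n))) f"
  have [measurable]: "f \<in> borel_measurable borel" by fact
  have Am: "?A n \<in> borel_measurable borel" for n
    unfolding steklov_def[abs_def] set_lebesgue_integral_def by measurable
  have Ab: "\<bar>?A n x\<bar> \<le> M" for n x by (rule steklov_abs_le[OF f(2)]) simp
  have local: "AE x in lborel. x \<in> {-real N..real N} \<longrightarrow> f x = v x" for N :: nat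
  proof -
    obtain r :: "nat \<Rightarrow> nat" where r: "strict_mono r"
      "AE x in lborel. x \<in> {-real N..real N} \<longrightarrow> (\<lambda>n. ?A (r n) x) \<longlonglongrightarrow> f x"
      by (rule L1loc_tendsto_AE_subseq[OF Am f(1) _ _ steklov_L1loc_tendsto[OF f], of M "real N"])
        (use Ab f(2) in auto)
    have "(\<lambda>n. ?A (r n) x) \<longlonglongrightarrow> v x" for x
      using LIMSEQ_subseq_LIMSEQ[OF lim r(1), of x] by (simp only: comp_def)
    with r(2) show ?thesis using LIMSEQ_unique by (auto elim!: eventually_mono)
  qed
  have "AE x in lborel. \<forall>N::nat. x \<in> {-real N..real N} \<longrightarrow> f x = v x"
    unfolding AE_all_countable using local by blast
  then show ?thesis
  proof eventually_elim
    case (elim x)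
    obtain N :: nat where "\<bar>x\<bar> \<le> real N" using real_arch_simple by blast
    then have "x \<in> {-real N..real N}" by auto
    with elim show ?case by blast
  qed
qed

section \<open>Convolutions along paths\<close>

lemma convolution_alt: "convolution u k x = (LINT s|lborel. u s * k (x - s))"
  using integral_reflect[of "\<lambda>y. u (x - y) * k y" x] by (simp add: convolution_def)

lemma convolution_integrable:
  fixes u k :: "real \<Rightarrow> real"
  assumes u: "u \<in> borel_measurable borel" "\<And>x. \<bar>u x\<bar> \<le> M" and k: "integrable lborel k"
  shows "integrable lborel (\<lambda>s. u s * k (x - s))"
  using integrable_bounded_mult[OF u integrable_reflect[OF k]] .

lemma convolution_translate_le:
  fixes u k :: "real \<Rightarrow> real"
  assumes u: "u \<in> borel_measurable borel" "\<And>x. \<bar>u x\<bar> \<le> M" and k: "integrable lborel k"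
  shows "\<bar>convolution u k y - convolution u k x\<bar> \<le> M * (LINT s|lborel. \<bar>k (s + (y - x)) - k s\<bar>)"
proof -
  note i = integrable_reflect[OF k]
  have "convolution u k y - convolution u k x = (LINT s|lborel. u s * (k (y - s) - k (x - s)))"
    unfolding convolution_alt
    by (subst Bochner_Integration.integral_diff[symmetric, OF integrable_bounded_mult[OF u i] integrable_bounded_mult[OF u i]])
      (simp add: algebra_simps)
  also have "\<bar>\<dots>\<bar> \<le> M * (LINT s|lborel. \<bar>k (y - s) - k (x - s)\<bar>)"
    by (intro integral_bounded_mult_le[OF u] Bochner_Integration.integrable_diff i)
  also have "(LINT s|lborel. \<bar>k (y - s) - k (x - s)\<bar>) = (LINT s|lborel. \<bar>k (s + (y - x)) - k s\<bar>)"
    using integral_reflect[of "\<lambda>s. \<bar>k (s + (y - x)) - k s\<bar>" x] by (simp add: algebra_simps)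
  finally show ?thesis .
qed

text \<open>
  A weight \<open>k\<close> in \<open>L\<^sup>1\<close> can be cut off where it or its argument exceeds \<open>N\<close>: the part removed
  is small uniformly in \<open>n\<close> as the functions share the bound \<open>M\<close>, and on the rest \<open>L\<^sup>1\<^sub>l\<^sub>o\<^sub>c\<close>
  convergence applies.
\<close>

lemma L1loc_tendsto_weighted:
  fixes u :: "nat \<Rightarrow> real \<Rightarrow> real" and v k :: "real \<Rightarrow> real"
  assumes u: "\<And>n. u n \<in> borel_measurable borel" "\<And>n x. \<bar>u n x\<bar> \<le> M"
    and v: "v \<in> borel_measurable borel" "\<And>x. \<bar>v x\<bar> \<le> M"
    and lim: "L1loc_tendsto u v" and k: "integrable lborel k"
  shows "(\<lambda>n. LINT s|lborel. \<bar>u n s - v s\<bar> * \<bar>k s\<bar>) \<longlonglongrightarrow> 0"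
proof (rule LIMSEQ_I)
  fix e :: real assume e: "e > 0"
  have [measurable]: "k \<in> borel_measurable borel" "v \<in> borel_measurable borel" "\<And>n. u n \<in> borel_measurable borel"
    using k u v by auto
  have M: "M \<ge> 0" using v(2)[of 0] by linarith
  define A where "A N = {s. \<bar>s\<bar> > real N \<or> \<bar>k s\<bar> > real N}" for N :: nat
  have [measurable]: "A N \<in> sets borel" for N unfolding A_def by measurable
  have "(\<lambda>N. LINT s|lborel. indicator (A N) s * \<bar>k s\<bar>) \<longlonglongrightarrow> (LINT s::real|lborel. (0::real))"
  proof (rule integral_dominated_convergence[where w="\<lambda>s. \<bar>k s\<bar>"])
    show "AE s in lborel. (\<lambda>N. indicator (A N) s * \<bar>k s\<bar>) \<longlonglongrightarrow> 0"
    proof (rule AE_I2)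
      fix s :: real
      obtain N0 :: nat where "\<bar>s\<bar> + \<bar>k s\<bar> < real N0" using reals_Archimedean2 by blast
      then have "\<forall>\<^sub>F N in sequentially. indicator (A N) s * \<bar>k s\<bar> = 0"
        by (intro eventually_sequentiallyI[of N0]) (auto simp: A_def indicator_def)
      then show "(\<lambda>N. indicator (A N) s * \<bar>k s\<bar>) \<longlonglongrightarrow> 0" by (simp add: tendsto_eventually)
    qed
  qed (use k in \<open>auto simp: indicator_def\<close>)
  from LIMSEQ_D[OF this, of "e / (2 * (2 * M + 1))"] e M obtain N where
    N: "\<bar>LINT s|lborel. indicator (A N) s * \<bar>k s\<bar>\<bar> < e / (2 * (2 * M + 1))" by auto
  have "(\<lambda>n. LINT s:{-real N..real N}|lborel. \<bar>u n s - v s\<bar>) \<longlonglongrightarrow> 0" using lim by (simp add: L1loc_tendsto_def)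
  from LIMSEQ_D[OF this, of "e / (2 * (real N + 1))"] e obtain n0 where
    n0: "\<And>n. n \<ge> n0 \<Longrightarrow> \<bar>LINT s:{-real N..real N}|lborel. \<bar>u n s - v s\<bar>\<bar> < e / (2 * (real N + 1))" by auto
  show "\<exists>n0. \<forall>n\<ge>n0. norm ((LINT s|lborel. \<bar>u n s - v s\<bar> * \<bar>k s\<bar>) - 0) < e"
  proof (intro exI allI impI)
    fix n assume n: "n \<ge> n0"
    have b: "\<bar>u n s - v s\<bar> \<le> 2 * M" for s using u(2)[of n s] v(2)[of s] by linarith
    have i1: "integrable lborel (\<lambda>s. indicator {-real N..real N} s * \<bar>u n s - v s\<bar>)"
    proof (rule Bochner_Integration.integrable_bound[of _ "\<lambda>s. 2 * M * indicator {-real N..real N} s"])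
      show "AE s in lborel. norm (indicator {-real N..real N} s * \<bar>u n s - v s\<bar>) \<le> norm (2 * M * indicator {-real N..real N} s)"
        using b M by (auto simp: indicator_def)
    qed auto
    have i2: "integrable lborel (\<lambda>s. indicator (A N) s * \<bar>k s\<bar>)"
      by (rule Bochner_Integration.integrable_bound[OF k]) (auto simp: indicator_def)
    have "(LINT s|lborel. \<bar>u n s - v s\<bar> * \<bar>k s\<bar>) \<le>
       (LINT s|lborel. real N * (indicator {-real N..real N} s * \<bar>u n s - v s\<bar>) + 2 * M * (indicator (A N) s * \<bar>k s\<bar>))"
    proof (rule integral_mono_AE')
      show "integrable lborel (\<lambda>s. real N * (indicator {-real N..real N} s * \<bar>u n s - v s\<bar>) + 2 * M * (indicator (A N) s * \<bar>k s\<bar>))"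
        using i1 i2 by simp
      show "AE s in lborel. \<bar>u n s - v s\<bar> * \<bar>k s\<bar> \<le> real N * (indicator {-real N..real N} s * \<bar>u n s - v s\<bar>) + 2 * M * (indicator (A N) s * \<bar>k s\<bar>)"
      proof (rule AE_I2)
        fix s :: real
        show "\<bar>u n s - v s\<bar> * \<bar>k s\<bar> \<le> real N * (indicator {-real N..real N} s * \<bar>u n s - v s\<bar>) + 2 * M * (indicator (A N) s * \<bar>k s\<bar>)"
        proof (cases "s \<in> A N")
          case True
          then show ?thesis using b[of s] by (auto simp: indicator_def intro!: mult_right_mono add_nonneg_nonneg add_increasing)
        next
          case False
          then have "\<bar>s\<bar> \<le> real N" "\<bar>k s\<bar> \<le> real N" by (auto simp: A_def)
          then show ?thesis using False by (auto simp: indicator_def abs_le_iff mult.commute intro!: mult_right_mono)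
        qed
      qed
    qed (use M in auto)
    also have "\<dots> = real N * (LINT s|lborel. indicator {-real N..real N} s * \<bar>u n s - v s\<bar>) + 2 * M * (LINT s|lborel. indicator (A N) s * \<bar>k s\<bar>)"
      using i1 i2 by simp
    also have "\<dots> \<le> real N * (e / (2 * (real N + 1))) + 2 * M * (e / (2 * (2 * M + 1)))"
      using n0[OF n] N M by (intro add_mono mult_left_mono) (auto simp: set_lebesgue_integral_def)
    also have "\<dots> < e / 2 + e / 2"
    proof (rule add_strict_mono)
      show "real N * (e / (2 * (real N + 1))) < e / 2" using e by (simp add: field_simps)
      show "2 * M * (e / (2 * (2 * M + 1))) < e / 2" using e M by (simp add: divide_simps)
    qed
    finally have "(LINT s|lborel. \<bar>u n s - v s\<bar> * \<bar>k s\<bar>) < e" by simp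
    moreover have "(LINT s|lborel. \<bar>u n s - v s\<bar> * \<bar>k s\<bar>) \<ge> 0" by (intro integral_nonneg_AE) auto
    ultimately show "norm ((LINT s|lborel. \<bar>u n s - v s\<bar> * \<bar>k s\<bar>) - 0) < e" by simp
  qed
qed

text \<open>
  Paths are indexed by all of \<open>\<real>\<close>; a trajectory on \<open>t \<ge> 0\<close> is extended by its initial datum.
  The functions of \<open>(t, x)\<close> built from it are then continuous on the whole plane.
\<close>

definition L1loc_path :: "real \<Rightarrow> (real \<Rightarrow> real \<Rightarrow> real) \<Rightarrow> bool" where
  "L1loc_path M u \<longleftrightarrow> (\<forall>t. u t \<in> borel_measurable borel) \<and> (\<forall>t x. \<bar>u t x\<bar> \<le> M) \<and>
     (\<forall>\<tau> t. \<tau> \<longlonglongrightarrow> t \<longrightarrow> L1loc_tendsto (\<lambda>n. u (\<tau> n)) (u t))"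

lemma L1loc_pathD:
  assumes "L1loc_path M u"
  shows "u t \<in> borel_measurable borel" "\<bar>u t x\<bar> \<le> M" "\<tau> \<longlonglongrightarrow> t \<Longrightarrow> L1loc_tendsto (\<lambda>n. u (\<tau> n)) (u t)"
  using assms by (auto simp: L1loc_path_def)

text \<open>
  Moving \<open>x\<close> costs a translation of the kernel in \<open>L\<^sup>1\<close>, uniformly in \<open>t\<close>; moving \<open>t\<close> at fixed
  \<open>x\<close> is weighted \<open>L\<^sup>1\<^sub>l\<^sub>o\<^sub>c\<close> convergence. So the convolution is jointly continuous even though the
  path is merely measurable in \<open>x\<close>.
\<close>

lemma continuous_convolution_path:
  assumes u: "L1loc_path M u" and k: "integrable lborel k"
  shows "continuous_on UNIV (\<lambda>(t, x). convolution (u t) k x)"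
proof (rule continuous_at_imp_continuous_on, rule ballI)
  fix p :: "real \<times> real"
  obtain t x where p: "p = (t, x)" by (cases p)
  show "isCont (\<lambda>(t, x). convolution (u t) k x) p"
    unfolding continuous_at_sequentially comp_def p
  proof (intro allI impI)
    fix q :: "nat \<Rightarrow> real \<times> real" assume q: "q \<longlonglongrightarrow> (t, x)"
    define \<tau> where "\<tau> n = fst (q n)" for n
    define y where "y n = snd (q n)" for n
    have \<tau>: "\<tau> \<longlonglongrightarrow> t" and y: "y \<longlonglongrightarrow> x" using tendsto_fst[OF q] tendsto_snd[OF q] by (simp_all add: \<tau>_def[abs_def] y_def[abs_def])
    note um = L1loc_pathD[OF u]
    have c1: "(\<lambda>n. M * (LINT s|lborel. \<bar>k (s + (y n - x)) - k s\<bar>)) \<longlonglongrightarrow> M * 0"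
      using integrable_L1_continuous[OF k] LIM_zero[OF y]
      by (intro tendsto_mult tendsto_const) (auto simp: L1_continuous_def)
    have c2: "(\<lambda>n. LINT s|lborel. \<bar>u (\<tau> n) s - u t s\<bar> * \<bar>k (x - s)\<bar>) \<longlonglongrightarrow> 0"
      by (rule L1loc_tendsto_weighted[where M=M]) (use um \<tau> integrable_reflect[OF k] in auto)
    have bound: "\<bar>convolution (u (\<tau> n)) k (y n) - convolution (u t) k x\<bar> \<le>
        M * (LINT s|lborel. \<bar>k (s + (y n - x)) - k s\<bar>) + (LINT s|lborel. \<bar>u (\<tau> n) s - u t s\<bar> * \<bar>k (x - s)\<bar>)" for n
    proof -
      have "convolution (u (\<tau> n)) k x - convolution (u t) k x = (LINT s|lborel. (u (\<tau> n) s - u t s) * k (x - s))"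
        unfolding convolution_alt
        by (subst Bochner_Integration.integral_diff[symmetric, OF convolution_integrable[OF um(1,2) k] convolution_integrable[OF um(1,2) k]])
          (simp add: algebra_simps)
      also have "\<bar>\<dots>\<bar> \<le> (LINT s|lborel. \<bar>(u (\<tau> n) s - u t s) * k (x - s)\<bar>)" by (rule integral_abs_bound)
      finally have "\<bar>convolution (u (\<tau> n)) k x - convolution (u t) k x\<bar> \<le> (LINT s|lborel. \<bar>u (\<tau> n) s - u t s\<bar> * \<bar>k (x - s)\<bar>)"
        by (simp add: abs_mult)
      with convolution_translate_le[OF um(1,2) k, of "\<tau> n" "y n" x] show ?thesis by linarith
    qed
    have c3: "(\<lambda>n. M * (LINT s|lborel. \<bar>k (s + (y n - x)) - k s\<bar>) + (LINT s|lborel. \<bar>u (\<tau> n) s - u t s\<bar> * \<bar>k (x - s)\<bar>)) \<longlonglongrightarrow> 0"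
      using tendsto_add[OF c1 c2] by simp
    have "(\<lambda>n. convolution (u (\<tau> n)) k (y n)) \<longlonglongrightarrow> convolution (u t) k x"
      by (rule LIM_zero_cancel, rule Lim_null_comparison[OF always_eventually[OF allI] c3]) (use bound in simp)
    then show "(\<lambda>n. case q n of (t, x) \<Rightarrow> convolution (u t) k x) \<longlonglongrightarrow> (case (t, x) of (t, x) \<Rightarrow> convolution (u t) k x)"
      by (simp add: \<tau>_def y_def case_prod_beta)
  qed
qed

lemma integral_convolution:
  fixes u k :: "real \<Rightarrow> real"
  assumes u: "u \<in> borel_measurable borel" "\<And>x. \<bar>u x\<bar> \<le> M" and k: "integrable lborel k"
  shows "(LINT z:{x..y}|lborel. convolution u k z) = (LINT s|lborel. u s * (LINT z:{x..y}|lborel. k (z - s)))"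
    and "set_integrable lborel {x..y} (convolution u k)"
proof -
  let ?I = "indicator {x..y} :: real \<Rightarrow> real"
  have [measurable]: "u \<in> borel_measurable borel" "k \<in> borel_measurable borel" using u k by auto
  have iI: "integrable lborel ?I" by (auto intro!: integrable_real_indicator simp: emeasure_lborel_Icc_eq)
  have p: "integrable (lborel \<Otimes>\<^sub>M lborel) (\<lambda>(z, s). ?I z * (u s * k (z - s)))"
  proof (rule Bochner_Integration.integrable_bound)
    show "integrable (lborel \<Otimes>\<^sub>M lborel) (\<lambda>p. M * (case p of (z, s) \<Rightarrow> ?I z * k (z + (-1) * s)))"
      by (intro integrable_mult_right integrable_pair_shift[OF iI k]) auto
    show "AE p in lborel \<Otimes>\<^sub>M lborel. norm (case p of (z, s) \<Rightarrow> ?I z * (u s * k (z - s))) \<le> norm (M * (case p of (z, s) \<Rightarrow> ?I z * k (z + (-1) * s)))"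
    proof (rule AE_I2, safe)
      fix z s :: real
      have "\<bar>u s\<bar> \<le> \<bar>M\<bar>" using u(2)[of s] by linarith
      then show "norm (?I z * (u s * k (z - s))) \<le> norm (M * (?I z * k (z + (-1) * s)))"
        by (auto simp: abs_mult indicator_def intro!: mult_right_mono)
    qed
    show "(\<lambda>(z, s). ?I z * (u s * k (z - s))) \<in> borel_measurable (lborel \<Otimes>\<^sub>M lborel)" by measurable
  qed
  have "(LINT z:{x..y}|lborel. convolution u k z) = (LINT z|lborel. LINT s|lborel. ?I z * (u s * k (z - s)))"
    by (simp add: set_lebesgue_integral_def convolution_alt)
  also have "\<dots> = (LINT s|lborel. LINT z|lborel. ?I z * (u s * k (z - s)))"
    using lborel_pair.Fubini_integral[OF p] by simp
  also have "\<dots> = (LINT s|lborel. u s * (LINT z:{x..y}|lborel. k (z - s)))"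
    by (simp add: set_lebesgue_integral_def mult.left_commute[of _ "u _"])
  finally show "(LINT z:{x..y}|lborel. convolution u k z) = (LINT s|lborel. u s * (LINT z:{x..y}|lborel. k (z - s)))" .
  show "set_integrable lborel {x..y} (convolution u k)"
    using lborel_pair.integrable_fst[OF p] by (simp add: set_integrable_def convolution_alt)
qed

section \<open>The derivative of a monotone kernel\<close>

lemma continuous_antiderivative:
  fixes f :: "real \<Rightarrow> real"
  assumes f: "continuous_on UNIV f"
  obtains F where "F 0 = 0" "\<And>x. (F has_real_derivative f x) (at x)"
proof -
  let ?F = "\<lambda>x::real. LBINT y=0..x. f y"
  have 0: "?F 0 = 0" by (simp add: interval_integral_endpoints_same[of 0 f] flip: zero_ereal_def)
  have "(?F has_real_derivative f x) (at x)" for x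
  proof -
    let ?r = "\<bar>x\<bar> + 1"
    have "((\<lambda>u. LBINT y=0..u. f y) has_vector_derivative f x) (at x within {-?r..?r})"
      by (rule interval_integral_FTC2[of "-?r" 0 ?r f x, folded zero_ereal_def]) (auto intro: continuous_on_subset[OF f])
    then show ?thesis
      using at_within_Icc_at[of "-?r" x ?r] by (simp add: has_real_derivative_iff_has_vector_derivative abs_if)
  qed
  with 0 show thesis by (rule that[of ?F])
qed

lemma set_integral_antiderivative:
  fixes f F :: "real \<Rightarrow> real"
  assumes "\<And>x. (F has_real_derivative f x) (at x)" "continuous_on UNIV f" "a \<le> b"
  shows "(LINT x:{a..b}|lborel. f x) = F b - F a"
  unfolding set_lebesgue_integral_def
proof (rule integral_FTC_atLeastAtMost[OF assms(3)])
  fix x show "(F has_vector_derivative f x) (at x within {a..b})"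
    using assms(1)[of x] by (meson has_field_derivative_at_within has_real_derivative_iff_has_vector_derivative)
qed (rule continuous_on_subset[OF assms(2)], simp)

text \<open>
  Telescoping: the integral of a difference quotient of \<open>f\<close> is the difference of two difference
  quotients of a primitive of \<open>f\<close>.
\<close>

lemma set_integral_difference_quotient_tendsto:
  fixes f :: "real \<Rightarrow> real"
  assumes f: "continuous_on UNIV f" and ab: "a \<le> b"
  shows "(\<lambda>n. LINT y:{a..b}|lborel. (f (y + inverse (real (Suc n))) - f y) * real (Suc n)) \<longlonglongrightarrow> f b - f a"
proof -
  obtain F where F: "\<And>x. (F has_real_derivative f x) (at x)"
    using continuous_antiderivative[OF f] by blast
  let ?h = "\<lambda>n. inverse (real (Suc n))"
  have eq: "(LINT y:{a..b}|lborel. (f (y + ?h n) - f y) * real (Suc n)) =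
      (F (b + ?h n) - F b) / ?h n - (F (a + ?h n) - F a) / ?h n" for n
  proof -
    have d: "((\<lambda>y. (F (y + ?h n) - F y) * real (Suc n)) has_real_derivative (f (y + ?h n) - f y) * real (Suc n)) (at y)" for y
      by (auto intro!: derivative_eq_intros DERIV_cong[OF DERIV_shift[THEN iffD1, OF F]] F)
    have c: "continuous_on UNIV (\<lambda>y. (f (y + ?h n) - f y) * real (Suc n))"
      by (intro continuous_intros continuous_on_compose2[OF f] f) auto
    have "(LINT y:{a..b}|lborel. (f (y + ?h n) - f y) * real (Suc n)) =
        (F (b + ?h n) - F b) * real (Suc n) - (F (a + ?h n) - F a) * real (Suc n)"
      by (rule set_integral_antiderivative[OF d c ab])
    then show ?thesis by (simp add: field_simps)
  qed
  have lim: "(\<lambda>n. (F (x + ?h n) - F x) / ?h n) \<longlonglongrightarrow> f x" for x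
  proof -
    have "((\<lambda>h. (F (x + h) - F x) / h) \<longlongrightarrow> f x) (at 0)" using F[of x] by (simp add: DERIV_def)
    moreover have "filterlim ?h (at 0) sequentially"
      using LIMSEQ_inverse_real_of_nat by (auto simp: filterlim_at)
    ultimately show ?thesis by (rule filterlim_compose)
  qed
  show ?thesis unfolding eq by (intro tendsto_diff lim)
qed

text \<open>
  The kernel is the integral of its derivative on the negative half-line. Lipschitz continuity
  bounds the difference quotients, so dominated convergence turns convergence almost everywhere
  into the fundamental theorem of calculus. The inequality \<open>k \<le> D k'\<close> with \<open>k \<ge> 0\<close> makes
  \<open>k\<close> nondecreasing, integrability makes it vanish at \<open>-\<infinity>\<close>, and so the density has total mass
  \<open>k(0)\<close>. The truncation \<open>min _ 0\<close> removes the jump of \<open>k\<close> at \<open>0\<close>.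
\<close>

lemma monotone_kernel_density:
  fixes k :: "real \<Rightarrow> real"
  assumes k0: "\<And>x. 0 \<le> k x" and ki: "integrable lborel k"
    and lip: "C-lipschitz_on {..0} k" and D: "D > 0"
    and deriv: "AE y in lborel. y < 0 \<longrightarrow> k differentiable (at y) \<and> k y \<le> D * deriv k y"
  obtains kd where "integrable lborel kd" "\<And>y. 0 \<le> kd y" "\<And>y. 0 \<le> y \<Longrightarrow> kd y = 0"
    "AE y in lborel. y < 0 \<longrightarrow> k y \<le> D * kd y"
    "\<And>a b. a \<le> b \<Longrightarrow> (LINT y:{a..b}|lborel. kd y) = k (min b 0) - k (min a 0)"
    "(LINT y|lborel. kd y) = k 0"
proof -
  define f where "f y = k (min y 0)" for y
  let ?h = "\<lambda>n. inverse (real (Suc n))"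
  let ?q = "\<lambda>n y. (f (y + ?h n) - f y) * real (Suc n)"
  have C: "C \<ge> 0" using lip by (rule lipschitz_on_nonneg)
  have fl: "\<bar>f x - f y\<bar> \<le> C * \<bar>x - y\<bar>" for x y
  proof -
    have "\<bar>f x - f y\<bar> \<le> C * \<bar>min x 0 - min y 0\<bar>"
      using lipschitz_onD[OF lip, of "min x 0" "min y 0"] by (simp add: f_def dist_real_def)
    also have "\<dots> \<le> C * \<bar>x - y\<bar>" using C by (intro mult_left_mono) auto
    finally show ?thesis .
  qed
  have fc: "continuous_on UNIV f"
    by (rule lipschitz_on_continuous_on[of C]) (use fl C in \<open>auto simp: lipschitz_on_def dist_real_def\<close>)
  have [measurable]: "f \<in> borel_measurable borel" using fc by (rule borel_measurable_continuous_onI)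
  have qb: "\<bar>?q n y\<bar> \<le> C" for n y
  proof -
    have "\<bar>?q n y\<bar> = \<bar>f (y + ?h n) - f y\<bar> * real (Suc n)" by (simp add: abs_mult)
    also have "\<dots> \<le> (C * \<bar>y + ?h n - y\<bar>) * real (Suc n)" by (intro mult_right_mono fl) auto
    also have "\<dots> = C" by simp
    finally show ?thesis .
  qed
  define kd where "kd y = (if y < 0 then max 0 (lim (\<lambda>n. ?q n y)) else 0)" for y
  have [measurable]: "(\<lambda>y. lim (\<lambda>n. ?q n y)) \<in> borel_measurable borel"
    by (rule borel_measurable_lim_metric) measurable
  have [measurable]: "kd \<in> borel_measurable borel" unfolding kd_def by measurable
  have kd0: "0 \<le> kd y" for y by (simp add: kd_def)
  have neg: "(\<lambda>n. ?q n y) \<longlonglongrightarrow> kd y \<and> k y \<le> D * kd y" if y: "y < 0" "k differentiable (at y)" "k y \<le> D * deriv k y" for y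
  proof -
    have "DERIV k y :> deriv k y" using y(2) by (simp add: DERIV_deriv_iff_real_differentiable)
    moreover have "\<forall>\<^sub>F z in nhds y. f z = k z"
      using eventually_nhds_in_open[of "{..<0}" y] y(1) by (auto elim!: eventually_mono simp: f_def)
    ultimately have "DERIV f y :> deriv k y" using DERIV_cong_ev[OF refl, of f k y "deriv k y"] by simp
    then have "((\<lambda>h. (f (y + h) - f y) / h) \<longlongrightarrow> deriv k y) (at 0)" by (simp add: DERIV_def)
    moreover have "filterlim ?h (at 0) sequentially"
      using LIMSEQ_inverse_real_of_nat by (auto simp: filterlim_at)
    ultimately have "(\<lambda>n. (f (y + ?h n) - f y) / ?h n) \<longlonglongrightarrow> deriv k y" by (rule filterlim_compose)
    then have l: "(\<lambda>n. ?q n y) \<longlonglongrightarrow> deriv k y" by (simp add: field_simps)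
    have "D * deriv k y \<ge> 0" using k0[of y] y(3) by linarith
    then have "deriv k y \<ge> 0" using D by (simp add: zero_le_mult_iff)
    then have "kd y = deriv k y" using limI[OF l] y(1) by (simp add: kd_def)
    with l y(3) show ?thesis by simp
  qed
  have pos: "(\<lambda>n. ?q n y) \<longlonglongrightarrow> kd y" if "y \<ge> 0" for y using that by (simp add: f_def kd_def add_increasing2)
  have ae: "AE y in lborel. (\<lambda>n. ?q n y) \<longlonglongrightarrow> kd y"
    using deriv
  proof eventually_elim
    case (elim y)
    show ?case
    proof (cases "y < 0")
      case True
      with elim neg[OF True] show ?thesis by blast
    next
      case False
      then show ?thesis by (intro pos) simp
    qed
  qed
  have ftc: "(LINT y:{a..b}|lborel. kd y) = f b - f a" if ab: "a \<le> b" for a b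
  proof -
    have "(\<lambda>n. LINT y:{a..b}|lborel. ?q n y) \<longlonglongrightarrow> (LINT y:{a..b}|lborel. kd y)"
      unfolding set_lebesgue_integral_def
    proof (rule integral_dominated_convergence[where w="\<lambda>y. C * indicator {a..b} y"])
      show "AE y in lborel. (\<lambda>n. indicator {a..b} y *\<^sub>R ?q n y) \<longlonglongrightarrow> indicator {a..b} y *\<^sub>R kd y"
        using ae by eventually_elim (intro tendsto_scaleR tendsto_const)
      show "AE y in lborel. norm (indicator {a..b} y *\<^sub>R ?q n y) \<le> C * indicator {a..b} y" for n
        using qb[where n=n] C by (auto simp: indicator_def)
    qed (auto simp: emeasure_lborel_Icc_eq)
    with set_integral_difference_quotient_tendsto[OF fc ab] show ?thesis
      using LIMSEQ_unique by blast
  qed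
  have kdb: "kd y \<le> C" if "(\<lambda>n. ?q n y) \<longlonglongrightarrow> kd y" for y
    by (rule tendsto_upperbound[OF that always_eventually]) (use abs_le_D1[OF qb] in auto)
  have seti: "set_integrable lborel {a..b} kd" for a b
    unfolding set_integrable_def
  proof (rule Bochner_Integration.integrable_bound[of _ "\<lambda>y. C * indicator {a..b} y"])
    show "AE y in lborel. norm (indicator {a..b} y *\<^sub>R kd y) \<le> norm (C * indicator {a..b} y)"
      using ae
    proof eventually_elim
      case (elim y)
      show ?case using kdb[OF elim] kd0[of y] C by (simp add: indicator_def)
    qed
  qed (auto simp: emeasure_lborel_Icc_eq)
  have mono: "f a \<le> f b" if "a \<le> b" for a b
  proof -
    have "(LINT y:{a..b}|lborel. kd y) \<ge> 0"
      unfolding set_lebesgue_integral_def using kd0 by (intro integral_nonneg_AE) auto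
    with ftc[OF that] show ?thesis by simp
  qed
  (* a nondecreasing nonnegative integrable function is at most (its integral) / n at - n *)
  have vanish: "(\<lambda>n. f (- real n)) \<longlonglongrightarrow> 0"
  proof (rule Lim_null_comparison)
    let ?I = "LINT y|lborel. k y"
    show "\<forall>\<^sub>F n in sequentially. norm (f (- real n)) \<le> ?I * inverse (real n)"
    proof (rule eventually_sequentiallyI[of 1])
      fix n :: nat assume n: "1 \<le> n"
      have "(LINT y|lborel. indicator {- real n..0} y * f (- real n)) \<le> (LINT y|lborel. k y)"
      proof (rule integral_mono_AE'[OF ki])
        show "AE y in lborel. indicator {- real n..0} y * f (- real n) \<le> k y"
        proof (rule AE_I2)
          fix y :: real
          show "indicator {- real n..0} y * f (- real n) \<le> k y"
            using mono[of "- real n" y] k0[of y] by (auto simp: indicator_def f_def split: if_splits)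
        qed
      qed (use k0 in auto)
      then have "real n * f (- real n) \<le> ?I" by simp
      then show "norm (f (- real n)) \<le> ?I * inverse (real n)"
        using n k0 by (simp add: f_def field_simps)
    qed
    show "(\<lambda>n. ?I * inverse (real n)) \<longlonglongrightarrow> 0" using tendsto_mult[OF tendsto_const lim_inverse_n, of ?I] by simp
  qed
  have hb: "has_bochner_integral lborel kd (k 0)"
  proof (rule has_bochner_integral_monotone_convergence[where f="\<lambda>n y. indicator {- real n..0} y *\<^sub>R kd y"])
    show "\<And>n. integrable lborel (\<lambda>y. indicator {- real n..0} y *\<^sub>R kd y)" using seti by (simp add: set_integrable_def)
    show "AE y in lborel. mono (\<lambda>n. indicator {- real n..0} y *\<^sub>R kd y)"
      using kd0 by (auto simp: mono_def indicator_def)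
    show "AE y in lborel. (\<lambda>n. indicator {- real n..0} y *\<^sub>R kd y) \<longlonglongrightarrow> kd y"
    proof (rule AE_I2)
      fix y :: real
      obtain N :: nat where N: "- y \<le> real N" using real_arch_simple by blast
      have "\<forall>\<^sub>F n in sequentially. indicator {- real n..0} y *\<^sub>R kd y = kd y"
        by (rule eventually_sequentiallyI[of N]) (use N in \<open>auto simp: indicator_def kd_def\<close>)
      then show "(\<lambda>n. indicator {- real n..0} y *\<^sub>R kd y) \<longlonglongrightarrow> kd y" by (rule tendsto_eventually)
    qed
    have "(\<lambda>n. f 0 - f (- real n)) \<longlonglongrightarrow> f 0 - 0" by (intro tendsto_diff tendsto_const vanish)
    then show "(\<lambda>n. LINT y|lborel. indicator {- real n..0} y *\<^sub>R kd y) \<longlonglongrightarrow> k 0"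
      using ftc[of "- real n" 0 for n] by (simp add: set_lebesgue_integral_def f_def)
  qed simp
  show thesis
  proof
    show "integrable lborel kd" "(LINT y|lborel. kd y) = k 0"
      using hb by (auto simp: has_bochner_integral_iff)
    show "AE y in lborel. y < 0 \<longrightarrow> k y \<le> D * kd y"
      using deriv by eventually_elim (use neg in blast)
  qed (use kd0 ftc in \<open>auto simp: kd_def f_def\<close>)
qed

section \<open>Differential inequalities\<close>

text \<open>
  Apply the mean value theorem from the last time at which \<open>f\<close> is not positive. All differential
  inequalities below are reduced to this one; the derivative is only needed in the open interval.
\<close>

lemma nonpos_if_nonincreasing_where_positive:
  fixes f f' :: "real \<Rightarrow> real"
  assumes cont: "continuous_on {0..T} f" and init: "f 0 \<le> 0"
    and deriv: "\<And>t. 0 < t \<Longrightarrow> t < T \<Longrightarrow> (f has_real_derivative f' t) (at t)"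
    and decr: "\<And>t. 0 < t \<Longrightarrow> t < T \<Longrightarrow> f t > 0 \<Longrightarrow> f' t \<le> 0"
    and t: "0 \<le> t" "t \<le> T"
  shows "f t \<le> 0"
proof (rule ccontr)
  assume pos: "\<not> f t \<le> 0"
  define A where "A = {s \<in> {0..t}. f s \<in> {..0}}"
  have ct: "continuous_on {0..t} f" using continuous_on_subset[OF cont, of "{0..t}"] t by auto
  have "A = {0..t} \<inter> f -` {..0}" by (auto simp: A_def)
  then have clA: "closed A" using continuous_closed_preimage[OF ct] by simp
  have A0: "0 \<in> A" using init t by (auto simp: A_def)
  have bA: "bdd_above A" by (auto simp: A_def bdd_above_def)
  define s where "s = Sup A"
  have sA: "s \<in> A" unfolding s_def using closed_contains_Sup[OF _ bA clA] A0 by auto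
  then have s: "0 \<le> s" "s \<le> t" "f s \<le> 0" by (auto simp: A_def)
  with pos have "s < t" by (cases "s = t") auto
  have posr: "f r > 0" if "s < r" "r \<le> t" for r
    using cSup_upper[OF _ bA, of r] that s(1) unfolding s_def[symmetric] by (fastforce simp: A_def)
  have diff: "f differentiable (at x)" if "s < x" "x < t" for x
    using deriv[of x] that s t by (auto simp: real_differentiable_def)
  have "\<exists>l z. s < z \<and> z < t \<and> DERIV f z :> l \<and> f t - f s = (t - s) * l"
    by (rule MVT[OF \<open>s < t\<close> _ diff]) (use s t in \<open>auto intro!: continuous_on_subset[OF cont]\<close>)
  then obtain l z where z: "s < z" "z < t" "DERIV f z :> l" "f t - f s = (t - s) * l" by blast
  have "l = f' z" using DERIV_unique[OF z(3) deriv] z s t by auto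
  then have "l \<le> 0" using decr[of z] posr[of z] z s t by auto
  then have "(t - s) * l \<le> 0" using \<open>s < t\<close> by (simp add: mult_le_0_iff)
  with z(4) s(3) pos show False by linarith
qed

lemma gronwall_affine:
  fixes f f' :: "real \<Rightarrow> real"
  assumes cont: "continuous_on {0..T} f"
    and deriv: "\<And>t. 0 < t \<Longrightarrow> t < T \<Longrightarrow> (f has_real_derivative f' t) (at t)"
    and bound: "\<And>t. 0 < t \<Longrightarrow> t < T \<Longrightarrow> f t > 0 \<Longrightarrow> f' t \<le> K * f t + w"
    and K: "0 \<le> K" and w: "0 \<le> w" and f0: "f 0 \<le> c" "0 \<le> c"
    and t: "0 \<le> t" "t \<le> T"
  shows "f t \<le> (c + w * t) * exp (K * t)"
proof -
  let ?g = "\<lambda>t. exp (- K * t) * f t - c - w * t"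
  have "?g t \<le> 0"
  proof (rule nonpos_if_nonincreasing_where_positive[where f'="\<lambda>t. exp (- K * t) * (f' t - K * f t) - w", OF _ _ _ _ t])
    show "continuous_on {0..T} ?g" by (intro continuous_intros cont)
    show "?g 0 \<le> 0" using f0 by simp
    fix s assume s: "0 < s" "s < T"
    show "(?g has_real_derivative exp (- K * s) * (f' s - K * f s) - w) (at s)"
      by (auto intro!: derivative_eq_intros deriv[OF s] simp: algebra_simps)
    assume "0 < ?g s"
    then have "exp (- K * s) * f s > 0" using f0 w s mult_nonneg_nonneg[of w s] by linarith
    then have "f s > 0" by (simp add: zero_less_mult_iff)
    then have "f' s - K * f s \<le> w" using bound[OF s] by simp
    then have "exp (- K * s) * (f' s - K * f s) \<le> exp (- K * s) * w" by (intro mult_left_mono) auto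
    also have "\<dots> \<le> 1 * w" using s K w by (intro mult_right_mono) auto
    finally show "exp (- K * s) * (f' s - K * f s) - w \<le> 0" by simp
  qed
  then have "exp (K * t) * (exp (- K * t) * f t) \<le> exp (K * t) * (c + w * t)"
    by (intro mult_left_mono) auto
  moreover have "exp (K * t) * (exp (- K * t) * f t) = f t" by (simp add: exp_minus)
  ultimately show ?thesis by (metis mult.commute)
qed

text \<open>
  The argument runs on \<open>f\<^sup>2\<close>, whose derivative is controlled whatever the sign of \<open>f\<close>; it shows that
  \<open>f\<close> cannot reach \<open>0\<close>.
\<close>

lemma gronwall_lower:
  fixes f f' :: "real \<Rightarrow> real"
  assumes cont: "continuous_on {0..T} f"
    and deriv: "\<And>t. 0 < t \<Longrightarrow> t < T \<Longrightarrow> (f has_real_derivative f' t) (at t)"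
    and bound: "\<And>t. 0 < t \<Longrightarrow> t < T \<Longrightarrow> \<bar>f' t\<bar> \<le> K * \<bar>f t\<bar>"
    and f0: "f 0 > 0"
    and t: "0 \<le> t" "t \<le> T"
  shows "f t \<ge> f 0 * exp (- K * t)"
proof -
  have sq: "(f 0 * exp (- K * s))\<^sup>2 \<le> (f s)\<^sup>2" if st: "0 \<le> s" "s \<le> T" for s
  proof -
    let ?g = "\<lambda>t. (f 0)\<^sup>2 - exp (2 * K * t) * (f t)\<^sup>2"
    have "?g s \<le> 0"
    proof (rule nonpos_if_nonincreasing_where_positive[where f'="\<lambda>t. - exp (2 * K * t) * (2 * f t * f' t + 2 * K * (f t)\<^sup>2)", OF _ _ _ _ st])
      show "continuous_on {0..T} ?g" by (intro continuous_intros cont)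
      show "?g 0 \<le> 0" by simp
      fix s assume s: "0 < s" "s < T"
      show "(?g has_real_derivative - exp (2 * K * s) * (2 * f s * f' s + 2 * K * (f s)\<^sup>2)) (at s)"
        by (auto intro!: derivative_eq_intros deriv[OF s] simp: algebra_simps power2_eq_square)
      have "\<bar>f s * f' s\<bar> \<le> \<bar>f s\<bar> * (K * \<bar>f s\<bar>)" unfolding abs_mult by (intro mult_left_mono bound s) auto
      then have "\<bar>f s * f' s\<bar> \<le> K * (f s)\<^sup>2" by (simp add: power2_eq_square abs_mult_self_eq mult_ac flip: abs_mult)
      then have "2 * f s * f' s + 2 * K * (f s)\<^sup>2 \<ge> 0" by linarith
      then show "- exp (2 * K * s) * (2 * f s * f' s + 2 * K * (f s)\<^sup>2) \<le> 0" by (simp add: mult_nonneg_nonneg)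
    qed
    then have "exp (- (2 * K * s)) * (f 0)\<^sup>2 \<le> exp (- (2 * K * s)) * (exp (2 * K * s) * (f s)\<^sup>2)"
      by (intro mult_left_mono) auto
    moreover have "exp (- (2 * K * s)) = (exp (- K * s))\<^sup>2" using exp_double[of "- K * s"] by (simp add: mult.assoc)
    moreover have "exp (- (2 * K * s)) * (exp (2 * K * s) * (f s)\<^sup>2) = (f s)\<^sup>2" by (simp add: exp_minus)
    ultimately show ?thesis by (metis power_mult_distrib mult.commute)
  qed
  have nz: "f s \<noteq> 0" if "0 \<le> s" "s \<le> T" for s
  proof
    assume "f s = 0"
    then have "(f 0 * exp (- K * s))\<^sup>2 \<le> 0" using sq[OF that] by simp
    with f0 show False by simp
  qed
  have "f t > 0"
  proof (rule ccontr)
    assume "\<not> f t > 0"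
    then obtain s where "0 \<le> s" "s \<le> t" "f s = 0"
      using IVT2'[of f t 0 0] f0 t continuous_on_subset[OF cont, of "{0..t}"] by fastforce
    with nz[of s] t show False by simp
  qed
  then have "0 \<le> f t" by simp
  with sq[OF t] show ?thesis by (rule power2_le_imp_le)
qed

text \<open>
  A substitute for differentiating a supremum. For a quantity \<open>d\<^sub>i(t)\<close> attached to each
  characteristic, or pair of characteristics, \<open>d\<^sub>i'\<close> is estimated in terms of the supremum of all the
  \<open>d\<^sub>j\<close>. Such an estimate, fed with a bound \<open>B e\<^sup>\<kappa>\<^sup>t\<close> on the family, returns the bound with \<open>B/2\<close>
  once \<open>\<kappa>\<close> is large. Neither attainment nor measurability of the supremum is involved.
\<close>

lemma family_nonpos_by_halving:
  fixes d :: "'i \<Rightarrow> real \<Rightarrow> real"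
  assumes bd: "\<And>i t. i \<in> I \<Longrightarrow> 0 \<le> t \<Longrightarrow> t \<le> T \<Longrightarrow> d i t \<le> B0" and l: "\<kappa> \<ge> 0"
    and halve: "\<And>B i t. 0 \<le> B \<Longrightarrow> (\<And>i t. i \<in> I \<Longrightarrow> 0 \<le> t \<Longrightarrow> t \<le> T \<Longrightarrow> d i t \<le> B * exp (\<kappa> * t)) \<Longrightarrow>
        i \<in> I \<Longrightarrow> 0 \<le> t \<Longrightarrow> t \<le> T \<Longrightarrow> d i t \<le> B / 2 * exp (\<kappa> * t)"
    and i: "i \<in> I" and t: "0 \<le> t" "t \<le> T"
  shows "d i t \<le> 0"
proof -
  define B where "B = max 0 B0"
  have "d i t \<le> B * (1/2) ^ n * exp (\<kappa> * t)" if "i \<in> I" "0 \<le> t" "t \<le> T" for n i t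
    using that
  proof (induction n arbitrary: i t)
    case 0
    have "d i t \<le> B * 1" using bd[OF 0] by (simp add: B_def)
    also have "\<dots> \<le> B * exp (\<kappa> * t)" using 0 l by (intro mult_left_mono) (auto simp: B_def)
    finally show ?case by simp
  next
    case (Suc n)
    have "d i t \<le> (B * (1/2) ^ n) / 2 * exp (\<kappa> * t)"
      by (rule halve[OF _ Suc.IH]) (use Suc.prems in \<open>auto simp: B_def\<close>)
    then show ?case by simp
  qed
  then have "\<And>n. d i t \<le> B * (1/2) ^ n * exp (\<kappa> * t)" using i t by blast
  moreover have "(\<lambda>n. B * (1/2) ^ n * exp (\<kappa> * t)) \<longlonglongrightarrow> B * 0 * exp (\<kappa> * t)"
    by (intro tendsto_intros LIMSEQ_power_zero) simp
  ultimately show ?thesis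
    using LIMSEQ_le_const[of "\<lambda>n. B * (1/2) ^ n * exp (\<kappa> * t)" "B * 0 * exp (\<kappa> * t)" "d i t"] by simp
qed

section \<open>Integral curves of Lipschitz velocity fields\<close>

text \<open>
  Picard iteration for \<open>g(t) = e\<^sup>-\<^sup>l\<^sup>t (X(t) - x)\<close> in the bounded continuous functions. With
  \<open>l = 2 K\<close> the weight makes the iteration a contraction on all of \<open>t \<ge> 0\<close> at once. For \<open>t < 0\<close>
  the iterates are frozen at their value in \<open>0\<close>.
\<close>

lemma flow_curve_exists:
  fixes b :: "real \<Rightarrow> real \<Rightarrow> real"
  assumes cont: "continuous_on UNIV (\<lambda>(t, x). b t x)" and bd: "\<And>t x. \<bar>b t x\<bar> \<le> B"
    and lip: "\<And>t x y. \<bar>b t x - b t y\<bar> \<le> K * \<bar>x - y\<bar>" and K: "K > 0"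
  shows "\<exists>X. X 0 = x \<and> continuous_on {0..} X \<and> (\<forall>t>0. (X has_real_derivative b t (X t)) (at t))"
proof -
  define l where "l = 2 * K"
  have l: "l > 0" using K by (simp add: l_def)
  have B: "B \<ge> 0" using bd[of 0 0] by linarith
  define P where "P g F \<longleftrightarrow> F 0 = 0 \<and> (\<forall>t. (F has_real_derivative b t (x + exp (l * t) * apply_bcontfun g t)) (at t))"
    for g :: "real \<Rightarrow>\<^sub>C real" and F :: "real \<Rightarrow> real"
  have "\<exists>F. P g F" for g
  proof -
    have "continuous_on UNIV (\<lambda>t. (t, x + exp (l * t) * apply_bcontfun g t))" by (intro continuous_intros) auto
    from continuous_on_compose2[OF cont this] have "continuous_on UNIV (\<lambda>t. b t (x + exp (l * t) * apply_bcontfun g t))" by simp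
    from continuous_antiderivative[OF this] obtain F where "F 0 = 0"
      "\<And>t. (F has_real_derivative b t (x + exp (l * t) * apply_bcontfun g t)) (at t)" by blast
    then show ?thesis unfolding P_def by (intro exI[of _ F]) simp
  qed
  then obtain F where F: "\<And>g. P g (F g)" by metis
  then have F0: "F g 0 = 0" and dF: "(F g has_real_derivative b t (x + exp (l * t) * apply_bcontfun g t)) (at t)" for g t
    by (auto simp: P_def)
  have contF: "continuous_on A (F g)" for A g
    by (meson DERIV_isCont continuous_at_imp_continuous_on dF)
  define \<Phi> where "\<Phi> g = (\<lambda>t. exp (- l * max 0 t) * F g (max 0 t))" for g
  have Fb: "\<bar>F g t\<bar> \<le> B * t" if t: "t \<ge> 0" for g t
  proof (cases "t = 0")
    case False
    then have "0 < t" using t by simp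
    from MVT2[OF this, of "F g", OF dF] obtain z where "F g t - F g 0 = (t - 0) * b z (x + exp (l * z) * apply_bcontfun g z)" by blast
    then have "\<bar>F g t\<bar> = t * \<bar>b z (x + exp (l * z) * apply_bcontfun g z)\<bar>" using t by (simp add: F0 abs_mult)
    also have "\<dots> \<le> t * B" using bd t by (intro mult_left_mono) auto
    finally show ?thesis by (simp add: mult.commute)
  qed (simp add: F0)
  have exl: "l * t \<le> exp (l * t)" for t using exp_ge_add_one_self[of "l * t"] by linarith
  have \<Phi>b: "\<Phi> g \<in> bcontfun" for g
  proof (rule bcontfun_normI[of _ "B / l"])
    show "continuous_on UNIV (\<Phi> g)" unfolding \<Phi>_def
      by (intro continuous_intros continuous_on_compose2[OF contF[of UNIV g]]) auto
    fix t :: real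
    define s where "s = max 0 t"
    have s: "s \<ge> 0" by (simp add: s_def)
    have "l * \<bar>F g s\<bar> \<le> l * (B * s)" using Fb[OF s] l by (intro mult_left_mono) auto
    also have "\<dots> \<le> B * exp (l * s)" using mult_left_mono[OF exl[of s] B] by (simp add: mult_ac)
    finally have "exp (- (l * s)) * (l * \<bar>F g s\<bar>) \<le> exp (- (l * s)) * (B * exp (l * s))" by (intro mult_left_mono) auto
    also have "\<dots> = B" by (simp add: mult.left_commute flip: exp_add)
    finally show "norm (\<Phi> g t) \<le> B / l" using l by (simp add: \<Phi>_def s_def[symmetric] abs_mult field_simps)
  qed
  have Fd: "F g t - F h t \<le> K / l * dist g h * exp (l * t)" if t: "t \<ge> 0" for g h t
  proof -
    let ?f = "\<lambda>t. F g t - F h t - K / l * dist g h * exp (l * t)"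
    have "?f t \<le> 0"
    proof (rule nonpos_if_nonincreasing_where_positive[of t ?f "\<lambda>t. b t (x + exp (l * t) * apply_bcontfun g t) - b t (x + exp (l * t) * apply_bcontfun h t) - K * dist g h * exp (l * t)"])
      show "continuous_on {0..t} ?f" by (intro continuous_intros contF)
      show "?f 0 \<le> 0" using K l by (simp add: F0)
      fix s
      show "(?f has_real_derivative b s (x + exp (l * s) * apply_bcontfun g s) - b s (x + exp (l * s) * apply_bcontfun h s) - K * dist g h * exp (l * s)) (at s)"
        using l by (auto intro!: derivative_eq_intros dF)
      have "b s (x + exp (l * s) * apply_bcontfun g s) - b s (x + exp (l * s) * apply_bcontfun h s)
         \<le> K * \<bar>(x + exp (l * s) * apply_bcontfun g s) - (x + exp (l * s) * apply_bcontfun h s)\<bar>"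
        using lip abs_le_D1 by blast
      also have "\<dots> = K * (exp (l * s) * dist (apply_bcontfun g s) (apply_bcontfun h s))"
        by (simp add: dist_real_def abs_mult flip: right_diff_distrib)
      also have "\<dots> \<le> K * (exp (l * s) * dist g h)"
        using K by (intro mult_left_mono dist_bounded) auto
      finally show "b s (x + exp (l * s) * apply_bcontfun g s) - b s (x + exp (l * s) * apply_bcontfun h s) - K * dist g h * exp (l * s) \<le> 0"
        by (simp add: mult_ac)
    qed (use t in auto)
    then show ?thesis by simp
  qed
  have "dist (Bcontfun (\<Phi> g)) (Bcontfun (\<Phi> h)) \<le> 1/2 * dist g h" for g h
  proof (rule dist_bound)
    fix t :: real
    define s where "s = max 0 t"
    have s: "s \<ge> 0" by (simp add: s_def)
    have "\<bar>F g s - F h s\<bar> \<le> K / l * dist g h * exp (l * s)"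
      using Fd[OF s, of g h] Fd[OF s, of h g] by (simp add: dist_commute abs_le_iff)
    then have "\<bar>F g s - F h s\<bar> \<le> 1/2 * dist g h * exp (l * s)" using K by (simp add: l_def)
    then have "exp (- (l * s)) * \<bar>F g s - F h s\<bar> \<le> exp (- (l * s)) * (1/2 * dist g h * exp (l * s))" by (intro mult_left_mono) auto
    also have "\<dots> = 1/2 * dist g h" by (simp add: mult.left_commute mult.assoc flip: exp_add)
    finally show "dist (apply_bcontfun (Bcontfun (\<Phi> g)) t) (apply_bcontfun (Bcontfun (\<Phi> h)) t) \<le> 1/2 * dist g h"
      unfolding Bcontfun_inverse[OF \<Phi>b]
      by (simp add: \<Phi>_def s_def[symmetric] dist_real_def abs_mult flip: right_diff_distrib)
  qed
  then have "\<exists>!g. Bcontfun (\<Phi> g) = g" by (intro banach_fix_type[of "1/2"]) simp_all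
  then obtain g where g: "Bcontfun (\<Phi> g) = g" by blast
  have gt: "exp (l * t) * apply_bcontfun g t = F g t" if "t \<ge> 0" for t
  proof -
    have "apply_bcontfun g t = \<Phi> g t" using g Bcontfun_inverse[OF \<Phi>b] by metis
    then show ?thesis using that by (simp add: \<Phi>_def max_def flip: exp_add mult.assoc)
  qed
  show ?thesis
  proof (intro exI[of _ "\<lambda>t. x + F g t"] conjI allI impI)
    show "continuous_on {0..} (\<lambda>t. x + F g t)" by (intro continuous_intros contF)
    fix t :: real assume "t > 0"
    then show "((\<lambda>t. x + F g t) has_real_derivative b t (x + F g t)) (at t)"
      using dF[of g t] gt[of t] by (auto intro!: derivative_eq_intros)
  qed (simp add: F0)
qed

section \<open>Smooth functions of compact support\<close>

text \<open>
  The one-dimensional counterpart of \<open>Ck_plane\<close>; tensor products of such functions are the only test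
  functions that are used.
\<close>

primrec Ck_line :: "nat \<Rightarrow> (real \<Rightarrow> real) \<Rightarrow> bool" where
  "Ck_line 0 f \<longleftrightarrow> continuous_on UNIV f"
| "Ck_line (Suc n) f \<longleftrightarrow> (\<exists>f'. Ck_line n f' \<and> (\<forall>x. (f has_real_derivative f' x) (at x)))"

definition smooth :: "(real \<Rightarrow> real) \<Rightarrow> bool" where
  "smooth f \<longleftrightarrow> (\<forall>n. Ck_line n f)"

lemma Ck_line_Suc_imp: "Ck_line (Suc n) f \<Longrightarrow> Ck_line n f"
proof (induction n arbitrary: f)
  case 0
  then show ?case by (auto intro!: continuous_at_imp_continuous_on intro: DERIV_isCont)
next
  case (Suc n)
  from Suc.prems obtain f' where "Ck_line (Suc n) f'" "\<forall>x. (f has_real_derivative f' x) (at x)" by auto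
  with Suc.IH[of f'] show ?case by auto
qed

lemma Ck_line_add: "Ck_line n f \<Longrightarrow> Ck_line n g \<Longrightarrow> Ck_line n (\<lambda>x. f x + g x)"
proof (induction n arbitrary: f g)
  case 0
  then show ?case by (auto intro: continuous_intros)
next
  case (Suc n)
  from Suc.prems obtain f' g' where "Ck_line n f'" "\<forall>x. (f has_real_derivative f' x) (at x)"
    "Ck_line n g'" "\<forall>x. (g has_real_derivative g' x) (at x)" by auto
  then show ?case using Suc.IH[of f' g'] by (auto intro!: exI[of _ "\<lambda>x. f' x + g' x"] DERIV_add)
qed

lemma Ck_line_mult: "Ck_line n f \<Longrightarrow> Ck_line n g \<Longrightarrow> Ck_line n (\<lambda>x. f x * g x)"
proof (induction n arbitrary: f g)
  case 0
  then show ?case by (auto intro: continuous_intros)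
next
  case (Suc n)
  from Suc.prems obtain f' g' where 1: "Ck_line n f'" "\<forall>x. (f has_real_derivative f' x) (at x)"
    "Ck_line n g'" "\<forall>x. (g has_real_derivative g' x) (at x)" by auto
  have "Ck_line n (\<lambda>x. f' x * g x + f x * g' x)"
    using Suc.prems[THEN Ck_line_Suc_imp] 1 Suc.IH by (intro Ck_line_add) auto
  moreover have "((\<lambda>x. f x * g x) has_real_derivative f' x * g x + f x * g' x) (at x)" for x
    using 1 by (auto intro!: derivative_eq_intros)
  ultimately show ?case by auto
qed

lemma Ck_line_const: "Ck_line n (\<lambda>x. c)"
proof (induction n arbitrary: c)
  case (Suc n)
  then show ?case by (auto intro!: exI[of _ "\<lambda>x. 0"])
qed simp

lemma Ck_line_affine: "Ck_line n f \<Longrightarrow> Ck_line n (\<lambda>x. f (a * x + b))"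
proof (induction n arbitrary: f)
  case 0
  then show ?case by (auto intro!: continuous_intros continuous_on_compose2[of UNIV f])
next
  case (Suc n)
  from Suc.prems obtain f' where 1: "Ck_line n f'" "\<And>x. (f has_real_derivative f' x) (at x)" by auto
  have "Ck_line n (\<lambda>x. f' (a * x + b) * a)" using 1 Suc.IH by (intro Ck_line_mult Ck_line_const) auto
  moreover have "((\<lambda>x. f (a * x + b)) has_real_derivative f' (a * x + b) * a) (at x)" for x
    by (rule DERIV_chain2[OF 1(2)]) (auto intro!: derivative_eq_intros)
  ultimately show ?case by auto
qed

lemma smooth_derivative:
  assumes "smooth f" "\<And>x. (f has_real_derivative f' x) (at x)"
  shows "smooth f'"
  unfolding smooth_def
proof
  fix n
  have "Ck_line (Suc n) f" using assms(1) by (simp only: smooth_def)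
  then obtain g where g: "Ck_line n g" "\<forall>x. (f has_real_derivative g x) (at x)" by auto
  then have "f' = g" using assms(2) DERIV_unique by blast
  with g show "Ck_line n f'" by simp
qed

lemma smooth_antiderivative:
  assumes "smooth f'" "\<And>x. (f has_real_derivative f' x) (at x)"
  shows "smooth f"
  unfolding smooth_def
proof
  fix n
  have "Ck_line (Suc n) f" using assms by (auto simp: smooth_def)
  then show "Ck_line n f" by (rule Ck_line_Suc_imp)
qed

lemma smooth_continuous: "smooth f \<Longrightarrow> continuous_on UNIV f"
  unfolding smooth_def by (metis Ck_line.simps(1))

lemma poly_mult_exp_minus_tendsto_0:
  fixes q :: "real poly"
  shows "((\<lambda>y. poly q y * exp (- y)) \<longlongrightarrow> 0) at_top"
proof -
  have "((\<lambda>y. \<Sum>i\<le>degree q. coeff q i * (y ^ i / exp y)) \<longlongrightarrow> (\<Sum>i\<le>degree q. coeff q i * 0)) at_top"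
    by (intro tendsto_sum tendsto_mult tendsto_const tendsto_power_div_exp_0)
  then show ?thesis by (simp add: poly_altdef sum_distrib_right exp_minus divide_inverse mult.assoc)
qed

text \<open>
  The functions \<open>p(1/x) e\<^sup>-\<^sup>1\<^sup>/\<^sup>x\<close> on \<open>x > 0\<close> with \<open>p\<close> a polynomial. The class is closed under
  differentiation, also at the origin, which gives smoothness without computing any higher derivative.
\<close>

definition flat_exp :: "real poly \<Rightarrow> real \<Rightarrow> real" where
  "flat_exp p x = (if x > 0 then poly p (inverse x) * exp (- inverse x) else 0)"

lemma DERIV_eventually_eq:
  "(g has_real_derivative D) (at x) \<Longrightarrow> \<forall>\<^sub>F z in nhds x. f z = g z \<Longrightarrow> (f has_real_derivative D) (at x)"
  using DERIV_cong_ev[of x x f g D D] by simp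

lemma flat_exp_derivative:
  "(flat_exp p has_real_derivative flat_exp ([:0, 0, 1:] * (p - pderiv p)) x) (at x)"
proof -
  consider "x > 0" | "x < 0" | "x = 0" by linarith
  then show ?thesis
  proof cases
    case 1
    have "((\<lambda>x. poly p (inverse x) * exp (- inverse x)) has_real_derivative flat_exp ([:0, 0, 1:] * (p - pderiv p)) x) (at x)"
      using 1 by (auto intro!: derivative_eq_intros DERIV_chain2[OF poly_DERIV] simp: flat_exp_def algebra_simps power2_eq_square)
    moreover have "\<forall>\<^sub>F z in nhds x. flat_exp p z = poly p (inverse z) * exp (- inverse z)"
      using eventually_nhds_in_open[of "{0<..}" x] 1 by (auto elim!: eventually_mono simp: flat_exp_def)
    ultimately show ?thesis using DERIV_eventually_eq by blast
  next
    case 2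
    have "\<forall>\<^sub>F z in nhds x. flat_exp p z = 0"
      using eventually_nhds_in_open[of "{..<0}" x] 2 by (auto elim!: eventually_mono simp: flat_exp_def)
    moreover have "((\<lambda>x. 0) has_real_derivative flat_exp ([:0, 0, 1:] * (p - pderiv p)) x) (at x)"
      using 2 by (simp add: flat_exp_def)
    ultimately show ?thesis using DERIV_eventually_eq by blast
  next
    case 3
    have "((\<lambda>h. flat_exp p h / h) \<longlongrightarrow> 0) (at_left 0)"
    proof (rule tendsto_eventually)
      show "\<forall>\<^sub>F h in at_left 0. flat_exp p h / h = 0"
        by (auto simp: eventually_at_filter flat_exp_def)
    qed
    moreover have "((\<lambda>h. flat_exp p h / h) \<longlongrightarrow> 0) (at_right 0)"
    proof -
      have "((\<lambda>h. poly (pCons 0 p) (inverse h) * exp (- inverse h)) \<longlongrightarrow> 0) (at_right 0)"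
        by (rule filterlim_compose[OF poly_mult_exp_minus_tendsto_0 filterlim_inverse_at_top_right])
      moreover have "\<forall>\<^sub>F h in at_right 0. poly (pCons 0 p) (inverse h) * exp (- inverse h) = flat_exp p h / h"
        by (auto simp: eventually_at_filter flat_exp_def field_simps)
      ultimately show ?thesis by (rule Lim_transform_eventually)
    qed
    ultimately have "((\<lambda>h. flat_exp p h / h) \<longlongrightarrow> 0) (at 0)" by (simp add: filterlim_at_split)
    then show ?thesis using 3 by (simp add: DERIV_def flat_exp_def)
  qed
qed

lemma smooth_flat_exp: "smooth (flat_exp p)"
  unfolding smooth_def
proof
  fix n show "Ck_line n (flat_exp p)"
  proof (induction n arbitrary: p)
    case 0
    show ?case using flat_exp_derivative by (auto intro!: continuous_at_imp_continuous_on intro: DERIV_isCont)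
  next
    case (Suc n)
    then show ?case using flat_exp_derivative by auto
  qed
qed

definition bump :: "real \<Rightarrow> real \<Rightarrow> real \<Rightarrow> real" where
  "bump a b x = flat_exp 1 (x - a) * flat_exp 1 (b - x)"

lemma smooth_bump: "smooth (bump a b)"
  unfolding smooth_def
proof
  fix n
  have "Ck_line n (\<lambda>x. flat_exp 1 (1 * x + (- a)) * flat_exp 1 ((-1) * x + b))"
    using smooth_flat_exp by (intro Ck_line_mult Ck_line_affine) (auto simp: smooth_def)
  then show "Ck_line n (bump a b)" by (simp add: bump_def[abs_def])
qed

lemma bump_pos_iff: "bump a b x > 0 \<longleftrightarrow> a < x \<and> x < b"
  and bump_nonneg: "bump a b x \<ge> 0"
  and bump_eq_0: "x \<le> a \<or> b \<le> x \<Longrightarrow> bump a b x = 0"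
  by (auto simp: bump_def flat_exp_def)

lemma integrable_continuous_compact_support:
  fixes f :: "real \<Rightarrow> real"
  assumes "continuous_on UNIV f" "\<And>x. x \<notin> {a..b} \<Longrightarrow> f x = 0"
  shows "integrable lborel f"
proof -
  have "set_integrable lborel {a..b} f"
    by (rule borel_integrable_atLeastAtMost') (rule continuous_on_subset[OF assms(1)], simp)
  moreover have "(\<lambda>x. indicator {a..b} x *\<^sub>R f x) = f"
  proof
    fix x show "indicator {a..b} x *\<^sub>R f x = f x" using assms(2)[of x] by (auto simp: indicator_def)
  qed
  ultimately show ?thesis unfolding set_integrable_def by simp
qed

lemma integral_compact_support:
  fixes f :: "real \<Rightarrow> real"
  assumes "\<And>x. x \<notin> {a..b} \<Longrightarrow> f x = 0"
  shows "(LINT x:{a..b}|lborel. f x) = (LINT x|lborel. f x)"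
  unfolding set_lebesgue_integral_def
  by (intro Bochner_Integration.integral_cong) (use assms in \<open>auto simp: indicator_def\<close>)

lemma bump_integral_pos:
  assumes "a < b"
  shows "(LINT x|lborel. bump a b x) > 0"
proof -
  have i: "integrable lborel (bump a b)"
    by (rule integrable_continuous_compact_support[of _ a b]) (auto intro: smooth_continuous smooth_bump bump_eq_0)
  have "(LINT x|lborel. bump a b x) \<noteq> 0"
  proof
    assume "(LINT x|lborel. bump a b x) = 0"
    then have "AE x in lborel. bump a b x = 0"
      using integral_nonneg_eq_0_iff_AE[OF i] bump_nonneg by simp
    then have "AE x in lborel. x \<notin> {a<..<b}" 
    proof eventually_elim
      case (elim x)
      then show ?case using bump_pos_iff[of a b x] by auto
    qed
    then have "emeasure lborel {a<..<b} = 0" using AE_iff_null_sets[of "{a<..<b}" lborel] by auto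
    with assms show False by simp
  qed
  moreover have "(LINT x|lborel. bump a b x) \<ge> 0" by (simp add: bump_nonneg)
  ultimately show ?thesis by simp
qed

text \<open>
  Both partial derivatives of a tensor product are again tensor products.
\<close>

lemma product_test_function:
  assumes \<theta>: "smooth \<theta>" "\<And>t. t \<notin> {a..b} \<Longrightarrow> \<theta> t = 0" and \<psi>: "smooth \<psi>" "\<And>x. x \<notin> {c..d} \<Longrightarrow> \<psi> x = 0"
  shows "test_function (\<lambda>(t, x). \<theta> t * \<psi> x)"
  unfolding test_function_def
proof (intro conjI allI)
  have "Ck_plane n (\<lambda>p. \<theta> (fst p) * \<psi> (snd p))" if "Ck_line n \<theta>" "Ck_line n \<psi>" for n \<theta> \<psi>
    using that
  proof (induction n arbitrary: \<theta> \<psi>)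
    case 0
    then show ?case by (auto intro!: continuous_intros continuous_on_compose2[of UNIV \<theta>] continuous_on_compose2[of UNIV \<psi>])
  next
    case (Suc n)
    from Suc.prems obtain \<theta>' \<psi>' where 1: "Ck_line n \<theta>'" "\<And>x. (\<theta> has_real_derivative \<theta>' x) (at x)"
      "Ck_line n \<psi>'" "\<And>x. (\<psi> has_real_derivative \<psi>' x) (at x)" by auto
    have "((\<lambda>p. \<theta> (fst p) * \<psi> (snd p)) has_derivative (\<lambda>h. (\<theta>' (fst p) * \<psi> (snd p)) * fst h + (\<theta> (fst p) * \<psi>' (snd p)) * snd h)) (at p)" for p
    proof -
      have d1: "((\<lambda>p. \<theta> (fst p)) has_derivative (\<lambda>h. \<theta>' (fst p) * fst h)) (at p)"
        using has_derivative_compose[OF has_derivative_fst[OF has_derivative_ident] 1(2)[unfolded has_field_derivative_def]] .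
      have d2: "((\<lambda>p. \<psi> (snd p)) has_derivative (\<lambda>h. \<psi>' (snd p) * snd h)) (at p)"
        using has_derivative_compose[OF has_derivative_snd[OF has_derivative_ident] 1(4)[unfolded has_field_derivative_def]] .
      show ?thesis
        by (rule has_derivative_eq_rhs[OF has_derivative_mult[OF d1 d2]]) (auto simp: algebra_simps)
    qed
    moreover have "Ck_plane n (\<lambda>p. \<theta>' (fst p) * \<psi> (snd p))" "Ck_plane n (\<lambda>p. \<theta> (fst p) * \<psi>' (snd p))"
      using Suc.IH Suc.prems[THEN Ck_line_Suc_imp] 1 by auto
    ultimately show ?case unfolding Ck_plane.simps
      by (intro exI[of _ "\<lambda>p. \<theta>' (fst p) * \<psi> (snd p)"] exI[of _ "\<lambda>p. \<theta> (fst p) * \<psi>' (snd p)"]) auto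
  qed
  then show "Ck_plane n (\<lambda>(t, x). \<theta> t * \<psi> x)" for n
    using \<theta>(1) \<psi>(1) unfolding smooth_def case_prod_beta by blast
  have "compact ({a..b} \<times> {c..d})" by (intro compact_Times) auto
  moreover have "\<forall>p. p \<notin> {a..b} \<times> {c..d} \<longrightarrow> (case p of (t, x) \<Rightarrow> \<theta> t * \<psi> x) = 0"
    using \<theta>(2) \<psi>(2) by auto
  ultimately show "\<exists>K. compact K \<and> (\<forall>p. p \<notin> K \<longrightarrow> (case p of (t, x) \<Rightarrow> \<theta> t * \<psi> x) = 0)" by blast
qed

section \<open>Kernels that look ahead\<close>

text \<open>
  A rescaled kernel \<open>k\<close> together with the density \<open>kd\<close> of its derivative on the negative
  half-line. The jump of \<open>k\<close> at \<open>0\<close> is not part of \<open>kd\<close>.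
\<close>

locale anticipating_kernel =
  fixes k kd :: "real \<Rightarrow> real" and D :: real
  assumes k_nonneg: "\<And>x. 0 \<le> k x" and k_zero: "\<And>x. 0 < x \<Longrightarrow> k x = 0"
    and k_int: "integrable lborel k" and k_one: "(LINT y|lborel. k y) = 1"
    and kd_nonneg: "\<And>y. 0 \<le> kd y" and kd_int: "integrable lborel kd"
    and kd_zero: "\<And>y. 0 \<le> y \<Longrightarrow> kd y = 0"
    and kd_total: "(LINT y|lborel. kd y) = k 0"
    and kd_prim: "\<And>a b. a \<le> b \<Longrightarrow> (LINT y:{a..b}|lborel. kd y) = k (min b 0) - k (min a 0)"
    and D_pos: "0 < D"
    and k_le_kd: "AE y in lborel. y < 0 \<longrightarrow> k y \<le> D * kd y"
begin

lemma k_measurable[measurable]: "k \<in> borel_measurable borel"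
  and kd_measurable[measurable]: "kd \<in> borel_measurable borel"
  using k_int kd_int by auto

text \<open>
  Integrated form of \<open>(u * k)\<^sub>x = u * kd - k(0) u\<close>; the last term comes from the jump of \<open>k\<close> at
  \<open>0\<close>. In particular \<open>u * k\<close> is Lipschitz for every bounded \<open>u\<close>.
\<close>

lemma convolution_k_increment:
  assumes u: "u \<in> borel_measurable borel" "\<And>x. \<bar>u x\<bar> \<le> M" and xy: "x \<le> y"
  shows "convolution u k y - convolution u k x =
    (LINT z:{x..y}|lborel. convolution u kd z - k 0 * u z)"
proof -
  have [measurable]: "u \<in> borel_measurable borel" by fact
  have iu: "set_integrable lborel {x..y} u"
    unfolding set_integrable_def
  proof (rule Bochner_Integration.integrable_bound[of _ "\<lambda>z. \<bar>M\<bar> * indicator {x..y} z"])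
    show "AE z in lborel. norm (indicator {x..y} z *\<^sub>R u z) \<le> norm (\<bar>M\<bar> * indicator {x..y} z)"
    proof (rule AE_I2)
      fix z show "norm (indicator {x..y} z *\<^sub>R u z) \<le> norm (\<bar>M\<bar> * indicator {x..y} z)"
        using u(2)[of z] by (auto simp: indicator_def)
    qed
  qed (use integrable_indicator_Icc in auto)
  have iuI: "integrable lborel (\<lambda>s. indicator {x..<y} s * u s)"
    unfolding real_scaleR_def[symmetric]
    by (rule set_integrable_subset[OF iu, unfolded set_integrable_def]) auto
  note ik = convolution_integrable[OF u k_int] 
  have "(LINT z:{x..y}|lborel. convolution u kd z) = (LINT s|lborel. u s * (LINT z:{x..y}|lborel. kd (z - s)))"
    by (rule integral_convolution(1)[OF u kd_int])
  also have "\<dots> = (LINT s|lborel. u s * k (y - s) - u s * k (x - s) + k 0 * (indicator {x..<y} s * u s))"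
  proof (rule Bochner_Integration.integral_cong[OF refl])
    fix s :: real
    have "(LINT z:{x..y}|lborel. kd (z - s)) = k (min (y - s) 0) - k (min (x - s) 0)"
      unfolding set_integral_translate using xy by (intro kd_prim) simp
    also have "\<dots> = k (y - s) - k (x - s) + k 0 * indicator {x..<y} s"
      using xy k_zero[of "y - s"] k_zero[of "x - s"] by (auto simp: indicator_def min_def)
    finally have eq: "(LINT z:{x..y}|lborel. kd (z - s)) = k (y - s) - k (x - s) + k 0 * indicator {x..<y} s" .
    show "u s * (LINT z:{x..y}|lborel. kd (z - s)) = u s * k (y - s) - u s * k (x - s) + k 0 * (indicator {x..<y} s * u s)"
      unfolding eq by (simp add: algebra_simps)
  qed
  also have "\<dots> = convolution u k y - convolution u k x + k 0 * (LINT s|lborel. indicator {x..<y} s * u s)"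
    unfolding convolution_alt
    by (simp only: Bochner_Integration.integral_add[OF Bochner_Integration.integrable_diff[OF ik ik] integrable_mult_right[OF iuI]]
      Bochner_Integration.integral_diff[OF ik ik] integral_mult_right_zero)
  also have "(LINT s|lborel. indicator {x..<y} s * u s) = (LINT s:{x..y}|lborel. u s)"
    unfolding set_lebesgue_integral_def
  proof (rule integral_cong_AE)
    show "AE s in lborel. indicator {x..<y} s * u s = indicator {x..y} s *\<^sub>R u s"
      using AE_lborel_singleton[of y] by eventually_elim (auto simp: indicator_def)
  qed auto
  finally have "convolution u k y - convolution u k x =
      (LINT z:{x..y}|lborel. convolution u kd z) - k 0 * (LINT s:{x..y}|lborel. u s)" by simp
  also have "\<dots> = (LINT z:{x..y}|lborel. convolution u kd z) - (LINT s:{x..y}|lborel. k 0 * u s)" by simp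
  also have "\<dots> = (LINT z:{x..y}|lborel. convolution u kd z - k 0 * u z)"
    using integral_convolution(2)[OF u kd_int, of x y] iu by (intro set_integral_diff(2)[symmetric]) auto
  finally show ?thesis .
qed

lemma convolution_bounds:
  assumes u: "u \<in> borel_measurable borel" "\<And>x. a \<le> u x" "\<And>x. u x \<le> c"
    and f: "integrable lborel f" "\<And>x. 0 \<le> f x"
  shows "a * (LINT y|lborel. f y) \<le> convolution u f x" "convolution u f x \<le> c * (LINT y|lborel. f y)"
proof -
  have b: "\<bar>u x\<bar> \<le> \<bar>a\<bar> + \<bar>c\<bar>" for x using u(2)[of x] u(3)[of x] by linarith
  note i = convolution_integrable[OF u(1) b f(1)] and j = integrable_reflect[OF f(1)]
  have "(LINT s|lborel. a * f (x - s)) \<le> convolution u f x"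
    unfolding convolution_alt using i j u f by (intro integral_mono) (auto intro: mult_right_mono)
  then show "a * (LINT y|lborel. f y) \<le> convolution u f x" using integral_reflect[of f x] by simp
  have "convolution u f x \<le> (LINT s|lborel. c * f (x - s))"
    unfolding convolution_alt using i j u f by (intro integral_mono) (auto intro: mult_right_mono)
  then show "convolution u f x \<le> c * (LINT y|lborel. f y)" using integral_reflect[of f x] by simp
qed

end

section \<open>The nonlocal velocity field\<close>

text \<open>
  A trajectory \<open>u\<close> in a version that respects the bounds everywhere. The constants \<open>Q\<close> and
  \<open>Q2\<close> bound \<open>V'\<close> and its Lipschitz constant on \<open>[0, umax]\<close>.
\<close>

locale nonlocal_traffic = anticipating_kernel +
  fixes V V' :: "real \<Rightarrow> real" and umax \<delta> Q Q2 :: real and u :: "real \<Rightarrow> real \<Rightarrow> real"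
  assumes umax_pos: "0 < umax" and \<delta>_pos: "0 < \<delta>"
    and V_deriv: "\<And>w. (V has_real_derivative V' w) (at w)"
    and V'_le: "\<And>w. w \<in> {0..umax} \<Longrightarrow> V' w \<le> - \<delta>"
    and V'_ge: "\<And>w. w \<in> {0..umax} \<Longrightarrow> - Q \<le> V' w"
    and V'_antimono: "\<And>w z. w \<in> {0..umax} \<Longrightarrow> z \<in> {0..umax} \<Longrightarrow> w \<le> z \<Longrightarrow> V' z \<le> V' w"
    and V'_lip: "\<And>w z. w \<in> {0..umax} \<Longrightarrow> z \<in> {0..umax} \<Longrightarrow> \<bar>V' w - V' z\<bar> \<le> Q2 * \<bar>w - z\<bar>"
    and u_path: "L1loc_path umax u" and u_nonneg: "\<And>t x. 0 \<le> u t x"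
    and u_weak: "distributional_solution V k (u 0) u"
begin

abbreviation w :: "real \<Rightarrow> real \<Rightarrow> real" where "w t \<equiv> convolution (u t) k"
abbreviation G :: "real \<Rightarrow> real \<Rightarrow> real" where "G t \<equiv> convolution (u t) kd"
definition b :: "real \<Rightarrow> real \<Rightarrow> real" where "b t x = V (w t x)"
definition B :: real where "B = \<bar>V 0\<bar> + Q * umax"
definition K :: real where "K = Q * (k 0 * umax) + 1"

lemma Q_pos: "0 < Q" using V'_le[of 0] V'_ge[of 0] umax_pos \<delta>_pos by auto

lemma Q2_nonneg: "0 \<le> Q2"
proof -
  have "0 \<le> Q2 * \<bar>0 - umax\<bar>" using V'_lip[of 0 umax] umax_pos by (intro order_trans[OF abs_ge_zero V'_lip]) auto
  then show ?thesis using umax_pos by (simp add: zero_le_mult_iff)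
qed

lemma K_pos: "0 < K"
  using Q_pos k_nonneg[of 0] umax_pos by (simp add: K_def add_nonneg_pos)

lemma u_measurable[measurable]: "u t \<in> borel_measurable borel"
  and u_abs: "\<bar>u t x\<bar> \<le> umax"
  using L1loc_pathD[OF u_path] by auto

lemma u_le: "u t x \<le> umax"
  using u_abs[of t x] by linarith

lemma w_bounds: "w t x \<in> {0..umax}"
  using convolution_bounds[OF u_measurable u_nonneg u_le k_int k_nonneg, of t x] by (simp add: k_one)

lemma G_bounds: "0 \<le> G t x" "G t x \<le> k 0 * umax"
  using convolution_bounds[OF u_measurable u_nonneg u_le kd_int kd_nonneg, of t x] by (simp_all add: kd_total mult.commute)

lemma w_increment:
  "x \<le> y \<Longrightarrow> w t y - w t x = (LINT z:{x..y}|lborel. G t z - k 0 * u t z)"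
  by (rule convolution_k_increment[OF u_measurable u_abs])

lemma w_lipschitz: "\<bar>w t x - w t y\<bar> \<le> k 0 * umax * \<bar>x - y\<bar>"
proof -
  have *: "\<bar>w t y - w t x\<bar> \<le> k 0 * umax * (y - x)" if "x \<le> y" for x y
    unfolding w_increment[OF that]
  proof (rule set_integral_bound_interval[OF that])
    fix z
    have "0 \<le> k 0 * u t z" "k 0 * u t z \<le> k 0 * umax"
      using u_nonneg[of t z] u_le[of t z] k_nonneg[of 0] by (auto intro: mult_left_mono)
    with G_bounds[of t z] show "\<bar>G t z - k 0 * u t z\<bar> \<le> k 0 * umax" by linarith
  qed
  show ?thesis using *[of x y] *[of y x] by (cases "x \<le> y") (auto simp: abs_minus_commute)
qed

lemma V_mvt:
  assumes "x \<in> {0..umax}" "y \<in> {0..umax}"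
  obtains z where "z \<in> {min x y..max x y}" "V y - V x = V' z * (y - x)"
proof -
  consider "x < y" | "x = y" | "y < x" by linarith
  then show thesis
  proof cases
    case 1
    from MVT2[OF this, of V V'] V_deriv obtain z where "x < z" "z < y" "V y - V x = (y - x) * V' z" by blast
    with 1 that[of z] show thesis by (simp add: mult.commute)
  next
    case 2
    with that[of x] show thesis by simp
  next
    case 3
    from MVT2[OF this, of V V'] V_deriv obtain z where "y < z" "z < x" "V x - V y = (x - y) * V' z" by blast
    with 3 that[of z] show thesis by (simp add: algebra_simps)
  qed
qed

lemma V'_abs: "z \<in> {0..umax} \<Longrightarrow> \<bar>V' z\<bar> \<le> Q"
  using V'_le[of z] V'_ge[of z] \<delta>_pos by auto

lemma V_lip:
  assumes "x \<in> {0..umax}" "y \<in> {0..umax}"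
  shows "\<bar>V y - V x\<bar> \<le> Q * \<bar>y - x\<bar>"
proof -
  from V_mvt[OF assms] obtain z where z: "z \<in> {min x y..max x y}" "V y - V x = V' z * (y - x)" by blast
  then have "z \<in> {0..umax}" using assms by auto
  then show ?thesis using V'_abs[of z] by (simp add: z(2) abs_mult mult_right_mono)
qed

lemma b_lipschitz: "\<bar>b t x - b t y\<bar> \<le> K * \<bar>x - y\<bar>"
proof -
  have "\<bar>b t x - b t y\<bar> \<le> Q * \<bar>w t x - w t y\<bar>" unfolding b_def by (rule V_lip[OF w_bounds w_bounds])
  also have "\<dots> \<le> Q * (k 0 * umax * \<bar>x - y\<bar>)" using Q_pos by (intro mult_left_mono w_lipschitz) auto
  also have "\<dots> \<le> K * \<bar>x - y\<bar>" by (simp add: K_def algebra_simps)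
  finally show ?thesis .
qed

lemma b_abs: "\<bar>b t x\<bar> \<le> B"
proof -
  have "\<bar>V (w t x) - V 0\<bar> \<le> Q * \<bar>w t x - 0\<bar>" by (rule V_lip) (use w_bounds umax_pos in auto)
  also have "\<dots> \<le> Q * umax" using Q_pos w_bounds[of t x] by (intro mult_left_mono) auto
  finally show ?thesis by (simp add: b_def B_def)
qed

lemma B_nonneg: "0 \<le> B" using b_abs[of 0 0] by linarith

lemma V_continuous: "continuous_on UNIV V"
  by (meson DERIV_isCont V_deriv continuous_at_imp_continuous_on)

lemma w_continuous: "continuous_on UNIV (\<lambda>(t, x). w t x)"
  by (rule continuous_convolution_path[OF u_path k_int])

lemma G_continuous: "continuous_on UNIV (\<lambda>(t, x). G t x)"
  by (rule continuous_convolution_path[OF u_path kd_int])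

lemma b_continuous: "continuous_on UNIV (\<lambda>(t, x). b t x)"
  using continuous_on_compose2[OF V_continuous w_continuous] by (simp add: b_def case_prod_beta)

lemma continuous_along_curve:
  assumes "continuous_on UNIV (\<lambda>(t, x). f t x)" "continuous_on A p"
  shows "continuous_on A (\<lambda>t. f t (p t))"
  using continuous_on_compose2[OF assms(1), of A "\<lambda>t. (t, p t)"] assms(2) by (simp add: continuous_on_Pair)

lemma b_measurable[measurable]: "b t \<in> borel_measurable borel"
proof -
  have "continuous_on UNIV (\<lambda>x. b t x)"
    using continuous_on_compose2[OF b_continuous, of UNIV "\<lambda>x. (t, x)"] by (simp add: continuous_on_Pair)
  then show ?thesis by (rule borel_measurable_continuous_onI)
qed

text \<open>
  The velocity converges pointwise and boundedly, so the flux inherits \<open>L\<^sup>1\<^sub>l\<^sub>o\<^sub>c\<close> continuity in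
  time from \<open>u\<close>.
\<close>

lemma flux_path: "L1loc_path (umax * B) (\<lambda>t x. u t x * b t x)"
  unfolding L1loc_path_def
proof (intro conjI allI impI)
  show "(\<lambda>x. u t x * b t x) \<in> borel_measurable borel" for t by measurable
  show "\<bar>u t x * b t x\<bar> \<le> umax * B" for t x
    unfolding abs_mult by (intro mult_mono u_abs b_abs) (use umax_pos in auto)
  fix \<tau> :: "nat \<Rightarrow> real" and t assume \<tau>: "\<tau> \<longlonglongrightarrow> t"
  show "L1loc_tendsto (\<lambda>n x. u (\<tau> n) x * b (\<tau> n) x) (\<lambda>x. u t x * b t x)"
    unfolding L1loc_tendsto_def
  proof
    fix R :: real
    let ?I = "indicator {-R..R} :: real \<Rightarrow> real"
    note iI = integrable_indicator_Icc[of "-R" R]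
    have i: "integrable lborel (\<lambda>x. ?I x * f x)" if "f \<in> borel_measurable borel" "\<And>x. \<bar>f x\<bar> \<le> c" for f c
      using integrable_bounded_mult[OF that iI] by (simp add: mult.commute)
    have i1: "integrable lborel (\<lambda>x. ?I x * \<bar>u (\<tau> n) x - u t x\<bar>)" for n
    proof (rule i)
      fix x show "\<bar>\<bar>u (\<tau> n) x - u t x\<bar>\<bar> \<le> 2 * umax" using u_abs[of "\<tau> n" x] u_abs[of t x] by linarith
    qed measurable
    have i2: "integrable lborel (\<lambda>x. ?I x * \<bar>b (\<tau> n) x - b t x\<bar>)" for n
    proof (rule i)
      fix x show "\<bar>\<bar>b (\<tau> n) x - b t x\<bar>\<bar> \<le> 2 * B" using b_abs[of "\<tau> n" x] b_abs[of t x] by linarith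
    qed measurable
    have l1: "(\<lambda>n. LINT x|lborel. ?I x * \<bar>u (\<tau> n) x - u t x\<bar>) \<longlonglongrightarrow> 0"
      using L1loc_pathD(3)[OF u_path \<tau>] by (simp add: L1loc_tendsto_def set_lebesgue_integral_def)
    have l2: "(\<lambda>n. LINT x|lborel. ?I x * \<bar>b (\<tau> n) x - b t x\<bar>) \<longlonglongrightarrow> (LINT x::real|lborel. (0::real))"
    proof (rule integral_dominated_convergence[where w="\<lambda>x. 2 * B * ?I x"])
      show "AE x in lborel. (\<lambda>n. ?I x * \<bar>b (\<tau> n) x - b t x\<bar>) \<longlonglongrightarrow> 0"
      proof (rule AE_I2)
        fix x :: real
        have "continuous_on UNIV (\<lambda>s. b s x)" by (rule continuous_along_curve[OF b_continuous]) simp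
        then have "(\<lambda>n. b (\<tau> n) x) \<longlonglongrightarrow> b t x"
          using \<tau> by (auto simp: continuous_on_eq_continuous_at intro: isCont_tendsto_compose)
        then show "(\<lambda>n. ?I x * \<bar>b (\<tau> n) x - b t x\<bar>) \<longlonglongrightarrow> 0"
          by (intro tendsto_mult_right_zero tendsto_rabs_zero LIM_zero)
      qed
      show "AE x in lborel. norm (?I x * \<bar>b (\<tau> n) x - b t x\<bar>) \<le> 2 * B * ?I x" for n
      proof (rule AE_I2)
        fix x show "norm (?I x * \<bar>b (\<tau> n) x - b t x\<bar>) \<le> 2 * B * ?I x"
          using b_abs[of "\<tau> n" x] b_abs[of t x] by (auto simp: indicator_def)
      qed
    qed (use iI in auto)
    have bound: "(LINT x:{-R..R}|lborel. \<bar>u (\<tau> n) x * b (\<tau> n) x - u t x * b t x\<bar>) \<le>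
       B * (LINT x|lborel. ?I x * \<bar>u (\<tau> n) x - u t x\<bar>) + umax * (LINT x|lborel. ?I x * \<bar>b (\<tau> n) x - b t x\<bar>)" for n
    proof -
      have "(LINT x:{-R..R}|lborel. \<bar>u (\<tau> n) x * b (\<tau> n) x - u t x * b t x\<bar>) \<le>
        (LINT x|lborel. B * (?I x * \<bar>u (\<tau> n) x - u t x\<bar>) + umax * (?I x * \<bar>b (\<tau> n) x - b t x\<bar>))"
        unfolding set_lebesgue_integral_def
      proof (rule integral_mono_AE')
        show "AE x in lborel. ?I x *\<^sub>R \<bar>u (\<tau> n) x * b (\<tau> n) x - u t x * b t x\<bar> \<le> B * (?I x * \<bar>u (\<tau> n) x - u t x\<bar>) + umax * (?I x * \<bar>b (\<tau> n) x - b t x\<bar>)"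
        proof (rule AE_I2)
          fix x :: real
          have split: "u (\<tau> n) x * b (\<tau> n) x - u t x * b t x = b (\<tau> n) x * (u (\<tau> n) x - u t x) + u t x * (b (\<tau> n) x - b t x)"
            by (simp add: algebra_simps)
          have "\<bar>u (\<tau> n) x * b (\<tau> n) x - u t x * b t x\<bar> \<le> \<bar>b (\<tau> n) x\<bar> * \<bar>u (\<tau> n) x - u t x\<bar> + \<bar>u t x\<bar> * \<bar>b (\<tau> n) x - b t x\<bar>"
            unfolding split abs_mult[symmetric] by (rule abs_triangle_ineq)
          also have "\<dots> \<le> B * \<bar>u (\<tau> n) x - u t x\<bar> + umax * \<bar>b (\<tau> n) x - b t x\<bar>"
            by (rule add_mono[OF mult_right_mono[OF b_abs abs_ge_zero] mult_right_mono[OF u_abs abs_ge_zero]])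
          finally have "?I x * \<bar>u (\<tau> n) x * b (\<tau> n) x - u t x * b t x\<bar> \<le> ?I x * (B * \<bar>u (\<tau> n) x - u t x\<bar> + umax * \<bar>b (\<tau> n) x - b t x\<bar>)"
            by (rule mult_left_mono) (rule indicator_pos_le)
          then show "?I x *\<^sub>R \<bar>u (\<tau> n) x * b (\<tau> n) x - u t x * b t x\<bar> \<le> B * (?I x * \<bar>u (\<tau> n) x - u t x\<bar>) + umax * (?I x * \<bar>b (\<tau> n) x - b t x\<bar>)"
            by (simp only: real_scaleR_def distrib_left mult.left_commute[of "?I x"])
        qed
        show "integrable lborel (\<lambda>x. B * (?I x * \<bar>u (\<tau> n) x - u t x\<bar>) + umax * (?I x * \<bar>b (\<tau> n) x - b t x\<bar>))"
          by (intro Bochner_Integration.integrable_add integrable_mult_right i1 i2)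
        show "AE x in lborel. 0 \<le> B * (?I x * \<bar>u (\<tau> n) x - u t x\<bar>) + umax * (?I x * \<bar>b (\<tau> n) x - b t x\<bar>)"
          using B_nonneg umax_pos by (intro AE_I2 add_nonneg_nonneg mult_nonneg_nonneg) auto
      qed
      also have "\<dots> = B * (LINT x|lborel. ?I x * \<bar>u (\<tau> n) x - u t x\<bar>) + umax * (LINT x|lborel. ?I x * \<bar>b (\<tau> n) x - b t x\<bar>)"
        by (simp only: Bochner_Integration.integral_add[OF integrable_mult_right[OF i1] integrable_mult_right[OF i2]] integral_mult_right_zero)
      finally show ?thesis .
    qed
    have nn: "0 \<le> (LINT x:{-R..R}|lborel. \<bar>u (\<tau> n) x * b (\<tau> n) x - u t x * b t x\<bar>)" for n
      unfolding set_lebesgue_integral_def by (intro integral_nonneg_AE) auto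
    have "(\<lambda>n. B * (LINT x|lborel. ?I x * \<bar>u (\<tau> n) x - u t x\<bar>) + umax * (LINT x|lborel. ?I x * \<bar>b (\<tau> n) x - b t x\<bar>)) \<longlonglongrightarrow> B * 0 + umax * 0"
      using l1 l2 by (intro tendsto_add tendsto_mult tendsto_const) simp_all
    then have l3: "(\<lambda>n. B * (LINT x|lborel. ?I x * \<bar>u (\<tau> n) x - u t x\<bar>) + umax * (LINT x|lborel. ?I x * \<bar>b (\<tau> n) x - b t x\<bar>)) \<longlonglongrightarrow> 0"
      by simp
    show "(\<lambda>n. LINT x:{-R..R}|lborel. \<bar>u (\<tau> n) x * b (\<tau> n) x - u t x * b t x\<bar>) \<longlonglongrightarrow> 0"
      by (rule Lim_null_comparison[OF always_eventually[OF allI] l3]) (use bound nn in simp)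
  qed
qed

end

section \<open>The equation in integrated form and its characteristics\<close>

lemma smooth_step_exists:
  fixes \<kappa> :: real
  assumes "0 < \<kappa>"
  obtains \<rho> H :: "real \<Rightarrow> real" where "smooth \<rho>" "\<And>y. 0 \<le> \<rho> y" "\<And>y. y \<notin> {-\<kappa>..\<kappa>} \<Longrightarrow> \<rho> y = 0"
    "integrable lborel \<rho>" "(LINT y|lborel. \<rho> y) = 1" "smooth H" "\<And>y. (H has_real_derivative \<rho> y) (at y)"
    "\<And>y. y \<le> -\<kappa> \<Longrightarrow> H y = 0" "\<And>y. \<kappa> \<le> y \<Longrightarrow> H y = 1" "\<And>y. 0 \<le> H y" "\<And>y. H y \<le> 1"
proof -
  define m where "m = (LINT x|lborel. bump (-\<kappa>) \<kappa> x)"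
  have m: "0 < m" using assms by (simp add: m_def bump_integral_pos)
  define \<rho> where "\<rho> y = inverse m * bump (-\<kappa>) \<kappa> y" for y
  have sm: "smooth \<rho>"
    unfolding smooth_def
  proof
    fix n show "Ck_line n \<rho>" unfolding \<rho>_def[abs_def] using smooth_bump
      by (intro Ck_line_mult Ck_line_const) (auto simp: smooth_def)
  qed
  have nn: "0 \<le> \<rho> y" for y using m by (simp add: \<rho>_def bump_nonneg)
  have z: "\<rho> y = 0" if "y \<notin> {-\<kappa>..\<kappa>}" for y using that by (auto simp: \<rho>_def bump_eq_0)
  have one: "(LINT y|lborel. \<rho> y) = 1" using m by (simp add: \<rho>_def m_def[symmetric])
  have int: "integrable lborel \<rho>"
    by (rule integrable_continuous_compact_support[OF smooth_continuous[OF sm] z])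
  obtain R where R: "\<And>x. (R has_real_derivative \<rho> x) (at x)"
    using continuous_antiderivative[OF smooth_continuous[OF sm]] by blast
  define H where "H y = R y - R (-\<kappa>)" for y
  have dH: "(H has_real_derivative \<rho> y) (at y)" for y
    unfolding H_def[abs_def] by (auto intro!: derivative_eq_intros R)
  note ftc = set_integral_antiderivative[OF dH smooth_continuous[OF sm]]
  have H0: "H (-\<kappa>) = 0" by (simp add: H_def)
  have Hm: "H a \<le> H b" if "a \<le> b" for a b
  proof -
    have "0 \<le> (LINT y:{a..b}|lborel. \<rho> y)"
      unfolding set_lebesgue_integral_def using nn by (intro integral_nonneg_AE) auto
    with ftc[OF that] show ?thesis by simp
  qed
  have Hl: "H y = 0" if "y \<le> -\<kappa>" for y
  proof -
    have "(LINT z:{y..-\<kappa>}|lborel. \<rho> z) = (LINT z:{y..-\<kappa>}|lborel. 0)"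
      unfolding set_lebesgue_integral_def
      by (intro Bochner_Integration.integral_cong) (auto simp: indicator_def \<rho>_def bump_eq_0)
    then show ?thesis using ftc[OF that] H0 by simp
  qed
  have Hr: "H y = 1" if "\<kappa> \<le> y" for y
  proof -
    have "(LINT z:{-\<kappa>..y}|lborel. \<rho> z) = 1"
      unfolding one[symmetric] by (rule integral_compact_support) (use that z in auto)
    then show ?thesis using ftc[of "-\<kappa>" y] that assms H0 by simp
  qed
  have Hn: "0 \<le> H y" for y using Hm[of "-\<kappa>" y] Hl[of y] H0 by (cases "y \<le> -\<kappa>") auto
  have Hu: "H y \<le> 1" for y using Hm[of y \<kappa>] Hr[of \<kappa>] Hr[of y] by (cases "y \<le> \<kappa>") auto
  show thesis
    by (rule that[OF sm nn z int one smooth_antiderivative[OF sm dH] dH Hl Hr Hn Hu])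
qed

lemma integral_path_continuous:
  assumes u: "L1loc_path M u" and \<psi>: "integrable lborel \<psi>"
  shows "continuous_on UNIV (\<lambda>t. LINT x|lborel. u t x * \<psi> x)"
proof -
  have "integrable lborel (\<lambda>r. \<psi> (- r))" using integrable_reflect[OF \<psi>, of 0] by simp
  from continuous_on_compose2[OF continuous_convolution_path[OF u this], of UNIV "\<lambda>t. (t, 0)"]
  show ?thesis by (simp add: convolution_alt continuous_on_Pair)
qed

text \<open>
  Otherwise \<open>h\<close> would have a fixed sign near \<open>t\<close>, and a bump supported there would detect it.
\<close>

lemma zero_if_orthogonal_to_bumps:
  fixes h :: "real \<Rightarrow> real"
  assumes h: "continuous_on UNIV h"
    and orth: "\<And>a b. 0 < a \<Longrightarrow> a < b \<Longrightarrow> (LINT t:{0..b}|lborel. bump a b t * h t) = 0"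
    and t: "0 < t"
  shows "h t = 0"
proof (rule ccontr)
  assume nz: "h t \<noteq> 0"
  define \<sigma> where "\<sigma> = sgn (h t)"
  have \<sigma>: "\<sigma> * h t = \<bar>h t\<bar>" by (simp add: \<sigma>_def abs_sgn mult.commute)
  have "isCont (\<lambda>s. \<sigma> * h s) t" using h by (auto simp: continuous_on_eq_continuous_at)
  then obtain d where d: "d > 0" "\<And>s. \<bar>s - t\<bar> < d \<Longrightarrow> \<bar>\<sigma> * h s - \<sigma> * h t\<bar> < \<bar>h t\<bar> / 2"
    unfolding continuous_at_eps_delta using nz by (metis dist_real_def half_gt_zero zero_less_abs_iff)
  define a where "a = max (t - d) (t / 2)"
  define b where "b = t + d"
  have ab: "0 < a" "a < b" "a < t" "t - d \<le> a" using t d by (auto simp: a_def b_def)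
  have low: "\<bar>h t\<bar> / 2 \<le> \<sigma> * h s" if "a < s" "s < b" for s
  proof -
    have "\<bar>s - t\<bar> < d" using that ab by (auto simp: b_def abs_less_iff)
    from d(2)[OF this] show ?thesis unfolding \<sigma> by linarith
  qed
  have z: "bump a b s * g = 0" if "s \<notin> {0..b}" for s g using that ab by (auto intro: bump_eq_0)
  have cb: "continuous_on UNIV (bump a b)" by (rule smooth_continuous[OF smooth_bump])
  have ib: "integrable lborel (bump a b)"
    by (rule integrable_continuous_compact_support[OF cb, of a b]) (auto intro: bump_eq_0)
  have ih: "integrable lborel (\<lambda>s. bump a b s * h s)"
    by (rule integrable_continuous_compact_support[of _ 0 b]) (use z in \<open>auto intro!: continuous_intros cb h\<close>)
  have "(\<bar>h t\<bar> / 2) * (LINT s|lborel. bump a b s) = (LINT s|lborel. bump a b s * (\<bar>h t\<bar> / 2))" by simp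
  also have "\<dots> \<le> (LINT s|lborel. \<sigma> * (bump a b s * h s))"
  proof (rule integral_mono)
    fix s
    show "bump a b s * (\<bar>h t\<bar> / 2) \<le> \<sigma> * (bump a b s * h s)"
    proof (cases "a < s \<and> s < b")
      case True
      then show ?thesis using mult_left_mono[OF low bump_nonneg, of s a b] by (simp add: mult.left_commute)
    qed (use bump_eq_0 in auto)
  qed (use ib ih in auto)
  also have "\<dots> = \<sigma> * (LINT s:{0..b}|lborel. bump a b s * h s)"
    using integral_compact_support[of 0 b "\<lambda>s. bump a b s * h s"] z by simp
  also have "\<dots> = 0" using orth ab by simp
  finally have "(\<bar>h t\<bar> / 2) * (LINT s|lborel. bump a b s) \<le> 0" .
  moreover have "0 < (LINT s|lborel. bump a b s)" using ab by (intro bump_integral_pos)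
  ultimately show False using nz by (simp add: mult_le_0_iff)
qed

context nonlocal_traffic
begin

text \<open>
  Testing the equation with \<open>\<theta>(t) \<psi>(x)\<close> says that \<open>f' = g\<close> weakly on \<open>t > 0\<close> with initial value
  \<open>f(0)\<close>, where \<open>f\<close> and \<open>g\<close> are the integrals of \<open>u \<psi>\<close> and \<open>u V(w) \<psi>'\<close>. Both are continuous
  in time, so \<open>f - f(0) - \<integral> g\<close> is a continuous function orthogonal to all bumps.
\<close>

lemma integral_u_evolution:
  assumes \<psi>: "smooth \<psi>" "\<And>x. x \<notin> {c..d} \<Longrightarrow> \<psi> x = 0" and d\<psi>: "\<And>x. (\<psi> has_real_derivative \<psi>' x) (at x)"
    and t: "0 < t"
  shows "((\<lambda>t. LINT x|lborel. u t x * \<psi> x) has_real_derivative (LINT x|lborel. u t x * b t x * \<psi>' x)) (at t)"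
proof -
  define f where "f t = (LINT x|lborel. u t x * \<psi> x)" for t
  define g where "g t = (LINT x|lborel. u t x * b t x * \<psi>' x)" for t
  have s\<psi>': "smooth \<psi>'" by (rule smooth_derivative[OF \<psi>(1) d\<psi>])
  have z': "\<psi>' x = 0" if "x \<notin> {c..d}" for x
  proof -
    have "open (- {c..d})" by auto
    then have "\<forall>\<^sub>F y in nhds x. y \<in> - {c..d}" using that by (intro eventually_nhds_in_open) auto
    then have "\<forall>\<^sub>F y in nhds x. \<psi> y = 0" by eventually_elim (use \<psi>(2) in auto)
    then have "(\<psi> has_real_derivative 0) (at x)" using DERIV_eventually_eq[of "\<lambda>_. 0" 0 x \<psi>] by simp
    then show ?thesis using DERIV_unique d\<psi> by blast
  qed
  have i\<psi>: "integrable lborel \<psi>" by (rule integrable_continuous_compact_support[OF smooth_continuous[OF \<psi>(1)] \<psi>(2)])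
  have i\<psi>': "integrable lborel \<psi>'" by (rule integrable_continuous_compact_support[OF smooth_continuous[OF s\<psi>'] z'])
  have iu: "integrable lborel (\<lambda>x. u t x * \<psi> x)" for t by (rule integrable_bounded_mult[OF u_measurable u_abs i\<psi>])
  have iub: "integrable lborel (\<lambda>x. u t x * b t x * \<psi>' x)" for t
    using integrable_bounded_mult[OF L1loc_pathD(1,2)[OF flux_path] i\<psi>'] .
  have cf: "continuous_on UNIV f" unfolding f_def by (rule integral_path_continuous[OF u_path i\<psi>])
  have cg: "continuous_on UNIV g" unfolding g_def by (rule integral_path_continuous[OF flux_path i\<psi>'])
  obtain g1 where g1: "g1 0 = 0" "\<And>t. (g1 has_real_derivative g t) (at t)"
    using continuous_antiderivative[OF cg] by blast
  have cg1: "continuous_on UNIV g1" by (meson DERIV_isCont continuous_at_imp_continuous_on g1(2))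
  define h where "h t = f t - f 0 - g1 t" for t
  have h0: "h t = 0" if "0 < t" for t
  proof (rule zero_if_orthogonal_to_bumps[OF _ _ that])
    show "continuous_on UNIV h" unfolding h_def[abs_def] by (intro continuous_intros cf cg1)
    fix a e :: real assume ae: "0 < a" "a < e"
    have cb: "continuous_on UNIV (bump p q)" for p q by (rule smooth_continuous[OF smooth_bump])
    have ib: "integrable lborel (bump p q)" for p q
      by (rule integrable_continuous_compact_support[OF cb, of p q]) (auto intro: bump_eq_0)
    (* On t >= 0 the time factor has derivative - bump a e. A second bump on (-1, 0), where the equation is not tested, gives it compact support. *)
    define m where "m = (LINT s|lborel. bump a e s) / (LINT s|lborel. bump (-1) 0 s)"
    define r where "r s = m * bump (-1) 0 s + (-1) * bump a e s" for s
    have sr: "smooth r" unfolding smooth_def r_def[abs_def]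
      by (intro allI Ck_line_add Ck_line_mult Ck_line_const) (use smooth_bump in \<open>auto simp: smooth_def\<close>)
    have rz: "r s = 0" if "s \<notin> {-1..e}" for s using that ae by (auto simp: r_def bump_eq_0)
    have rpos: "r s = - bump a e s" if "0 \<le> s" for s using that by (simp add: r_def bump_eq_0)
    have r0: "(LINT s|lborel. r s) = 0"
    proof -
      have "(LINT s|lborel. r s) = m * (LINT s|lborel. bump (-1) 0 s) - (LINT s|lborel. bump a e s)"
        using ib by (simp add: r_def)
      also have "\<dots> = 0" using bump_integral_pos[of "-1" 0] by (simp add: m_def)
      finally show ?thesis .
    qed
    obtain R where R: "\<And>s. (R has_real_derivative r s) (at s)"
      using continuous_antiderivative[OF smooth_continuous[OF sr]] by blast
    define \<theta> where "\<theta> s = R s - R e" for s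
    have d\<theta>: "(\<theta> has_real_derivative r s) (at s)" for s
      unfolding \<theta>_def[abs_def] by (auto intro!: derivative_eq_intros R)
    have s\<theta>: "smooth \<theta>" by (rule smooth_antiderivative[OF sr d\<theta>])
    note ftc = set_integral_antiderivative[OF d\<theta> smooth_continuous[OF sr]]
    have \<theta>z: "\<theta> s = 0" if "s \<notin> {-1..e}" for s
    proof (cases "s > e")
      case True
      have "(LINT z:{e..s}|lborel. r z) = (LINT z:{e..s}|lborel. 0)"
        unfolding set_lebesgue_integral_def
        by (intro Bochner_Integration.integral_cong) (use ae in \<open>auto simp: indicator_def r_def bump_eq_0\<close>)
      then show ?thesis using ftc[of e s] True by (simp add: \<theta>_def)
    next
      case False
      then have s: "s < -1" using that by auto
      have "(LINT z:{s..e}|lborel. r z) = (LINT z|lborel. r z)"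
        by (rule integral_compact_support) (use rz s in auto)
      then show ?thesis using ftc[of s e] s ae r0 by (simp add: \<theta>_def)
    qed
    have \<theta>e: "\<theta> e = 0" by (simp add: \<theta>_def)
    have "test_function (\<lambda>(t, x). \<theta> t * \<psi> x)" by (rule product_test_function[OF s\<theta> \<theta>z \<psi>])
    then have "(LINT t:{0..}|lborel. (LINT x|lborel. u t x * deriv (\<lambda>s. \<theta> s * \<psi> x) t
          + u t x * V (w t x) * deriv (\<lambda>y. \<theta> t * \<psi> y) x)) + (LINT x|lborel. u 0 x * (\<theta> 0 * \<psi> x)) = 0"
      using u_weak by (auto simp: distributional_solution_def)
    moreover have "deriv (\<lambda>s. \<theta> s * \<psi> x) t = r t * \<psi> x" for x t
      by (rule DERIV_imp_deriv) (auto intro!: derivative_eq_intros d\<theta>)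
    moreover have "deriv (\<lambda>y. \<theta> t * \<psi> y) x = \<theta> t * \<psi>' x" for x t
      by (rule DERIV_imp_deriv) (auto intro!: derivative_eq_intros d\<psi>)
    moreover have "(LINT x|lborel. u t x * (r t * \<psi> x) + u t x * V (w t x) * (\<theta> t * \<psi>' x)) = r t * f t + \<theta> t * g t" for t
    proof -
      have "(LINT x|lborel. u t x * (r t * \<psi> x) + u t x * V (w t x) * (\<theta> t * \<psi>' x)) =
          (LINT x|lborel. r t * (u t x * \<psi> x) + \<theta> t * (u t x * b t x * \<psi>' x))"
        by (intro Bochner_Integration.integral_cong) (auto simp: b_def algebra_simps)
      also have "\<dots> = r t * f t + \<theta> t * g t"
        by (simp only: Bochner_Integration.integral_add[OF integrable_mult_right[OF iu] integrable_mult_right[OF iub]]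
           integral_mult_right_zero f_def g_def)
      finally show ?thesis .
    qed
    moreover have "(LINT x|lborel. u 0 x * (\<theta> 0 * \<psi> x)) = \<theta> 0 * f 0"
      by (simp add: f_def mult.left_commute[of _ "\<theta> 0"])
    ultimately have weak: "(LINT t:{0..}|lborel. r t * f t + \<theta> t * g t) + \<theta> 0 * f 0 = 0" by simp
    have "(LINT t:{0..}|lborel. r t * f t + \<theta> t * g t) = (LINT t:{0..e}|lborel. r t * f t + \<theta> t * g t)"
      unfolding set_lebesgue_integral_def
      by (intro Bochner_Integration.integral_cong) (use rz \<theta>z in \<open>auto simp: indicator_def\<close>)
    also have "\<dots> = (LINT t:{0..e}|lborel. (g1 t * r t + g t * \<theta> t) + (f 0 * r t + - (bump a e t * h t)))"
      unfolding set_lebesgue_integral_def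
      by (intro Bochner_Integration.integral_cong) (auto simp: indicator_def rpos h_def algebra_simps)
    also have "\<dots> = (LINT t:{0..e}|lborel. g1 t * r t + g t * \<theta> t) + ((LINT t:{0..e}|lborel. f 0 * r t) + - (LINT t:{0..e}|lborel. bump a e t * h t))"
    proof -
      have cr: "continuous_on UNIV r" "continuous_on UNIV \<theta>" "continuous_on UNIV h"
        using sr s\<theta> smooth_continuous by (auto simp: h_def[abs_def] intro!: continuous_intros cf cg1)
      have i: "set_integrable lborel {0..e} F" if "continuous_on UNIV F" for F :: "real \<Rightarrow> real"
        by (rule borel_integrable_atLeastAtMost') (rule continuous_on_subset[OF that], simp)
      have i1: "set_integrable lborel {0..e} (\<lambda>t. g1 t * r t + g t * \<theta> t)" "set_integrable lborel {0..e} (\<lambda>t. f 0 * r t)"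
        "set_integrable lborel {0..e} (\<lambda>t. - (bump a e t * h t))"
        by (intro i continuous_intros cg1 cr cg cb)+
      show ?thesis
        unfolding set_integral_add(2)[OF i1(1) set_integral_add(1)[OF i1(2,3)]] set_integral_add(2)[OF i1(2,3)]
        by (simp add: set_lebesgue_integral_def)
    qed
    also have "(LINT t:{0..e}|lborel. g1 t * r t + g t * \<theta> t) = g1 e * \<theta> e - g1 0 * \<theta> 0"
    proof (rule set_integral_antiderivative)
      show "((\<lambda>t. g1 t * \<theta> t) has_real_derivative g1 t * r t + g t * \<theta> t) (at t)" for t
        by (auto intro!: derivative_eq_intros g1(2) d\<theta>)
      show "continuous_on UNIV (\<lambda>t. g1 t * r t + g t * \<theta> t)"
        using sr s\<theta> smooth_continuous by (auto intro!: continuous_intros cg1 cg)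
    qed (use ae in auto)
    also have "(LINT t:{0..e}|lborel. f 0 * r t) = f 0 * \<theta> e - f 0 * \<theta> 0"
    proof (rule set_integral_antiderivative)
      show "((\<lambda>t. f 0 * \<theta> t) has_real_derivative f 0 * r t) (at t)" for t
        by (auto intro!: derivative_eq_intros d\<theta>)
      show "continuous_on UNIV (\<lambda>t. f 0 * r t)"
        using sr smooth_continuous by (auto intro!: continuous_intros)
    qed (use ae in auto)
    finally show "(LINT t:{0..e}|lborel. bump a e t * h t) = 0" using weak \<theta>e g1(1) by simp
  qed
  have "\<forall>\<^sub>F s in nhds t. s \<in> {0<..}" using t by (intro eventually_nhds_in_open) auto
  then have "\<forall>\<^sub>F s in nhds t. f s = f 0 + g1 s"
  proof eventually_elim
    case (elim s)
    then show ?case using h0[of s] by (simp add: h_def)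
  qed
  moreover have "((\<lambda>s. f 0 + g1 s) has_real_derivative g t) (at t)" by (auto intro!: derivative_eq_intros g1(2))
  ultimately have "(f has_real_derivative g t) (at t)" using DERIV_eventually_eq by blast
  then show ?thesis by (simp add: f_def[abs_def] g_def)
qed

definition X :: "real \<Rightarrow> real \<Rightarrow> real" where
  "X x = (SOME c. c 0 = x \<and> continuous_on {0..} c \<and> (\<forall>t>0. (c has_real_derivative b t (c t)) (at t)))"

lemma X_props: "X x 0 = x" "continuous_on {0..} (X x)" "0 < t \<Longrightarrow> (X x has_real_derivative b t (X x t)) (at t)"
  using someI_ex[OF flow_curve_exists[OF b_continuous b_abs b_lipschitz K_pos, of x], folded X_def] by auto

lemma X_continuous: "continuous_on {0..T} (X x)"
  by (rule continuous_on_subset[OF X_props(2)]) auto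

lemma X_increment_lower:
  assumes "x < y" "0 \<le> t"
  shows "(y - x) * exp (- K * t) \<le> X y t - X x t"
proof -
  have "(\<lambda>t. X y t - X x t) t \<ge> (X y 0 - X x 0) * exp (- K * t)"
    by (rule gronwall_lower[where T=t and f'="\<lambda>t. b t (X y t) - b t (X x t)"])
      (use assms b_lipschitz in \<open>auto intro!: continuous_intros X_continuous derivative_eq_intros X_props(3) simp: X_props(1)\<close>)
  then show ?thesis by (simp add: X_props(1))
qed

lemma X_increment_upper:
  assumes "x \<le> y" "0 \<le> t"
  shows "X y t - X x t \<le> (y - x) * exp (K * t)"
proof -
  have "X y t - X x t \<le> ((y - x) + 0 * t) * exp (K * t)"
  proof (rule gronwall_affine[where T=t and f'="\<lambda>t. b t (X y t) - b t (X x t)"])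
    fix s assume "0 < X y s - X x s"
    then show "b s (X y s) - b s (X x s) \<le> K * (X y s - X x s) + 0"
      using b_lipschitz[of s "X y s" "X x s"] by (simp add: abs_le_iff)
  qed (use assms K_pos in \<open>auto intro!: continuous_intros X_continuous derivative_eq_intros X_props(3) simp: X_props(1)\<close>)
  then show ?thesis by simp
qed

lemma X_strict_mono:
  assumes "x < y" "0 \<le> t"
  shows "X x t < X y t"
proof -
  have "0 < (y - x) * exp (- K * t)" using assms by simp
  with X_increment_lower[OF assms] show ?thesis by linarith
qed

lemma X_displacement:
  assumes "0 \<le> t"
  shows "\<bar>X x t - x\<bar> \<le> B * t"
proof -
  have "\<sigma> * (X x t - x) \<le> (0 + B * t) * exp (0 * t)" if \<sigma>: "\<sigma> = 1 \<or> \<sigma> = -1" for \<sigma> :: real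
  proof (rule gronwall_affine[where T=t and f="\<lambda>t. \<sigma> * (X x t - x)" and f'="\<lambda>t. \<sigma> * b t (X x t)"])
    fix s show "\<sigma> * b s (X x s) \<le> 0 * (\<sigma> * (X x s - x)) + B"
      using b_abs[of s "X x s"] \<sigma> by auto
    show "continuous_on {0..t} (\<lambda>t. \<sigma> * (X x t - x))" by (intro continuous_intros X_continuous)
    show "((\<lambda>t. \<sigma> * (X x t - x)) has_real_derivative \<sigma> * b s (X x s)) (at s)" if "0 < s"
      using DERIV_cmult[OF DERIV_diff[OF X_props(3)[OF that] DERIV_const[of x]], of \<sigma>] by simp
  qed (use assms B_nonneg in \<open>auto simp: X_props(1)\<close>)
  from this[of 1] this[of "-1"] show ?thesis by (simp add: abs_le_iff)
qed

lemma X_space_continuous: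
  assumes "0 \<le> t"
  shows "continuous_on UNIV (\<lambda>x. X x t)"
proof (rule lipschitz_on_continuous_on[of "exp (K * t)"])
  have "\<bar>X x t - X y t\<bar> \<le> exp (K * t) * \<bar>x - y\<bar>" if "x \<le> y" for x y
    using X_increment_upper[OF that assms] X_strict_mono[of x y t] assms that
    by (cases "x = y") (auto simp: mult.commute)
  then show "(exp (K * t))-lipschitz_on UNIV (\<lambda>x. X x t)"
    unfolding lipschitz_on_def dist_real_def by (metis abs_minus_commute exp_ge_zero linear)
qed

lemma X_surj:
  assumes "0 \<le> t"
  obtains x where "X x t = z"
proof -
  have "\<exists>x. z - B * t \<le> x \<and> x \<le> z + B * t \<and> X x t = z"
    by (rule IVT')
      (use X_displacement[OF assms, of "z - B * t"] X_displacement[OF assms, of "z + B * t"] B_nonneg assms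
        in \<open>auto simp: abs_le_iff intro: continuous_on_subset[OF X_space_continuous]\<close>)
  with that show thesis by blast
qed

text \<open>
  Mollify in space only: with \<open>u\<^sub>\<kappa> = u * \<rho>\<^sub>\<kappa>\<close> the mass of \<open>u\<^sub>\<kappa>\<close> between two characteristics changes
  at the rate \<open>V(w) u\<^sub>\<kappa> - (V(w) u) * \<rho>\<^sub>\<kappa>\<close> at its two ends. As the velocity is Lipschitz in space this
  commutator is \<open>O(\<kappa>)\<close> for \<open>u\<close> merely bounded. The mass of \<open>u\<^sub>\<kappa>\<close> between \<open>0\<close> and \<open>c\<close> is the
  integral of \<open>u\<close> against a difference of two smooth steps, which is a test function in space.
\<close>

lemma mass_conservation_approx:
  assumes xy: "x \<le> y" and t: "0 \<le> t" and \<kappa>: "0 < \<kappa>"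
  shows "\<bar>(LINT z:{X x t..X y t}|lborel. u t z) - (LINT z:{x..y}|lborel. u 0 z)\<bar>
    \<le> \<kappa> * (2 * umax * K * t + 8 * umax)"
proof -
  obtain \<rho> H where s\<rho>: "smooth \<rho>" and \<rho>0: "\<And>y. 0 \<le> \<rho> y" and \<rho>z: "\<And>y. y \<notin> {-\<kappa>..\<kappa>} \<Longrightarrow> \<rho> y = 0"
    and \<rho>i: "integrable lborel \<rho>" and \<rho>1: "(LINT y|lborel. \<rho> y) = 1"
    and sH: "smooth H" and dH: "\<And>y. (H has_real_derivative \<rho> y) (at y)"
    and Hl: "\<And>y. y \<le> -\<kappa> \<Longrightarrow> H y = 0" and Hr: "\<And>y. \<kappa> \<le> y \<Longrightarrow> H y = 1"
    and Hn: "\<And>y. 0 \<le> H y" and Hu: "\<And>y. H y \<le> 1"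
    using smooth_step_exists[OF \<kappa>] by blast
  define \<rho>' where "\<rho>' r = \<rho> (- r)" for r
  have \<rho>'i: "integrable lborel \<rho>'" using integrable_reflect[OF \<rho>i, of 0] by (simp add: \<rho>'_def[abs_def])
  have \<rho>'1: "(LINT r|lborel. \<rho>' r) = 1" using integral_reflect[of \<rho> 0] \<rho>1 by (simp add: \<rho>'_def[abs_def])
  have \<rho>'0: "0 \<le> \<rho>' r" for r by (simp add: \<rho>'_def \<rho>0)
  define U where "U t = convolution (u t) \<rho>'" for t
  define P where "P t = convolution (\<lambda>x. u t x * b t x) \<rho>'" for t
  define F where "F t c = (LINT y|lborel. u t y * (H (y - 0) - H (y - c)))" for t c
  have cU: "continuous_on UNIV (\<lambda>(t, c). U t c)" unfolding U_def by (rule continuous_convolution_path[OF u_path \<rho>'i])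
  have cUt: "continuous_on UNIV (U t)" for t
    using continuous_on_compose2[OF cU, of UNIV "\<lambda>c. (t, c)"] by (simp add: continuous_on_Pair)
  have sm: "smooth (\<lambda>y. H (y - c) - H (y - d))" for c d
    unfolding smooth_def
  proof
    fix n
    have "Ck_line n (\<lambda>y. H (1 * y + (- c)) + (-1) * H (1 * y + (- d)))"
      using sH by (intro Ck_line_add Ck_line_mult Ck_line_const Ck_line_affine) (auto simp: smooth_def)
    then show "Ck_line n (\<lambda>y. H (y - c) - H (y - d))" by simp
  qed
  have supp: "H (y - c) - H (y - d) = 0" if "y \<notin> {min c d - \<kappa>..max c d + \<kappa>}" for y c d
    using that Hl[of "y - c"] Hl[of "y - d"] Hr[of "y - c"] Hr[of "y - d"] by (auto simp: not_le)
  have dstep: "((\<lambda>y. H (y - c) - H (y - d)) has_real_derivative \<rho> (y - c) - \<rho> (y - d)) (at y)" for c d y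
    by (intro DERIV_diff DERIV_chain2[OF dH, THEN DERIV_cong]) (auto intro!: derivative_eq_intros)
  have iH: "integrable lborel (\<lambda>y. H (y - c) - H (y - d))" for c d
    by (rule integrable_continuous_compact_support[OF smooth_continuous[OF sm] supp])
  have iuH: "integrable lborel (\<lambda>y. u t y * (H (y - c) - H (y - d)))" for t c d
    by (rule integrable_bounded_mult[OF u_measurable u_abs iH])
  have F_time: "((\<lambda>t. F t c) has_real_derivative P t 0 - P t c) (at t)" if "0 < t" for t c
  proof -
    have "(LINT y|lborel. u t y * b t y * (\<rho> (y - 0) - \<rho> (y - c))) = P t 0 - P t c"
    proof -
      note i = convolution_integrable[OF L1loc_pathD(1,2)[OF flux_path] \<rho>'i, of t]
      have "P t 0 - P t c = (LINT y|lborel. u t y * b t y * \<rho>' (0 - y) - u t y * b t y * \<rho>' (c - y))"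
        unfolding P_def convolution_alt by (rule Bochner_Integration.integral_diff[OF i i, symmetric])
      then show ?thesis by (simp add: \<rho>'_def algebra_simps)
    qed
    moreover have "((\<lambda>t. LINT y|lborel. u t y * (H (y - 0) - H (y - c))) has_real_derivative
        (LINT y|lborel. u t y * b t y * (\<rho> (y - 0) - \<rho> (y - c)))) (at t)"
      by (rule integral_u_evolution[where c="min 0 c - \<kappa>" and d="max 0 c + \<kappa>"])
        (use that in \<open>blast intro: sm supp dstep\<close>)+
    ultimately show ?thesis unfolding F_def by simp
  qed
  have F_incr: "F t d - F t c = (LINT z:{c..d}|lborel. U t z)" if "c \<le> d" for t c d
  proof -
    have "F t d - F t c = (LINT y|lborel. u t y * (H (y - c) - H (y - d)))"
      unfolding F_def by (subst Bochner_Integration.integral_diff[symmetric, OF iuH iuH]) (simp add: algebra_simps)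
    also have "\<dots> = (LINT y|lborel. u t y * (LINT z:{c..d}|lborel. \<rho>' (z - y)))"
    proof (intro Bochner_Integration.integral_cong refl arg_cong2[where f="(*)"])
      fix y
      have "(LINT z:{c..d}|lborel. \<rho>' (z - y)) = - H (y - d) - - H (y - c)"
      proof (rule set_integral_antiderivative[OF _ _ that])
        show "((\<lambda>z. - H (y - z)) has_real_derivative \<rho>' (z - y)) (at z)" for z
          by (rule DERIV_cong[OF DERIV_minus[OF DERIV_chain2[OF dH]]]) (auto intro!: derivative_eq_intros simp: \<rho>'_def)
        show "continuous_on UNIV (\<lambda>z. \<rho>' (z - y))" unfolding \<rho>'_def
          by (intro continuous_on_compose2[OF smooth_continuous[OF s\<rho>]] continuous_intros) auto
      qed
      then show "H (y - c) - H (y - d) = (LINT z:{c..d}|lborel. \<rho>' (z - y))" by simp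
    qed
    also have "\<dots> = (LINT z:{c..d}|lborel. U t z)"
      unfolding U_def by (rule integral_convolution(1)[OF u_measurable u_abs \<rho>'i, symmetric])
    finally show ?thesis .
  qed
  have F_lip: "\<bar>F t d - F t c\<bar> \<le> umax * \<bar>d - c\<bar>" for t c d
  proof -
    have *: "\<bar>F t d - F t c\<bar> \<le> umax * (d - c)" if "c \<le> d" for c d
      unfolding F_incr[OF that]
    proof (rule set_integral_bound_interval[OF that])
      fix z show "\<bar>U t z\<bar> \<le> umax"
        using convolution_bounds[OF u_measurable u_nonneg u_le \<rho>'i \<rho>'0, of t z] by (simp add: \<rho>'1 U_def)
    qed
    show ?thesis using *[of c d] *[of d c] by (cases "c \<le> d") (auto simp: abs_minus_commute)
  qed
  have F_space: "(F t has_real_derivative U t c) (at c)" for t c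
  proof -
    obtain A where A: "\<And>c. (A has_real_derivative U t c) (at c)" using continuous_antiderivative[OF cUt] by blast
    have "F t c = A c + (F t 0 - A 0)" for c
      using F_incr[of 0 c t] F_incr[of c 0 t] set_integral_antiderivative[OF A cUt, of 0 c] set_integral_antiderivative[OF A cUt, of c 0]
      by (cases "0 \<le> c") auto
    then have "\<forall>\<^sub>F z in nhds c. F t z = A z + (F t 0 - A 0)" by (intro always_eventually allI)
    moreover have "((\<lambda>c. A c + (F t 0 - A 0)) has_real_derivative U t c) (at c)" by (auto intro!: derivative_eq_intros A)
    ultimately show ?thesis using DERIV_eventually_eq by blast
  qed
  have E: "((\<lambda>t. F t (X x t)) has_real_derivative P t 0 - P t (X x t) + b t (X x t) * U t (X x t)) (at t)" if t: "0 < t" for x t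
  proof -
    have "((\<lambda>(t, c). F t c) has_derivative (\<lambda>(tx, ty). (P t 0 - P t (X x t)) * tx + blinfun_apply (blinfun_mult_right (U t (X x t))) ty))
        (at (t, X x t) within UNIV \<times> UNIV)"
    proof (rule has_derivative_partialsI)
      show "((\<lambda>s. F s (X x t)) has_derivative (\<lambda>tx. (P t 0 - P t (X x t)) * tx)) (at t within UNIV)"
        using F_time[OF t, of "X x t"] by (simp add: has_field_derivative_def)
      show "(F s has_derivative blinfun_apply (blinfun_mult_right (U s c))) (at c within UNIV)" for s c
        using F_space[of s c] by (simp add: has_field_derivative_def)
      have "continuous_on UNIV (\<lambda>p. blinfun_mult_right (case p of (s, c) \<Rightarrow> U s c))"
        by (rule bounded_linear.continuous_on[OF bounded_linear_blinfun_mult_right cU])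
      then show "continuous (at (t, X x t) within UNIV \<times> UNIV) (\<lambda>(s, c). blinfun_mult_right (U s c))"
        by (simp add: continuous_on_eq_continuous_at case_prod_unfold)
    qed auto
    then have d: "((\<lambda>p. F (fst p) (snd p)) has_derivative (\<lambda>q. (P t 0 - P t (X x t)) * fst q + U t (X x t) * snd q)) (at (t, X x t))"
      by (simp add: case_prod_unfold)
    have "((\<lambda>t. (t, X x t)) has_derivative (\<lambda>h. (h, b t (X x t) * h))) (at t)"
      using X_props(3)[OF t, of x] by (intro has_derivative_Pair has_derivative_ident) (simp add: has_field_derivative_def)
    from has_derivative_compose[OF this d]
    have "((\<lambda>t. F t (X x t)) has_derivative (\<lambda>h. (P t 0 - P t (X x t)) * h + U t (X x t) * (b t (X x t) * h))) (at t)"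
      by simp
    then show ?thesis unfolding has_field_derivative_def
      by (rule has_derivative_eq_rhs) (auto simp: algebra_simps)
  qed
  (* the commutator: b varies by at most K \<kappa> on the support of the mollifier *)
  have comm: "\<bar>b t c * U t c - P t c\<bar> \<le> umax * (K * \<kappa>)" for t c
  proof -
    note i1 = convolution_integrable[OF u_measurable u_abs \<rho>'i, of t c]
      and i2 = convolution_integrable[OF L1loc_pathD(1,2)[OF flux_path] \<rho>'i, of t c]
    have eq: "b t c * U t c - P t c = (LINT y|lborel. b t c * (u t y * \<rho>' (c - y)) - u t y * b t y * \<rho>' (c - y))"
      unfolding U_def P_def convolution_alt
      by (simp only: Bochner_Integration.integral_diff[OF integrable_mult_right[OF i1] i2] integral_mult_right_zero)
    have "\<bar>b t c * U t c - P t c\<bar> \<le> (LINT y|lborel. \<bar>b t c * (u t y * \<rho>' (c - y)) - u t y * b t y * \<rho>' (c - y)\<bar>)"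
      unfolding eq by (rule integral_abs_bound)
    also have "\<dots> \<le> (LINT y|lborel. (umax * (K * \<kappa>)) * \<rho>' (c - y))"
    proof (rule integral_mono_AE')
      show "integrable lborel (\<lambda>y. (umax * (K * \<kappa>)) * \<rho>' (c - y))"
        by (intro integrable_mult_right integrable_reflect \<rho>'i)
      show "AE y in lborel. \<bar>b t c * (u t y * \<rho>' (c - y)) - u t y * b t y * \<rho>' (c - y)\<bar> \<le> (umax * (K * \<kappa>)) * \<rho>' (c - y)"
      proof (rule AE_I2)
        fix y :: real
        have eq: "b t c * (u t y * \<rho>' (c - y)) - u t y * b t y * \<rho>' (c - y) = (u t y * (b t c - b t y)) * \<rho>' (c - y)"
          by (simp add: algebra_simps)
        show "\<bar>b t c * (u t y * \<rho>' (c - y)) - u t y * b t y * \<rho>' (c - y)\<bar> \<le> (umax * (K * \<kappa>)) * \<rho>' (c - y)"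
        proof (cases "y - c \<in> {-\<kappa>..\<kappa>}")
          case True
          have "\<bar>b t c - b t y\<bar> \<le> K * \<bar>c - y\<bar>" by (rule b_lipschitz)
          also have "\<dots> \<le> K * \<kappa>" using True K_pos by (intro mult_left_mono) auto
          finally have "\<bar>u t y\<bar> * \<bar>b t c - b t y\<bar> \<le> umax * (K * \<kappa>)"
            using umax_pos by (intro mult_mono u_abs) auto
          then show ?thesis unfolding eq abs_mult using \<rho>'0[of "c - y"] by (simp add: mult_right_mono)
        next
          case False
          then show ?thesis using \<rho>z[of "y - c"] by (simp add: \<rho>'_def)
        qed
      qed
      show "AE y in lborel. 0 \<le> (umax * (K * \<kappa>)) * \<rho>' (c - y)"
        using umax_pos K_pos \<kappa> \<rho>'0 by auto
    qed
    also have "\<dots> = umax * (K * \<kappa>)" using integral_reflect[of \<rho>' c] \<rho>'1 by simp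
    finally show ?thesis .
  qed
  define m where "m t = F t (X y t) - F t (X x t)" for t
  have Xle: "X x t \<le> X y t" if "0 \<le> t" for t using X_strict_mono[of x y t] xy that by (cases "x = y") auto
  have m_eq: "m t = (LINT z|lborel. u t z * (H (z - X x t) - H (z - X y t)))" for t
    unfolding m_def F_def by (subst Bochner_Integration.integral_diff[symmetric, OF iuH iuH]) (simp add: algebra_simps)
  (* a smooth step differs from a sharp one on an interval of length 2 \<kappa> only *)
  have m_close: "\<bar>m t - (LINT z:{X x t..X y t}|lborel. u t z)\<bar> \<le> 4 * \<kappa> * umax" if "0 \<le> t" for t
  proof -
    let ?p = "X x t" and ?q = "X y t"
    let ?I = "\<lambda>c. indicator {c - \<kappa>..c + \<kappa>} :: real \<Rightarrow> real"
    have iI: "integrable lborel (\<lambda>z. indicator {?p..?q} z *\<^sub>R u t z)"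
      using integrable_bounded_mult[OF u_measurable u_abs integrable_indicator_Icc, of t ?p ?q] by (simp add: mult.commute)
    have "\<bar>m t - (LINT z:{?p..?q}|lborel. u t z)\<bar> = \<bar>LINT z|lborel. u t z * (H (z - ?p) - H (z - ?q)) - indicator {?p..?q} z *\<^sub>R u t z\<bar>"
      unfolding m_eq set_lebesgue_integral_def by (simp only: Bochner_Integration.integral_diff[OF iuH iI])
    also have "\<dots> \<le> (LINT z|lborel. \<bar>u t z * (H (z - ?p) - H (z - ?q)) - indicator {?p..?q} z *\<^sub>R u t z\<bar>)"
      by (rule integral_abs_bound)
    also have "\<dots> \<le> (LINT z|lborel. umax * ?I ?p z + umax * ?I ?q z)"
    proof (rule integral_mono_AE')
      show "AE z in lborel. \<bar>u t z * (H (z - ?p) - H (z - ?q)) - indicator {?p..?q} z *\<^sub>R u t z\<bar> \<le> umax * ?I ?p z + umax * ?I ?q z"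
      proof (rule AE_I2)
        fix z
        let ?e = "H (z - ?p) - H (z - ?q) - indicator {?p..?q} z"
        have e: "\<bar>?e\<bar> \<le> ?I ?p z + ?I ?q z"
          using Xle[OF that] Hl[of "z - ?p"] Hl[of "z - ?q"] Hr[of "z - ?p"] Hr[of "z - ?q"]
            Hn[of "z - ?p"] Hn[of "z - ?q"] Hu[of "z - ?p"] Hu[of "z - ?q"] \<kappa>
          by (auto simp: indicator_def abs_le_iff not_le)
        have "\<bar>u t z * (H (z - ?p) - H (z - ?q)) - indicator {?p..?q} z *\<^sub>R u t z\<bar> = \<bar>u t z\<bar> * \<bar>?e\<bar>"
          by (simp add: abs_mult[symmetric] algebra_simps)
        also have "\<dots> \<le> umax * (?I ?p z + ?I ?q z)" using umax_pos by (intro mult_mono u_abs e) auto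
        finally show "\<bar>u t z * (H (z - ?p) - H (z - ?q)) - indicator {?p..?q} z *\<^sub>R u t z\<bar> \<le> umax * ?I ?p z + umax * ?I ?q z"
          by (simp add: distrib_left)
      qed
    qed (use umax_pos integrable_indicator_Icc in auto)
    also have "\<dots> = 4 * \<kappa> * umax" using \<kappa> integrable_indicator_Icc by simp
    finally show ?thesis .
  qed
  have m_drift: "\<bar>m t - m 0\<bar> \<le> 2 * umax * (K * \<kappa>) * t"
  proof -
    let ?m' = "\<lambda>t. (P t 0 - P t (X y t) + b t (X y t) * U t (X y t)) - (P t 0 - P t (X x t) + b t (X x t) * U t (X x t))"
    have dm: "(m has_real_derivative ?m' s) (at s)" if "0 < s" for s
      unfolding m_def[abs_def] by (intro DERIV_diff E that)
    have cm: "continuous_on {0..t} m"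
    proof -
      have cF: "continuous_on {0..t} (\<lambda>t. F t (X x t))" for x
      proof -
        show ?thesis
          unfolding continuous_on_def
        proof
          fix s assume s: "s \<in> {0..t}"
          have "isCont (\<lambda>r. F r (X x s)) s"
            using integral_path_continuous[OF u_path iH[of 0 "X x s"]] by (simp add: F_def continuous_on_eq_continuous_at)
          then have l1: "((\<lambda>r. F r (X x s)) \<longlongrightarrow> F s (X x s)) (at s within {0..t})"
            by (auto simp: isCont_def intro: tendsto_within_subset)
          have "((\<lambda>r. X x r) \<longlongrightarrow> X x s) (at s within {0..t})"
            using X_continuous s by (auto simp: continuous_on_def)
          then have "((\<lambda>r. umax * \<bar>X x r - X x s\<bar>) \<longlongrightarrow> 0) (at s within {0..t})"
            by (intro tendsto_mult_right_zero tendsto_rabs_zero LIM_zero)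
          then have l2: "((\<lambda>r. F r (X x r) - F r (X x s)) \<longlongrightarrow> 0) (at s within {0..t})"
            by (rule Lim_null_comparison[OF always_eventually, rotated]) (use F_lip in auto)
          show "((\<lambda>r. F r (X x r)) \<longlongrightarrow> F s (X x s)) (at s within {0..t})"
            using tendsto_add[OF l2 l1] by simp
        qed
      qed
      show ?thesis unfolding m_def[abs_def] by (intro continuous_on_diff cF)
    qed
    have "\<sigma> * (m t - m 0) \<le> (0 + (2 * umax * (K * \<kappa>)) * t) * exp (0 * t)" if \<sigma>: "\<sigma> = 1 \<or> \<sigma> = -1" for \<sigma> :: real
    proof (rule gronwall_affine[where T=t and f="\<lambda>t. \<sigma> * (m t - m 0)" and f'="\<lambda>t. \<sigma> * ?m' t"])
      show "continuous_on {0..t} (\<lambda>t. \<sigma> * (m t - m 0))" by (intro continuous_intros cm)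
      show "((\<lambda>t. \<sigma> * (m t - m 0)) has_real_derivative \<sigma> * ?m' s) (at s)" if "0 < s" for s
        using DERIV_cmult[OF DERIV_diff[OF dm[OF that] DERIV_const[of "m 0"]], of \<sigma>] by simp
      fix s show "\<sigma> * ?m' s \<le> 0 * (\<sigma> * (m s - m 0)) + 2 * umax * (K * \<kappa>)"
        using comm[of s "X y s"] comm[of s "X x s"] \<sigma> by (auto simp: abs_le_iff)
    qed (use t umax_pos K_pos \<kappa> in auto)
    from this[of 1] this[of "-1"] show ?thesis by (simp add: abs_le_iff)
  qed
  have "\<bar>(LINT z:{X x t..X y t}|lborel. u t z) - (LINT z:{x..y}|lborel. u 0 z)\<bar> \<le> 2 * umax * (K * \<kappa>) * t + 4 * \<kappa> * umax + 4 * \<kappa> * umax"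
    using m_close[OF t] m_close[of 0] m_drift by (simp add: X_props(1))
  then show ?thesis by (simp add: algebra_simps)
qed

lemma mass_conservation:
  assumes "x \<le> y" "0 \<le> t"
  shows "(LINT z:{X x t..X y t}|lborel. u t z) = (LINT z:{x..y}|lborel. u 0 z)"
proof -
  let ?d = "\<bar>(LINT z:{X x t..X y t}|lborel. u t z) - (LINT z:{x..y}|lborel. u 0 z)\<bar>"
  have "(\<lambda>n. inverse (real (Suc n)) * (2 * umax * K * t + 8 * umax)) \<longlonglongrightarrow> 0 * (2 * umax * K * t + 8 * umax)"
    by (intro tendsto_mult LIMSEQ_inverse_real_of_nat tendsto_const)
  then have "?d \<le> 0"
    using LIMSEQ_le_const[of _ "0 * (2 * umax * K * t + 8 * umax)" ?d] mass_conservation_approx[OF assms, of "inverse (real (Suc n))" for n]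
    by fastforce
  then show ?thesis by simp
qed

end

section \<open>Densities along characteristics\<close>

lemma linear_ode_exists:
  fixes \<alpha> \<beta> :: "real \<Rightarrow> real"
  assumes \<alpha>: "continuous_on UNIV \<alpha>" and \<beta>: "continuous_on UNIV \<beta>"
  shows "\<exists>a. a 0 = c \<and> (\<forall>t. (a has_real_derivative \<alpha> t * a t + \<beta> t) (at t))"
proof -
  obtain I where I: "I 0 = 0" "\<And>t. (I has_real_derivative \<alpha> t) (at t)"
    using continuous_antiderivative[OF \<alpha>] by blast
  have cI: "continuous_on UNIV I" by (meson DERIV_isCont I(2) continuous_at_imp_continuous_on)
  have "continuous_on UNIV (\<lambda>t. exp (- I t) * \<beta> t)" by (intro continuous_intros cI \<beta>)
  from continuous_antiderivative[OF this] obtain J where J: "J 0 = 0" "\<And>t. (J has_real_derivative exp (- I t) * \<beta> t) (at t)"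
    by blast
  have "((\<lambda>t. exp (I t) * (c + J t)) has_real_derivative \<alpha> t * (exp (I t) * (c + J t)) + \<beta> t) (at t)" for t
    by (auto intro!: derivative_eq_intros I(2) J(2) simp: algebra_simps exp_minus)
  then show ?thesis using I(1) J(1) by (intro exI[of _ "\<lambda>t. exp (I t) * (c + J t)"]) auto
qed

text \<open>
  Trajectories that start from a continuous density bounded away from \<open>0\<close>.
\<close>

locale regular_traffic = nonlocal_traffic +
  fixes a0 :: real
  assumes a0_pos: "0 < a0" and u0_lower: "\<And>x. a0 \<le> u 0 x" and u0_continuous: "continuous_on UNIV (u 0)"
begin

lemma V'_continuous: "continuous_on {0..umax} V'"
  by (rule lipschitz_on_continuous_on[of Q2])
    (use V'_lip Q2_nonneg in \<open>auto simp: lipschitz_on_def dist_real_def\<close>)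

lemma V'_w_continuous: "continuous_on UNIV (\<lambda>(t, x). V' (w t x))"
proof -
  have "(\<lambda>(t, x). w t x) ` UNIV \<subseteq> {0..umax}" using w_bounds by force
  from continuous_on_compose2[OF V'_continuous w_continuous this] show ?thesis by (simp add: case_prod_unfold)
qed

text \<open>
  Formally \<open>v\<close> solves \<open>v' = - V'(w) v (G - k(0) v)\<close> along a characteristic, which is nonlinear, but
  its reciprocal \<open>a = 1/v\<close> solves a linear equation and exists for all times. The coefficients are
  frozen for \<open>t < 0\<close>.
\<close>

lemma a_exists:
  "\<exists>a. a 0 = 1 / u 0 x \<and> continuous_on {0..} a \<and>
    (\<forall>t>0. (a has_real_derivative V' (w t (X x t)) * (G t (X x t) * a t - k 0)) (at t))"
proof -
  have c: "continuous_on UNIV (\<lambda>t. X x (max 0 t))"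
    by (rule continuous_on_compose2[OF X_props(2)]) (auto intro!: continuous_intros)
  have p: "continuous_on UNIV (\<lambda>t. f (max 0 t) (X x (max 0 t)))" if "continuous_on UNIV (\<lambda>(t, x). f t x)" for f :: "real \<Rightarrow> real \<Rightarrow> real"
    using continuous_on_compose2[OF that, of UNIV "\<lambda>t. (max 0 t, X x (max 0 t))"] c
    by (simp add: continuous_on_Pair continuous_on_max)
  let ?\<alpha> = "\<lambda>t. V' (w (max 0 t) (X x (max 0 t))) * G (max 0 t) (X x (max 0 t))"
  let ?\<beta> = "\<lambda>t. - k 0 * V' (w (max 0 t) (X x (max 0 t)))"
  have "\<exists>a. a 0 = 1 / u 0 x \<and> (\<forall>t. (a has_real_derivative ?\<alpha> t * a t + ?\<beta> t) (at t))"
    by (rule linear_ode_exists) (intro continuous_intros p[OF V'_w_continuous] p[OF G_continuous])+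
  then obtain a where a: "a 0 = 1 / u 0 x" "\<And>t. (a has_real_derivative ?\<alpha> t * a t + ?\<beta> t) (at t)" by blast
  have "continuous_on {0..} a" by (meson DERIV_isCont a(2) continuous_at_imp_continuous_on)
  moreover have "(a has_real_derivative V' (w t (X x t)) * (G t (X x t) * a t - k 0)) (at t)" if "0 < t" for t
    using a(2)[of t] that by (simp add: algebra_simps max_def)
  ultimately show ?thesis using a(1) by blast
qed

definition a :: "real \<Rightarrow> real \<Rightarrow> real" where
  "a x = (SOME a. a 0 = 1 / u 0 x \<and> continuous_on {0..} a \<and>
    (\<forall>t>0. (a has_real_derivative V' (w t (X x t)) * (G t (X x t) * a t - k 0)) (at t)))"

lemma a_props: "a x 0 = 1 / u 0 x" "continuous_on {0..} (a x)"
  "0 < t \<Longrightarrow> (a x has_real_derivative V' (w t (X x t)) * (G t (X x t) * a x t - k 0)) (at t)"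
  using someI_ex[OF a_exists[of x], folded a_def] by auto

text \<open>
  Length over mass of the cell between the characteristics of \<open>x\<close> and \<open>q\<close>: the reciprocal of the
  mean density in the cell, because its mass is conserved.
\<close>

definition cell :: "real \<Rightarrow> real \<Rightarrow> real \<Rightarrow> real" where
  "cell x q t = (X q t - X x t) / (LINT z:{x..q}|lborel. u 0 z)"

lemma set_integrable_u: "set_integrable lborel {x..y} (u t)"
  unfolding set_integrable_def
  using integrable_bounded_mult[OF u_measurable u_abs integrable_indicator_Icc] by (simp add: mult.commute)

lemma set_integral_u_bounds:
  assumes "x \<le> y" "\<And>z. x \<le> z \<Longrightarrow> z \<le> y \<Longrightarrow> c \<le> u t z" "\<And>z. x \<le> z \<Longrightarrow> z \<le> y \<Longrightarrow> u t z \<le> d"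
  shows "c * (y - x) \<le> (LINT z:{x..y}|lborel. u t z)" "(LINT z:{x..y}|lborel. u t z) \<le> d * (y - x)"
proof -
  have "(LINT z|lborel. c * indicator {x..y} z) \<le> (LINT z:{x..y}|lborel. u t z)"
    unfolding set_lebesgue_integral_def
    by (rule integral_mono[OF integrable_mult_right[OF integrable_indicator_Icc] set_integrable_u[unfolded set_integrable_def]])
      (use assms in \<open>auto simp: indicator_def\<close>)
  then show "c * (y - x) \<le> (LINT z:{x..y}|lborel. u t z)" using assms(1) by simp
  have "(LINT z:{x..y}|lborel. u t z) \<le> (LINT z|lborel. d * indicator {x..y} z)"
    unfolding set_lebesgue_integral_def
    by (rule integral_mono[OF set_integrable_u[unfolded set_integrable_def] integrable_mult_right[OF integrable_indicator_Icc]])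
      (use assms in \<open>auto simp: indicator_def\<close>)
  then show "(LINT z:{x..y}|lborel. u t z) \<le> d * (y - x)" using assms(1) by simp
qed

lemma initial_mass_pos:
  assumes "x < q"
  shows "a0 * (q - x) \<le> (LINT z:{x..q}|lborel. u 0 z)" "0 < (LINT z:{x..q}|lborel. u 0 z)"
proof -
  show "a0 * (q - x) \<le> (LINT z:{x..q}|lborel. u 0 z)"
    using assms set_integral_u_bounds(1)[of x q a0 0 umax] u0_lower u_le by auto
  moreover have "0 < a0 * (q - x)" using assms a0_pos by simp
  ultimately show "0 < (LINT z:{x..q}|lborel. u 0 z)" by linarith
qed

lemma cell_bounds:
  assumes "x < q" "0 \<le> t"
  shows "1 / umax \<le> cell x q t" "cell x q t \<le> exp (K * t) / a0"
proof -
  let ?M = "LINT z:{x..q}|lborel. u 0 z"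
  note M = initial_mass_pos[OF assms(1)]
  have "?M = (LINT z:{X x t..X q t}|lborel. u t z)" using mass_conservation[of x q t] assms by simp
  also have "\<dots> \<le> umax * (X q t - X x t)"
    using set_integral_u_bounds(2)[of "X x t" "X q t" 0 t umax] X_strict_mono[OF assms] u_nonneg u_le by auto
  finally show "1 / umax \<le> cell x q t" using M(2) umax_pos by (simp add: cell_def field_simps)
  have "a0 * (X q t - X x t) \<le> a0 * ((q - x) * exp (K * t))"
    using X_increment_upper[of x q t] assms a0_pos by (intro mult_left_mono) auto
  also have "\<dots> \<le> ?M * exp (K * t)" using mult_right_mono[OF M(1), of "exp (K * t)"] by (simp add: mult_ac)
  finally show "cell x q t \<le> exp (K * t) / a0" using M(2) a0_pos by (simp add: cell_def field_simps)
qed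

text \<open>
  Up to an error that vanishes with the width of the cell, \<open>cell\<close> satisfies the linear equation of
  \<open>a\<close>: the increment of \<open>w\<close> across the cell is \<open>\<integral> G\<close> minus \<open>k(0)\<close> times the mass.
\<close>

lemma cell_deriv:
  assumes xq: "x < q" and t: "0 < t"
    and \<omega>: "\<And>z. X x t \<le> z \<Longrightarrow> z \<le> X q t \<Longrightarrow> \<bar>G t z - G t (X x t)\<bar> \<le> \<omega>"
  obtains dA where "(cell x q has_real_derivative dA) (at t)"
    "\<bar>dA - V' (w t (X x t)) * (G t (X x t) * cell x q t - k 0)\<bar>
       \<le> Q * \<omega> * cell x q t + Q2 * (k 0 * umax) * (X q t - X x t) * (k 0 * umax * cell x q t + k 0)"
proof -
  let ?p = "X x t" and ?q = "X q t" and ?M = "LINT z:{x..q}|lborel. u 0 z"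
  let ?A = "cell x q t"
  have pq: "?p < ?q" using X_strict_mono[OF xq] t by simp
  note M = initial_mass_pos(2)[OF xq]
  obtain \<xi> where \<xi>: "\<xi> \<in> {min (w t ?p) (w t ?q)..max (w t ?p) (w t ?q)}"
    and bq: "b t ?q - b t ?p = V' \<xi> * (w t ?q - w t ?p)"
    using V_mvt[OF w_bounds w_bounds, of t ?p t ?q] unfolding b_def by blast
  have \<xi>01: "\<xi> \<in> {0..umax}" using \<xi> w_bounds[of t ?p] w_bounds[of t ?q] by auto
  have "\<bar>\<xi> - w t ?p\<bar> \<le> \<bar>w t ?q - w t ?p\<bar>" using \<xi> by auto
  also have "\<dots> \<le> k 0 * umax * (?q - ?p)" using w_lipschitz[of t ?q ?p] pq by simp
  finally have "Q2 * \<bar>\<xi> - w t ?p\<bar> \<le> Q2 * (k 0 * umax * (?q - ?p))" using Q2_nonneg by (rule mult_left_mono)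
  with V'_lip[OF \<xi>01 w_bounds, of t ?p] have dV: "\<bar>V' \<xi> - V' (w t ?p)\<bar> \<le> Q2 * (k 0 * umax) * (?q - ?p)" by (simp add: mult_ac)
  define r where "r = (LINT z:{?p..?q}|lborel. G t z - G t ?p) / (?q - ?p)"
  have "\<bar>LINT z:{?p..?q}|lborel. G t z - G t ?p\<bar> \<le> \<omega> * (?q - ?p)"
    by (rule set_integral_bound_interval) (use pq \<omega> in auto)
  then have r: "\<bar>r\<bar> \<le> \<omega>" using pq by (simp add: r_def field_simps)
  have iG: "set_integrable lborel {?p..?q} (G t)" by (rule integral_convolution(2)[OF u_measurable u_abs kd_int])
  have ic: "set_integrable lborel {?p..?q} (\<lambda>z. c)" for c :: real
    by (rule borel_integrable_atLeastAtMost') simp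
  have "w t ?q - w t ?p = (LINT z:{?p..?q}|lborel. G t z) - (LINT z:{?p..?q}|lborel. k 0 * u t z)"
    using w_increment[of ?p ?q t] pq iG set_integrable_u by (simp add: set_integral_diff(2))
  also have "(LINT z:{?p..?q}|lborel. k 0 * u t z) = k 0 * ?M" using mass_conservation[of x q t] xq t by simp
  also have "(LINT z:{?p..?q}|lborel. G t z) = (G t ?p + r) * (?q - ?p)"
  proof -
    have "(LINT z:{?p..?q}|lborel. G t z - G t ?p) = (LINT z:{?p..?q}|lborel. G t z) - (LINT z:{?p..?q}|lborel. G t ?p)"
      by (rule set_integral_diff(2)[OF iG ic])
    also have "(LINT z:{?p..?q}|lborel. G t ?p) = G t ?p * (?q - ?p)" using pq by (simp add: set_lebesgue_integral_def)
    finally show ?thesis using pq by (simp add: r_def field_simps)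
  qed
  finally have wq: "w t ?q - w t ?p = (G t ?p + r) * (?q - ?p) - k 0 * ?M" .
  have A: "?q - ?p = ?A * ?M" using M by (simp add: cell_def)
  have quot: "(b t ?q - b t ?p) / ?M = V' \<xi> * ((G t ?p + r) * ?A - k 0)"
    unfolding bq wq using M by (simp add: A field_simps)
  show thesis
  proof
    show "(cell x q has_real_derivative V' \<xi> * ((G t ?p + r) * ?A - k 0)) (at t)"
      unfolding quot[symmetric] unfolding cell_def[abs_def] by (intro DERIV_cdivide DERIV_diff X_props(3) t)
    have A0: "0 \<le> ?A" using cell_bounds(1)[OF xq, of t] t umax_pos by (meson divide_nonneg_pos less_imp_le order_trans zero_le_one)
    have "V' \<xi> * ((G t ?p + r) * ?A - k 0) - V' (w t ?p) * (G t ?p * ?A - k 0)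
        = V' \<xi> * r * ?A + (V' \<xi> - V' (w t ?p)) * (G t ?p * ?A - k 0)" by (simp add: algebra_simps)
    moreover have "\<bar>V' \<xi> * r * ?A\<bar> \<le> Q * \<omega> * ?A"
      unfolding abs_mult using V'_abs[OF \<xi>01] r A0 Q_pos by (intro mult_mono) auto
    moreover have "\<bar>(V' \<xi> - V' (w t ?p)) * (G t ?p * ?A - k 0)\<bar> \<le> Q2 * (k 0 * umax) * (?q - ?p) * (k 0 * umax * ?A + k 0)"
    proof -
      have "0 \<le> G t ?p * ?A" "G t ?p * ?A \<le> k 0 * umax * ?A" using G_bounds[of t ?p] A0 by (auto intro: mult_right_mono)
      then have "\<bar>G t ?p * ?A - k 0\<bar> \<le> k 0 * umax * ?A + k 0" using k_nonneg[of 0] by (simp add: abs_le_iff)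
      with dV show ?thesis unfolding abs_mult by (intro mult_mono) auto
    qed
    ultimately show "\<bar>V' \<xi> * ((G t ?p + r) * ?A - k 0) - V' (w t ?p) * (G t ?p * ?A - k 0)\<bar>
       \<le> Q * \<omega> * ?A + Q2 * (k 0 * umax) * (?q - ?p) * (k 0 * umax * ?A + k 0)" by linarith
  qed
qed

lemma initial_cell_close:
  assumes \<eta>: "0 < \<eta>"
  obtains d where "0 < d" "\<And>q. x < q \<Longrightarrow> q < x + d \<Longrightarrow> \<bar>cell x q 0 - a x 0\<bar> \<le> \<eta>"
proof -
  define \<gamma> where "\<gamma> = \<eta> * (a0 * a0)"
  have \<gamma>: "0 < \<gamma>" using \<eta> a0_pos by (simp add: \<gamma>_def)
  have "isCont (u 0) x" using u0_continuous by (auto simp: continuous_on_eq_continuous_at)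
  then obtain d where d: "0 < d" "\<And>z. \<bar>z - x\<bar> < d \<Longrightarrow> \<bar>u 0 z - u 0 x\<bar> < \<gamma>"
    unfolding continuous_at_eps_delta using \<gamma> by (metis dist_real_def)
  have "\<bar>cell x q 0 - a x 0\<bar> \<le> \<eta>" if q: "x < q" "q < x + d" for q
  proof -
    let ?M = "LINT z:{x..q}|lborel. u 0 z"
    define m where "m = ?M / (q - x)"
    have near: "u 0 x - \<gamma> \<le> u 0 z" "u 0 z \<le> u 0 x + \<gamma>" if "x \<le> z" "z \<le> q" for z
      using d(2)[of z] that q by (auto simp: abs_less_iff)
    have "(u 0 x - \<gamma>) * (q - x) \<le> ?M" "?M \<le> (u 0 x + \<gamma>) * (q - x)"
      using set_integral_u_bounds[of x q "u 0 x - \<gamma>" 0 "u 0 x + \<gamma>"] near q by auto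
    then have m1: "\<bar>m - u 0 x\<bar> \<le> \<gamma>" using q by (auto simp: m_def abs_le_iff field_simps)
    have m2: "a0 \<le> m" using initial_mass_pos(1)[OF q(1)] q by (simp add: m_def field_simps)
    have u: "a0 \<le> u 0 x" by (rule u0_lower)
    have "cell x q 0 - a x 0 = 1 / m - 1 / u 0 x" using q by (simp add: cell_def m_def a_props(1) X_props(1))
    also have "\<dots> = (u 0 x - m) / (m * u 0 x)" using m2 u a0_pos by (simp add: field_simps)
    finally have "\<bar>cell x q 0 - a x 0\<bar> = \<bar>m - u 0 x\<bar> / (m * u 0 x)"
      using m2 u a0_pos by (simp add: abs_minus_commute abs_mult)
    also have "\<dots> \<le> \<gamma> / (a0 * a0)"
      using m1 m2 u a0_pos \<gamma> by (intro frac_le mult_mono) auto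
    also have "\<dots> = \<eta>" using a0_pos by (simp add: \<gamma>_def)
    finally show ?thesis .
  qed
  with d(1) that show thesis by blast
qed

text \<open>
  Gronwall's inequality for the difference of two solutions of nearly the same linear equation with
  nearly the same initial values.
\<close>

lemma cell_close:
  assumes t: "0 \<le> t" and \<eta>: "0 < \<eta>"
  obtains d where "0 < d" "\<And>q. x < q \<Longrightarrow> q < x + d \<Longrightarrow> \<bar>cell x q t - a x t\<bar> \<le> \<eta>"
proof -
  define L where "L = Q * (k 0 * umax)"
  have L: "0 \<le> L" using Q_pos k_nonneg[of 0] umax_pos by (simp add: L_def)
  define \<eta>' where "\<eta>' = \<eta> / ((1 + t) * exp (L * t))"
  have \<eta>': "0 < \<eta>'" using \<eta> t by (simp add: \<eta>'_def)
  define C where "C = exp (K * t) / a0"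
  have C: "0 < C" using a0_pos by (simp add: C_def)
  (* the admissible oscillation of G and the width bound c3 each leave half of \<eta>' for the error of the equation *)
  define \<omega> where "\<omega> = \<eta>' / (2 * Q * C)"
  have \<omega>: "0 < \<omega>" using \<eta>' C Q_pos by (simp add: \<omega>_def)
  define c3 where "c3 = Q2 * (k 0 * umax) * exp (K * t) * (k 0 * umax * C + k 0)"
  have c3: "0 \<le> c3" using Q2_nonneg k_nonneg[of 0] umax_pos C by (simp add: c3_def)
  obtain d1 where d1: "0 < d1" "\<And>h. \<bar>h\<bar> < d1 \<Longrightarrow> (LINT s|lborel. \<bar>kd (s + h) - kd s\<bar>) < \<omega> / umax"
    using integrable_translation_modulus[OF kd_int, of "\<omega> / umax"] \<omega> umax_pos by auto
  obtain d2 where d2: "0 < d2" "\<And>q. x < q \<Longrightarrow> q < x + d2 \<Longrightarrow> \<bar>cell x q 0 - a x 0\<bar> \<le> \<eta>'"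
    using initial_cell_close[OF \<eta>', of x] by blast
  define d where "d = Min {d1 / exp (K * t), d2, \<eta>' / (2 * (c3 + 1))}"
  have d: "0 < d" using d1(1) d2(1) \<eta>' c3 by (simp add: d_def)
  have "\<bar>cell x q t - a x t\<bar> \<le> \<eta>" if q: "x < q" "q < x + d" for q
  proof -
    have qd: "q - x < d1 / exp (K * t)" "q < x + d2" "q - x < \<eta>' / (2 * (c3 + 1))"
      using q by (auto simp: d_def)
    have expK: "exp (K * s) \<le> exp (K * t)" if "s \<le> t" for s using that K_pos by simp
    have Xd: "X q s - X x s \<le> (q - x) * exp (K * t)" if "0 \<le> s" "s \<le> t" for s
      using X_increment_upper[of x q s] q that mult_left_mono[OF expK[OF that(2)], of "q - x"] by linarith
    have Ab: "cell x q s \<le> C" "0 \<le> cell x q s" if "0 \<le> s" "s \<le> t" for s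
    proof -
      have "exp (K * s) / a0 \<le> C" unfolding C_def using expK[OF that(2)] a0_pos by (intro divide_right_mono) auto
      with cell_bounds[OF q(1) that(1)] show "cell x q s \<le> C" by linarith
      have "0 < 1 / umax" using umax_pos by simp
      with cell_bounds[OF q(1) that(1)] show "0 \<le> cell x q s" by linarith
    qed
    have G\<omega>: "\<bar>G s z - G s (X x s)\<bar> \<le> \<omega>" if s: "0 \<le> s" "s \<le> t" and z: "X x s \<le> z" "z \<le> X q s" for s z
    proof -
      have "(q - x) * exp (K * t) < d1" using qd(1) by (simp add: pos_less_divide_eq)
      then have "\<bar>z - X x s\<bar> < d1" using Xd[OF s] z by auto
      from d1(2)[OF this] have "umax * (LINT r|lborel. \<bar>kd (r + (z - X x s)) - kd r\<bar>) \<le> umax * (\<omega> / umax)"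
        using umax_pos by (intro mult_left_mono) auto
      with convolution_translate_le[OF u_measurable u_abs kd_int, of s z "X x s"] show ?thesis using umax_pos by simp
    qed
    have deriv: "\<exists>dA. (cell x q has_real_derivative dA) (at s) \<and>
        \<bar>dA - V' (w s (X x s)) * (G s (X x s) * cell x q s - k 0)\<bar> \<le> \<eta>'" if s: "0 < s" "s < t" for s
    proof -
      obtain dA where dA: "(cell x q has_real_derivative dA) (at s)"
        "\<bar>dA - V' (w s (X x s)) * (G s (X x s) * cell x q s - k 0)\<bar>
       \<le> Q * \<omega> * cell x q s + Q2 * (k 0 * umax) * (X q s - X x s) * (k 0 * umax * cell x q s + k 0)"
        by (rule cell_deriv[OF q(1) s(1) G\<omega>[OF less_imp_le[OF s(1)] less_imp_le[OF s(2)]]])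
      have "Q * \<omega> * cell x q s \<le> Q * \<omega> * C" using Ab[of s] s Q_pos \<omega> by (intro mult_left_mono) auto
      also have "\<dots> = \<eta>' / 2" using Q_pos C by (simp add: \<omega>_def)
      finally have 1: "Q * \<omega> * cell x q s \<le> \<eta>' / 2" .
      have "Q2 * (k 0 * umax) * (X q s - X x s) * (k 0 * umax * cell x q s + k 0) \<le>
        Q2 * (k 0 * umax) * ((q - x) * exp (K * t)) * (k 0 * umax * C + k 0)"
        using Ab[of s] s Xd[of s] Q2_nonneg k_nonneg[of 0] umax_pos X_strict_mono[OF q(1), of s]
        by (intro mult_mono add_mono mult_left_mono) (auto intro!: mult_nonneg_nonneg add_nonneg_nonneg)
      also have "\<dots> = c3 * (q - x)" by (simp add: c3_def mult_ac)
      also have "\<dots> \<le> c3 * (\<eta>' / (2 * (c3 + 1)))" using qd(3) c3 by (intro mult_left_mono) auto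
      also have "\<dots> \<le> \<eta>' / 2" using c3 \<eta>' by (simp add: field_simps)
      finally show ?thesis using dA 1 by (intro exI[of _ dA] conjI) auto
    qed
    then obtain dA where dA: "\<And>s. 0 < s \<Longrightarrow> s < t \<Longrightarrow> (cell x q has_real_derivative dA s) (at s)"
      "\<And>s. 0 < s \<Longrightarrow> s < t \<Longrightarrow> \<bar>dA s - V' (w s (X x s)) * (G s (X x s) * cell x q s - k 0)\<bar> \<le> \<eta>'" by metis
    let ?a' = "\<lambda>s. V' (w s (X x s)) * (G s (X x s) * a x s - k 0)"
    have "\<sigma> * (cell x q t - a x t) \<le> (\<eta>' + \<eta>' * t) * exp (L * t)" if \<sigma>: "\<sigma> = 1 \<or> \<sigma> = -1" for \<sigma> :: real
    proof (rule gronwall_affine[where T=t and f="\<lambda>s. \<sigma> * (cell x q s - a x s)" and f'="\<lambda>s. \<sigma> * (dA s - ?a' s)"])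
      have "continuous_on {0..t} (cell x q)" unfolding cell_def[abs_def]
        using initial_mass_pos(2)[OF q(1)] by (intro continuous_intros X_continuous) auto
      moreover have "continuous_on {0..t} (a x)" by (rule continuous_on_subset[OF a_props(2)]) auto
      ultimately show "continuous_on {0..t} (\<lambda>s. \<sigma> * (cell x q s - a x s))" by (intro continuous_intros)
      show "((\<lambda>s. \<sigma> * (cell x q s - a x s)) has_real_derivative \<sigma> * (dA s - ?a' s)) (at s)" if "0 < s" "s < t" for s
        by (intro DERIV_cmult DERIV_diff dA(1) a_props(3) that)
      show "\<sigma> * (cell x q 0 - a x 0) \<le> \<eta>'" using d2(2)[OF q(1) qd(2)] \<sigma> by auto
      fix s assume s: "0 < s" "s < t" and pos: "0 < \<sigma> * (cell x q s - a x s)"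
      let ?e = "cell x q s - a x s"
      have e: "\<bar>?e\<bar> = \<sigma> * ?e" using pos \<sigma> by auto
      have "dA s - ?a' s = (dA s - V' (w s (X x s)) * (G s (X x s) * cell x q s - k 0)) + V' (w s (X x s)) * G s (X x s) * ?e"
        by (simp add: algebra_simps)
      moreover have "\<bar>V' (w s (X x s)) * G s (X x s) * ?e\<bar> \<le> L * \<bar>?e\<bar>"
        unfolding abs_mult L_def using V'_abs[OF w_bounds, of s "X x s"] G_bounds[of s "X x s"] Q_pos
        by (intro mult_right_mono mult_mono) auto
      ultimately have "\<bar>dA s - ?a' s\<bar> \<le> \<eta>' + L * \<bar>?e\<bar>" using dA(2)[OF s] by linarith
      moreover have "\<sigma> * (dA s - ?a' s) \<le> \<bar>dA s - ?a' s\<bar>" using \<sigma> by auto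
      ultimately show "\<sigma> * (dA s - ?a' s) \<le> L * (\<sigma> * ?e) + \<eta>'" unfolding e by linarith
    qed (use L \<eta>' t in auto)
    then have "\<bar>cell x q t - a x t\<bar> \<le> (\<eta>' + \<eta>' * t) * exp (L * t)" using that by (fastforce simp: abs_le_iff)
    also have "\<dots> = \<eta>' * ((1 + t) * exp (L * t))" by (simp add: algebra_simps)
    also have "\<dots> = \<eta>" using t by (simp add: \<eta>'_def add_nonneg_eq_0_iff)
    finally show ?thesis .
  qed
  with d that show thesis by blast
qed

lemma a_lower:
  assumes "0 \<le> t"
  shows "1 / umax \<le> a x t"
proof (rule field_le_epsilon)
  fix e :: real assume "0 < e"
  from cell_close[OF assms this, of x] obtain d where d: "0 < d"
    "\<And>q. x < q \<Longrightarrow> q < x + d \<Longrightarrow> \<bar>cell x q t - a x t\<bar> \<le> e" by blast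
  have "\<bar>cell x (x + d / 2) t - a x t\<bar> \<le> e" using d by auto
  moreover have "1 / umax \<le> cell x (x + d / 2) t" using d assms by (intro cell_bounds) auto
  ultimately show "1 / umax \<le> a x t + e" by linarith
qed

lemma a_pos:
  assumes "0 \<le> t"
  shows "0 < a x t"
proof -
  have "0 < 1 / umax" using umax_pos by simp
  with a_lower[OF assms, of x] show ?thesis by linarith
qed

text \<open>
  The version of \<open>u\<close> that is defined at every point by transport along characteristics.
\<close>

definition v :: "real \<Rightarrow> real \<Rightarrow> real" where
  "v t z = 1 / a (SOME x. X x t = z) t"

lemma v_X: "0 \<le> t \<Longrightarrow> v t (X x t) = 1 / a x t"
proof -
  assume t: "0 \<le> t"
  have "(SOME y. X y t = X x t) = x"
  proof (rule some_equality)
    show "y = x" if "X y t = X x t" for y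
      using X_strict_mono[of x y t] X_strict_mono[of y x t] t that by (cases y x rule: linorder_cases) auto
  qed simp
  then show ?thesis by (simp add: v_def)
qed

lemma v_bounds:
  assumes "0 \<le> t"
  shows "0 < v t z" "v t z \<le> umax"
proof -
  obtain x where x: "X x t = z" using X_surj[OF assms] .
  show "0 < v t z" using a_pos[OF assms, of x] v_X[OF assms, of x] x by simp
  have "1 / a x t \<le> umax" using a_lower[OF assms, of x] a_pos[OF assms, of x] umax_pos by (simp add: field_simps)
  then show "v t z \<le> umax" using v_X[OF assms, of x] x by simp
qed

text \<open>
  The average of \<open>u\<close> over a window to the right of a point is the mean density of the cell between
  two characteristics, and the cell shrinks with the window.
\<close>

lemma averages_tendsto_v:
  assumes t: "0 \<le> t"
  shows "(\<lambda>n. steklov (inverse (real (Suc n))) (u t) z) \<longlonglongrightarrow> v t z"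
proof -
  let ?h = "\<lambda>n. inverse (real (Suc n))"
  obtain x where x: "X x t = z" using X_surj[OF t] .
  have "\<exists>y. X y t = z + ?h n" for n using X_surj[OF t] by blast
  then obtain q where q: "\<And>n. X (q n) t = z + ?h n" by metis
  have xq: "x < q n" for n
  proof (rule ccontr)
    assume "\<not> x < q n"
    then have "X (q n) t \<le> X x t" using X_strict_mono[of "q n" x t] t by (cases "q n = x") auto
    then show False using q[of n] x by (simp add: not_le[symmetric])
  qed
  have qx: "q n - x \<le> exp (K * t) * ?h n" for n
  proof -
    have "(q n - x) * exp (- K * t) \<le> ?h n" using X_increment_lower[OF xq t, of n] q[of n] x by simp
    then have "exp (K * t) * ((q n - x) * exp (- K * t)) \<le> exp (K * t) * ?h n" by (intro mult_left_mono) auto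
    moreover have "exp (K * t) * ((q n - x) * exp (- K * t)) = q n - x" by (simp add: exp_minus)
    ultimately show ?thesis by (simp only:)
  qed
  have eq: "steklov (?h n) (u t) z = 1 / cell x (q n) t" for n
  proof -
    have "(LINT s:{0..?h n}|lborel. u t (z + s)) = (LINT r:{z..z + ?h n}|lborel. u t r)"
      using set_integral_translate[of z "z + ?h n" "\<lambda>s. u t (z + s)" z] by simp
    also have "\<dots> = (LINT r:{x..q n}|lborel. u 0 r)" using mass_conservation[of x "q n" t] xq[of n] t q[of n] x by simp
    finally show ?thesis by (simp add: steklov_def cell_def q x)
  qed
  have "(\<lambda>n. cell x (q n) t) \<longlonglongrightarrow> a x t"
  proof (rule LIMSEQ_I)
    fix e :: real assume e: "0 < e"
    then have "0 < e / 2" by simp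
    from cell_close[OF t this, of x] obtain d where d: "0 < d"
      "\<And>q. x < q \<Longrightarrow> q < x + d \<Longrightarrow> \<bar>cell x q t - a x t\<bar> \<le> e / 2" by blast
    obtain n0 where n0: "?h n0 < d / exp (K * t)" using reals_Archimedean[of "d / exp (K * t)"] d(1) by auto
    show "\<exists>n0. \<forall>n\<ge>n0. norm (cell x (q n) t - a x t) < e"
    proof (intro exI allI impI)
      fix n assume n: "n0 \<le> n"
      have "?h n \<le> ?h n0" using n by (intro le_imp_inverse_le) auto
      then have "?h n < d / exp (K * t)" using n0 by (rule le_less_trans)
      then have "?h n * exp (K * t) < d" by (subst (asm) pos_less_divide_eq) (rule exp_gt_zero)
      then have "exp (K * t) * ?h n < d" by (simp only: mult.commute)
      then have "q n < x + d" using qx[of n] by linarith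
      then show "norm (cell x (q n) t - a x t) < e" using d(2)[OF xq] e by fastforce
    qed
  qed
  then have "(\<lambda>n. 1 / cell x (q n) t) \<longlonglongrightarrow> 1 / a x t" using a_pos[OF t, of x] by (intro tendsto_intros) auto
  then show ?thesis unfolding eq using v_X[OF t, of x] x by simp
qed

lemma u_AE_eq_v: "0 \<le> t \<Longrightarrow> AE x in lborel. u t x = v t x"
  by (rule AE_eq_limit_of_averages[OF u_measurable u_abs averages_tendsto_v])

lemma v_measurable: "0 \<le> t \<Longrightarrow> v t \<in> borel_measurable borel"
proof -
  assume t: "0 \<le> t"
  show ?thesis
  proof (rule borel_measurable_LIMSEQ_real)
    show "(\<lambda>n. steklov (inverse (real (Suc n))) (u t) z) \<longlonglongrightarrow> v t z" for z
      by (rule averages_tendsto_v[OF t])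
    show "steklov (inverse (real (Suc n))) (u t) \<in> borel_measurable borel" for n
      unfolding steklov_def[abs_def] set_lebesgue_integral_def by measurable
  qed
qed

lemma v_0: "v 0 x = u 0 x"
  using v_X[of 0 x] by (simp add: X_props(1) a_props(1))

lemma convolution_v:
  assumes "0 \<le> t" and [measurable]: "f \<in> borel_measurable borel"
  shows "convolution (u t) f x = convolution (v t) f x"
proof -
  have [measurable]: "v t \<in> borel_measurable borel" by (rule v_measurable[OF assms(1)])
  show ?thesis unfolding convolution_alt
  proof (rule integral_cong_AE)
    show "AE s in lborel. u t s * f (x - s) = v t s * f (x - s)"
      using u_AE_eq_v[OF assms(1)] by eventually_elim simp
  qed measurable
qed

lemma v_abs: "0 \<le> t \<Longrightarrow> \<bar>v t x\<bar> \<le> umax"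
  using v_bounds[of t x] by simp

lemma w_increment_v:
  assumes "0 \<le> t" "x \<le> y"
  shows "w t y - w t x = (LINT z:{x..y}|lborel. G t z - k 0 * v t z)"
  using convolution_k_increment[OF v_measurable[OF assms(1)] v_abs[OF assms(1)] assms(2)]
    convolution_v[OF assms(1)] by simp

lemma v_along_X:
  "continuous_on {0..T} (\<lambda>t. v t (X x t))"
  "0 < t \<Longrightarrow> ((\<lambda>t. v t (X x t)) has_real_derivative
     v t (X x t) * - V' (w t (X x t)) * (G t (X x t) - k 0 * v t (X x t))) (at t)"
proof -
  have "a x t \<noteq> 0" if "t \<in> {0..T}" for t using a_pos[of t x] that by auto
  then have "continuous_on {0..T} (\<lambda>t. 1 / a x t)"
    by (intro continuous_on_divide continuous_on_const continuous_on_subset[OF a_props(2)]) auto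
  then show "continuous_on {0..T} (\<lambda>t. v t (X x t))"
    by (rule continuous_on_eq) (simp add: v_X)
  assume t: "0 < t"
  have "\<forall>\<^sub>F s in nhds t. s \<in> {0<..}" using t by (intro eventually_nhds_in_open) auto
  then have ev: "\<forall>\<^sub>F s in nhds t. v s (X x s) = 1 / a x s" by eventually_elim (simp add: v_X)
  have "((\<lambda>s. 1 / a x s) has_real_derivative
     v t (X x t) * - V' (w t (X x t)) * (G t (X x t) - k 0 * v t (X x t))) (at t)"
    using a_pos[of t x] t
    by (auto intro!: derivative_eq_intros a_props(3) simp: v_X field_simps)
  from DERIV_eventually_eq[OF this ev] show "((\<lambda>t. v t (X x t)) has_real_derivative
     v t (X x t) * - V' (w t (X x t)) * (G t (X x t) - k 0 * v t (X x t))) (at t)" .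
qed

end

section \<open>Bounds that propagate in time\<close>

text \<open>
  The algebra behind the estimate, for two points at distance \<open>\<Delta>\<close> that carry the densities \<open>y1\<close> and
  \<open>y1 - R \<Delta>\<close>. Here \<open>m\<close> bounds all negative difference quotients, \<open>W\<close> is the difference
  quotient of \<open>w\<close>, \<open>g1\<close> and \<open>g2\<close> stand for \<open>w\<^sub>x\<close>, and \<open>q1\<close>, \<open>q2\<close>, \<open>qs\<close> are values of
  \<open>- V'\<close> at the end points and between them. If \<open>R = N = m = \<mu>\<close> and all terms with a factor
  \<open>\<Delta>\<close> are ignored, the bracket is \<open>q (2 m W - y (W + m) / D)\<close>. With \<open>y \<ge> 2 D \<mu>\<close> and
  \<open>W + m \<ge> 0\<close> this is at most \<open>- 2 q \<mu>\<^sup>2\<close>. The deficits \<open>m - R\<close> and \<open>m - N\<close>, both at most \<open>E\<close>,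
  enter linearly and with a coefficient independent of \<open>E\<close>; the halving argument depends on that.
\<close>

lemma one_sided_rate_inequality:
  fixes \<Delta> :: real
  assumes \<Delta>: "0 < \<Delta>" and W: "\<bar>W\<bar> \<le> g0" "0 \<le> W + m"
    and g2: "\<bar>g2 - W\<bar> \<le> Lg * \<Delta>" "\<bar>g2\<bar> \<le> g0"
    and q1: "\<delta> \<le> q1" "q1 \<le> Q" "0 < \<delta>" and q2: "\<bar>q2 - q1\<bar> \<le> c2 * \<Delta>" "0 \<le> (q2 - q1) * W"
    and qs: "\<bar>qs - q1\<bar> \<le> c2 * \<Delta>"
    and y1: "2 * D * \<mu> \<le> y1" "y1 \<le> U" and D: "0 < D" and k0: "0 \<le> k0"
    and dg: "((W + m) / D - k0 * (m - R)) * \<Delta> \<le> g2 - g1"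
    and N: "0 \<le> N" "N \<le> R" "R \<le> m" "R \<le> Lv" "\<mu> \<le> N" and m: "m = \<mu> + E" and \<mu>: "0 \<le> \<mu>"
  shows "- ((y1 - R * \<Delta>) * q2 * g2 - y1 * q1 * g1) + N * (qs * (W * \<Delta>)) \<le>
     (- 2 * \<delta> * \<mu>\<^sup>2 + (4 * Q * g0 + U * Q * k0) * E + (2 * Lv * c2 * g0 + Lv * Q * Lg + U * c2 * Lg) * \<Delta>) * \<Delta>"
proof -
  have pos: "0 \<le> R" "0 \<le> m" "0 \<le> E" "0 \<le> Lv" "0 \<le> g0" "0 \<le> Q" "0 \<le> q1" "0 \<le> y1" "0 \<le> U"
  proof -
    have "0 \<le> 2 * D * \<mu>" using D \<mu> by simp
    then show "0 \<le> R" "0 \<le> m" "0 \<le> E" "0 \<le> Lv" "0 \<le> g0" "0 \<le> Q" "0 \<le> q1" "0 \<le> y1" "0 \<le> U"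
      using N W q1 y1 D \<mu> m by linarith+
  qed
  have cpos: "0 \<le> c2" "0 \<le> Lg"
    using order_trans[OF abs_ge_zero q2(1)] order_trans[OF abs_ge_zero g2(1)] \<Delta> by (auto simp: zero_le_mult_iff)
  have s1: "R * (q2 * g2) \<le> R * (q1 * W) + Lv * (c2 * g0 + Q * Lg) * \<Delta>"
  proof -
    have "q2 * g2 - q1 * W = (q2 - q1) * g2 + q1 * (g2 - W)" by (simp add: algebra_simps)
    also have "\<dots> \<le> \<bar>q2 - q1\<bar> * \<bar>g2\<bar> + \<bar>q1\<bar> * \<bar>g2 - W\<bar>"
      unfolding abs_mult[symmetric] by linarith
    also have "\<dots> \<le> (c2 * \<Delta>) * g0 + Q * (Lg * \<Delta>)"
      using pos q1 q2 g2 cpos \<Delta> by (intro add_mono mult_mono) auto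
    finally have "q2 * g2 - q1 * W \<le> (c2 * g0 + Q * Lg) * \<Delta>" by (simp add: algebra_simps)
    then have "R * (q2 * g2 - q1 * W) \<le> R * ((c2 * g0 + Q * Lg) * \<Delta>)" using pos by (intro mult_left_mono)
    also have "\<dots> \<le> Lv * ((c2 * g0 + Q * Lg) * \<Delta>)" using N pos cpos \<Delta> by (intro mult_right_mono) auto
    finally show ?thesis by (simp add: algebra_simps)
  qed
  have s2: "- (y1 * ((q2 - q1) * g2)) \<le> U * c2 * Lg * \<Delta> * \<Delta>"
  proof -
    have "- ((q2 - q1) * g2) = - ((q2 - q1) * W) - (q2 - q1) * (g2 - W)" by (simp add: algebra_simps)
    also have "\<dots> \<le> \<bar>q2 - q1\<bar> * \<bar>g2 - W\<bar>" unfolding abs_mult[symmetric] using q2(2) by linarith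
    also have "\<dots> \<le> (c2 * \<Delta>) * (Lg * \<Delta>)" using q2 g2 cpos \<Delta> by (intro mult_mono) auto
    finally have "y1 * (- ((q2 - q1) * g2)) \<le> y1 * ((c2 * \<Delta>) * (Lg * \<Delta>))" using pos by (intro mult_left_mono)
    also have "\<dots> \<le> U * ((c2 * \<Delta>) * (Lg * \<Delta>))" using y1 cpos \<Delta> by (intro mult_right_mono) auto
    finally show ?thesis by (simp add: mult_ac)
  qed
  have s3: "- (y1 * q1 * (g2 - g1)) \<le> (q1 * (- 2 * \<mu> * (W + m)) + U * Q * k0 * E) * \<Delta>"
  proof -
    have "2 * \<mu> * (W + m) \<le> y1 / D * (W + m)"
      using y1 D W by (intro mult_right_mono) (auto simp: field_simps)
    then have "q1 * (2 * \<mu> * (W + m)) \<le> q1 * (y1 / D * (W + m))" using pos by (intro mult_left_mono)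
    moreover have "y1 * q1 * (k0 * (m - R)) \<le> U * Q * (k0 * E)"
      using pos y1 q1 k0 N m by (intro mult_mono mult_left_mono) auto
    ultimately have "q1 * (2 * \<mu> * (W + m)) - U * Q * k0 * E \<le> y1 * q1 * ((W + m) / D - k0 * (m - R))"
      by (simp add: right_diff_distrib mult_ac)
    then have "(q1 * (2 * \<mu> * (W + m)) - U * Q * k0 * E) * \<Delta> \<le> y1 * q1 * ((W + m) / D - k0 * (m - R)) * \<Delta>"
      using \<Delta> by (intro mult_right_mono) auto
    also have "\<dots> \<le> y1 * q1 * (g2 - g1)"
      using mult_left_mono[OF dg, of "y1 * q1"] pos by (simp add: mult_ac)
    finally show ?thesis by (simp add: algebra_simps)
  qed
  have s4: "N * (qs * W) \<le> N * (q1 * W) + Lv * c2 * g0 * \<Delta>"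
  proof -
    have "(qs - q1) * W \<le> \<bar>qs - q1\<bar> * \<bar>W\<bar>" unfolding abs_mult[symmetric] by linarith
    also have "\<dots> \<le> (c2 * \<Delta>) * g0" using qs W cpos \<Delta> by (intro mult_mono) auto
    finally have "N * ((qs - q1) * W) \<le> N * ((c2 * \<Delta>) * g0)" using N by (intro mult_left_mono)
    also have "\<dots> \<le> Lv * ((c2 * \<Delta>) * g0)" using N pos cpos \<Delta> by (intro mult_right_mono) auto
    finally show ?thesis by (simp add: algebra_simps)
  qed
  have s5: "(R + N) * (q1 * W) + q1 * (- 2 * \<mu> * (W + m)) \<le> - 2 * \<delta> * \<mu>\<^sup>2 + 4 * Q * g0 * E"
  proof -
    have "(R + N) * (q1 * W) + q1 * (- 2 * \<mu> * (W + m)) = q1 * (- 2 * \<mu>\<^sup>2 - 2 * \<mu> * E) + q1 * (W * (R + N - 2 * \<mu>))"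
      by (simp add: m power2_eq_square algebra_simps)
    moreover have "q1 * (- 2 * \<mu>\<^sup>2 - 2 * \<mu> * E) \<le> - 2 * \<delta> * \<mu>\<^sup>2"
    proof -
      have "\<delta> * (2 * \<mu>\<^sup>2) \<le> q1 * (2 * \<mu>\<^sup>2)" using q1 by (intro mult_right_mono) auto
      also have "\<dots> \<le> q1 * (2 * \<mu>\<^sup>2 + 2 * \<mu> * E)" using pos \<mu> by (intro mult_left_mono) auto
      finally show ?thesis by (simp add: algebra_simps)
    qed
    moreover have "q1 * (W * (R + N - 2 * \<mu>)) \<le> Q * (g0 * (2 * E))"
    proof -
      have "0 \<le> R + N - 2 * \<mu>" "R + N - 2 * \<mu> \<le> 2 * E" using N m by linarith+
      then have "W * (R + N - 2 * \<mu>) \<le> g0 * (2 * E)" using W pos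
        by (intro order_trans[OF mult_right_mono mult_left_mono]) auto
      then have "q1 * (W * (R + N - 2 * \<mu>)) \<le> q1 * (g0 * (2 * E))" using pos by (intro mult_left_mono)
      also have "\<dots> \<le> Q * (g0 * (2 * E))" using q1 pos by (intro mult_right_mono) auto
      finally show ?thesis .
    qed
    moreover have "0 \<le> Q * (g0 * E)" using pos by simp
    ultimately show ?thesis by (simp add: mult_ac)
  qed
  have "- ((y1 - R * \<Delta>) * q2 * g2 - y1 * q1 * g1) + N * (qs * (W * \<Delta>)) =
     (R * (q2 * g2)) * \<Delta> + - (y1 * ((q2 - q1) * g2)) + - (y1 * q1 * (g2 - g1)) + (N * (qs * W)) * \<Delta>"
    by (simp add: algebra_simps)
  also have "\<dots> \<le> (R * (q1 * W) + Lv * (c2 * g0 + Q * Lg) * \<Delta>) * \<Delta> + U * c2 * Lg * \<Delta> * \<Delta>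
     + (q1 * (- 2 * \<mu> * (W + m)) + U * Q * k0 * E) * \<Delta> + (N * (q1 * W) + Lv * c2 * g0 * \<Delta>) * \<Delta>"
    using \<Delta> by (intro add_mono s2 s3 mult_right_mono s1 s4) auto
  also have "\<dots> = (((R + N) * (q1 * W) + q1 * (- 2 * \<mu> * (W + m))) + U * Q * k0 * E
      + (2 * Lv * c2 * g0 + Lv * Q * Lg + U * c2 * Lg) * \<Delta>) * \<Delta>" by (simp add: algebra_simps)
  also have "\<dots> \<le> ((- 2 * \<delta> * \<mu>\<^sup>2 + 4 * Q * g0 * E) + U * Q * k0 * E
      + (2 * Lv * c2 * g0 + Lv * Q * Lg + U * c2 * Lg) * \<Delta>) * \<Delta>"
    using \<Delta> by (intro mult_right_mono add_mono s5 order_refl) auto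
  finally show ?thesis by (simp add: algebra_simps)
qed

context regular_traffic
begin

abbreviation g :: "real \<Rightarrow> real \<Rightarrow> real" where "g t x \<equiv> G t x - k 0 * v t x"
definition g0 :: real where "g0 = k 0 * umax"

lemma g0_nonneg: "0 \<le> g0" using k_nonneg[of 0] umax_pos by (simp add: g0_def)

lemma g_abs:
  assumes "0 \<le> t"
  shows "\<bar>g t x\<bar> \<le> g0"
proof -
  have "0 \<le> k 0 * v t x" "k 0 * v t x \<le> k 0 * umax"
    using v_bounds[OF assms, of x] k_nonneg[of 0] by (auto intro: mult_left_mono)
  with G_bounds[of t x] show ?thesis unfolding g0_def by linarith
qed

lemma w_abs_increment: "\<bar>w t x - w t y\<bar> \<le> g0 * \<bar>x - y\<bar>"
  using w_lipschitz by (simp add: g0_def)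

lemma convolution_difference:
  assumes t: "0 \<le> t" and f: "integrable lborel f"
  shows "convolution (u t) f y - convolution (u t) f x = (LINT r|lborel. (v t (y - r) - v t (x - r)) * f r)"
    and "integrable lborel (\<lambda>r. (v t (y - r) - v t (x - r)) * f r)"
proof -
  have [measurable]: "v t \<in> borel_measurable borel" "f \<in> borel_measurable borel" using v_measurable[OF t] f by auto
  have i: "integrable lborel (\<lambda>r. v t (z - r) * f r)" for z
    by (rule integrable_bounded_mult[OF _ v_abs[OF t] f]) measurable
  have c: "convolution (u t) f z = (LINT r|lborel. v t (z - r) * f r)" for z
    using convolution_v[OF t, of f z] by (simp add: convolution_def)
  show "convolution (u t) f y - convolution (u t) f x = (LINT r|lborel. (v t (y - r) - v t (x - r)) * f r)"
    unfolding c by (subst Bochner_Integration.integral_diff[symmetric, OF i i]) (simp add: algebra_simps)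
  show "integrable lborel (\<lambda>r. (v t (y - r) - v t (x - r)) * f r)"
    using Bochner_Integration.integrable_diff[OF i[of y] i[of x]] by (simp add: left_diff_distrib)
qed

lemma convolution_difference_abs_le:
  assumes t: "0 \<le> t" and f: "integrable lborel f" "\<And>r. 0 \<le> f r" and c: "\<And>r. \<bar>v t (y - r) - v t (x - r)\<bar> \<le> c"
  shows "\<bar>convolution (u t) f y - convolution (u t) f x\<bar> \<le> c * (LINT r|lborel. f r)"
proof -
  have "\<bar>convolution (u t) f y - convolution (u t) f x\<bar> \<le> (LINT r|lborel. \<bar>(v t (y - r) - v t (x - r)) * f r\<bar>)"
    unfolding convolution_difference(1)[OF t f(1)] by (rule integral_abs_bound)
  also have "\<dots> \<le> (LINT r|lborel. c * f r)"
    using f c by (intro integral_mono integrable_abs convolution_difference(2) t) (auto simp: abs_mult intro: mult_right_mono)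
  finally show ?thesis by simp
qed

text \<open>
  Where \<open>v\<close> is close to its infimum \<open>i\<close>, \<open>G \<ge> k(0) i\<close> makes the right-hand side
  \<open>q v (G - k(0) v)\<close> nearly nonnegative.
\<close>

lemma v_lower_bound:
  assumes T: "0 \<le> T"
  shows "a0 \<le> v T z"
proof -
  define C where "C = umax * Q * k 0"
  have C: "0 \<le> C" using umax_pos Q_pos k_nonneg[of 0] by (simp add: C_def)
  have "a0 - v t (X x t) \<le> 0" if "x \<in> UNIV" "0 \<le> t" "t \<le> T" for x t
  proof (rule family_nonpos_by_halving[where I=UNIV and T=T and \<kappa>=C and d="\<lambda>x t. a0 - v t (X x t)", OF _ C _ that])
    show "a0 - v t (X x t) \<le> a0" if "0 \<le> t" for x t using v_bounds(1)[OF that, of "X x t"] by simp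
    fix B x t
    assume B: "0 \<le> B" and hyp: "\<And>x t. x \<in> UNIV \<Longrightarrow> 0 \<le> t \<Longrightarrow> t \<le> T \<Longrightarrow> a0 - v t (X x t) \<le> B * exp (C * t)"
      and t: "0 \<le> t" "t \<le> T"
    let ?f = "\<lambda>s. a0 - v s (X x s) - B / 2 * exp (C * s)"
    have "?f t \<le> 0"
    proof (rule nonpos_if_nonincreasing_where_positive[where T=T and f="?f" and
          f'="\<lambda>s. - (v s (X x s) * - V' (w s (X x s)) * g s (X x s)) - B / 2 * (C * exp (C * s))", OF _ _ _ _ t])
      show "continuous_on {0..T} ?f" by (intro continuous_intros v_along_X(1))
      show "?f 0 \<le> 0" using u0_lower[of x] B by (simp add: v_0 X_props(1))
      fix s assume s: "0 < s" "s < T"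
      show "(?f has_real_derivative - (v s (X x s) * - V' (w s (X x s)) * g s (X x s)) - B / 2 * (C * exp (C * s))) (at s)"
        by (auto intro!: derivative_eq_intros v_along_X(2)[OF s(1)])
      assume pos: "0 < ?f s"
      define E where "E = B * exp (C * s)"
      let ?y = "v s (X x s)" and ?q = "- V' (w s (X x s))"
      have s0: "0 \<le> s" using s by simp
      have low: "a0 - E \<le> v s z" for z
      proof -
        obtain y where "X y s = z" using X_surj[OF s0] .
        with hyp[of y s] s show ?thesis by (simp add: E_def)
      qed
      have "(a0 - E) * k 0 \<le> G s (X x s)"
        using convolution_bounds(1)[OF v_measurable[OF s0] low v_bounds(2)[OF s0] kd_int kd_nonneg]
          convolution_v[OF s0, of kd] by (simp add: kd_total)
      then have "k 0 * (a0 - E - ?y) \<le> g s (X x s)" by (simp add: algebra_simps)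
      moreover have yq: "0 \<le> ?y * ?q" "?y * ?q \<le> umax * Q"
      proof -
        have "0 \<le> ?y" "?y \<le> umax" "0 \<le> ?q" "?q \<le> Q"
          using v_bounds[OF s0, of "X x s"] V'_le[OF w_bounds, of s "X x s"] V'_ge[OF w_bounds, of s "X x s"] \<delta>_pos by auto
        then show "0 \<le> ?y * ?q" "?y * ?q \<le> umax * Q"
          using umax_pos by (blast intro: mult_nonneg_nonneg mult_mono less_imp_le)+
      qed
      ultimately have "(?y * ?q) * (k 0 * (a0 - E - ?y)) \<le> (?y * ?q) * g s (X x s)" by (intro mult_left_mono)
      moreover have "(?y * ?q) * (k 0 * (?y - (a0 - E))) \<le> (umax * Q) * (k 0 * (E / 2))"
      proof (rule mult_mono[OF yq(2)])
        show "k 0 * (?y - (a0 - E)) \<le> k 0 * (E / 2)"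
          using pos k_nonneg[of 0] by (intro mult_left_mono) (auto simp: E_def)
        show "0 \<le> k 0 * (?y - (a0 - E))"
          using low[of "X x s"] k_nonneg[of 0] by (intro mult_nonneg_nonneg) auto
      qed (use umax_pos Q_pos in auto)
      ultimately show "- (?y * ?q * g s (X x s)) - B / 2 * (C * exp (C * s)) \<le> 0"
        by (simp add: C_def E_def algebra_simps)
    qed
    then show "a0 - v t (X x t) \<le> B / 2 * exp (C * t)" by simp
  qed
  moreover obtain x where "X x T = z" using X_surj[OF T] .
  ultimately show ?thesis using T by force
qed

lemma flux_source_difference:
  fixes y1 y2 q1 q2 g1 g2 :: real
  shows "y2 * q2 * g2 - y1 * q1 * g1 = (y2 - y1) * (q2 * g2) + y1 * ((q2 - q1) * g2) + y1 * (q1 * (g2 - g1))"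
  by (simp add: algebra_simps)

lemma V'_w_increment: "\<bar>V' (w t x) - V' (w t y)\<bar> \<le> Q2 * g0 * \<bar>x - y\<bar>"
proof -
  have "\<bar>V' (w t x) - V' (w t y)\<bar> \<le> Q2 * \<bar>w t x - w t y\<bar>" by (rule V'_lip[OF w_bounds w_bounds])
  also have "\<dots> \<le> Q2 * (g0 * \<bar>x - y\<bar>)" using Q2_nonneg by (intro mult_left_mono w_abs_increment)
  finally show ?thesis by (simp add: mult.assoc)
qed

text \<open>
  The regularisation \<open>e\<close> makes the difference quotients bounded a priori, which the halving argument
  requires; the resulting bound does not depend on it. Translating both points changes neither their
  distance nor the bound, so \<open>G\<close> inherits the modulus of \<open>v\<close>.
\<close>

lemma v_almost_lipschitz:
  assumes u0: "\<And>x y. \<bar>u 0 x - u 0 y\<bar> \<le> K0 * \<bar>x - y\<bar>" and K0: "0 \<le> K0" and e: "0 < e"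
    and T: "0 \<le> t" "t \<le> T"
    and C: "C = Q * g0 + 2 * umax * Q * k 0 + K + umax * Q2 * g0 * g0"
  shows "\<bar>v t z2 - v t z1\<bar> \<le> ((K0 + 1) * exp (C * t) - 1) * (\<bar>z2 - z1\<bar> + e)"
proof -
  have C0: "0 \<le> C" unfolding C using Q_pos g0_nonneg umax_pos k_nonneg[of 0] K_pos Q2_nonneg by simp
  define \<mu> where "\<mu> s = (K0 + 1) * exp (C * s) - 1" for s
  have \<mu>0: "0 \<le> \<mu> s" if "0 \<le> s" for s
  proof -
    have "1 * 1 \<le> (K0 + 1) * exp (C * s)" using K0 C0 that by (intro mult_mono) auto
    then show ?thesis by (simp add: \<mu>_def)
  qed
  define I :: "(real \<times> real \<times> real) set" where "I = {(\<sigma>, x, y). (\<sigma> = 1 \<or> \<sigma> = - 1) \<and> x < y}"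
  define d where "d = (\<lambda>(\<sigma>, x, y) s. \<sigma> * (v s (X y s) - v s (X x s)) / (X y s - X x s + e) - \<mu> s)"
  have main: "d i s \<le> 0" if "i \<in> I" "0 \<le> s" "s \<le> T" for i s
  proof (rule family_nonpos_by_halving[where I=I and T=T and \<kappa>="2 * C" and d=d, OF _ _ _ that])
    show "0 \<le> 2 * C" using C0 by simp
    show "d i s \<le> umax / e" if i: "i \<in> I" and s: "0 \<le> s" for i s
    proof -
      obtain \<sigma> x y where ixy: "i = (\<sigma>, x, y)" "\<sigma> = 1 \<or> \<sigma> = - 1" "x < y" using i by (auto simp: I_def)
      have "\<sigma> * (v s (X y s) - v s (X x s)) \<le> umax"
        using ixy(2) v_bounds[OF s, of "X y s"] v_bounds[OF s, of "X x s"] by auto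
      then have "\<sigma> * (v s (X y s) - v s (X x s)) / (X y s - X x s + e) \<le> umax / (X y s - X x s + e)"
        using X_strict_mono[OF ixy(3) s] e by (intro divide_right_mono) auto
      also have "\<dots> \<le> umax / e" using X_strict_mono[OF ixy(3) s] e umax_pos by (intro divide_left_mono) auto
      finally show ?thesis using \<mu>0[OF s] by (simp add: d_def ixy(1))
    qed
    fix B i t
    assume B: "0 \<le> B" and hyp: "\<And>i t. i \<in> I \<Longrightarrow> 0 \<le> t \<Longrightarrow> t \<le> T \<Longrightarrow> d i t \<le> B * exp (2 * C * t)"
      and i: "i \<in> I" and t: "0 \<le> t" "t \<le> T"
    obtain \<sigma> x y where ixy: "i = (\<sigma>, x, y)" and \<sigma>: "\<sigma> = 1 \<or> \<sigma> = - 1" and xy: "x < y" using i by (auto simp: I_def)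
    (* the modulus that the current bound B provides for all pairs of points *)
    define m where "m s = \<mu> s + B * exp (2 * C * s)" for s
    have osc: "\<bar>v s b - v s a\<bar> \<le> m s * (\<bar>b - a\<bar> + e)" if s: "0 \<le> s" "s \<le> T" for s a b
    proof -
      have *: "\<bar>v s b - v s a\<bar> \<le> m s * (b - a + e)" if ab: "a < b" for a b
      proof -
        obtain p r where pr: "X p s = a" "X r s = b" using X_surj[OF s(1)] by metis
        have "p < r" using X_strict_mono[of r p s] s(1) ab pr by (cases p r rule: linorder_cases) auto
        then have "\<tau> * (v s b - v s a) / (b - a + e) - \<mu> s \<le> B * exp (2 * C * s)" if "\<tau> = 1 \<or> \<tau> = -1" for \<tau>
          using hyp[of "(\<tau>, p, r)" s] s that by (simp add: I_def d_def pr)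
        then have "\<tau> * (v s b - v s a) \<le> m s * (b - a + e)" if "\<tau> = 1 \<or> \<tau> = -1" for \<tau>
          using that ab e by (simp add: m_def pos_divide_le_eq diff_le_eq add.commute)
        from this[of 1] this[of "-1"] show ?thesis by (simp add: abs_le_iff)
      qed
      have "0 \<le> m s" using \<mu>0[OF s(1)] B by (simp add: m_def)
      then show ?thesis using *[of a b] *[of b a] e by (cases a b rule: linorder_cases) (auto simp: abs_minus_commute)
    qed
    let ?\<Delta> = "\<lambda>s. X y s - X x s" and ?v1 = "\<lambda>s. v s (X x s)" and ?v2 = "\<lambda>s. v s (X y s)"
    let ?q1 = "\<lambda>s. - V' (w s (X x s))" and ?q2 = "\<lambda>s. - V' (w s (X y s))"
    let ?g1 = "\<lambda>s. g s (X x s)" and ?g2 = "\<lambda>s. g s (X y s)"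
    let ?M = "\<lambda>s. \<mu> s + B / 2 * exp (2 * C * s)"
    let ?f = "\<lambda>s. \<sigma> * (?v2 s - ?v1 s) - ?M s * (?\<Delta> s + e)"
    let ?f' = "\<lambda>s. \<sigma> * (?v2 s * ?q2 s * ?g2 s - ?v1 s * ?q1 s * ?g1 s)
       - (C * (m s + 1) * (?\<Delta> s + e) + ?M s * (b s (X y s) - b s (X x s)))"
    have "?f t \<le> 0"
    proof (rule nonpos_if_nonincreasing_where_positive[where T=T and f="?f" and f'="?f'", OF _ _ _ _ t])
      show "continuous_on {0..T} ?f" unfolding \<mu>_def
        by (intro continuous_intros v_along_X(1) X_continuous)
      have "\<sigma> * (u 0 y - u 0 x) \<le> K0 * (y - x)" using u0[of y x] \<sigma> xy by auto
      also have "\<dots> \<le> (K0 + B / 2) * (y - x + e)" using K0 B xy e by (intro mult_mono) auto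
      finally show "?f 0 \<le> 0" by (simp add: v_0 X_props(1) \<mu>_def)
      fix s assume s: "0 < s" "s < T"
      then have s0: "0 \<le> s" by simp
      have d\<mu>: "(?M has_real_derivative C * (m s + 1)) (at s)"
        unfolding \<mu>_def m_def by (auto intro!: derivative_eq_intros simp: algebra_simps)
      show "(?f has_real_derivative ?f' s) (at s)"
        by (rule DERIV_cong[OF DERIV_diff[OF DERIV_cmult[OF DERIV_diff[OF v_along_X(2)[OF s(1)] v_along_X(2)[OF s(1)]]]
              DERIV_mult[OF d\<mu> DERIV_add[OF DERIV_diff[OF X_props(3)[OF s(1)] X_props(3)[OF s(1)]] DERIV_const]]]])
          (simp add: algebra_simps)
      let ?N = "?\<Delta> s + e"
      have \<Delta>: "0 < ?\<Delta> s" using X_strict_mono[OF xy s0] by simp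
      have N: "0 < ?N" "?\<Delta> s \<le> ?N" using \<Delta> e by auto
      have m0: "0 \<le> m s" using \<mu>0[OF s0] B by (simp add: m_def)
      have dv: "\<bar>?v2 s - ?v1 s\<bar> \<le> m s * ?N" using osc[of s "X y s" "X x s"] s \<Delta> by simp
      have qg: "\<bar>?q2 s * ?g2 s\<bar> \<le> Q * g0"
        unfolding abs_mult using V'_abs[OF w_bounds, of s "X y s"] g_abs[OF s0, of "X y s"] Q_pos by (intro mult_mono) auto
      have t1: "\<bar>(?v2 s - ?v1 s) * (?q2 s * ?g2 s)\<bar> \<le> (m s * ?N) * (Q * g0)"
        unfolding abs_mult[of "?v2 s - ?v1 s"] using dv qg m0 N by (intro mult_mono) auto
      have dq: "\<bar>?q2 s - ?q1 s\<bar> \<le> Q2 * g0 * ?N"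
      proof -
        have "\<bar>?q2 s - ?q1 s\<bar> \<le> Q2 * g0 * ?\<Delta> s" using V'_w_increment[of s "X x s" "X y s"] \<Delta> by simp
        also have "\<dots> \<le> Q2 * g0 * ?N" using Q2_nonneg g0_nonneg N by (intro mult_left_mono) auto
        finally show ?thesis .
      qed
      have "\<bar>(?q2 s - ?q1 s) * ?g2 s\<bar> \<le> (Q2 * g0 * ?N) * g0"
        unfolding abs_mult using dq g_abs[OF s0, of "X y s"] Q2_nonneg g0_nonneg N by (intro mult_mono) auto
      then have t2: "\<bar>?v1 s * ((?q2 s - ?q1 s) * ?g2 s)\<bar> \<le> umax * ((Q2 * g0 * ?N) * g0)"
        unfolding abs_mult[of "?v1 s"] using v_abs[OF s0] umax_pos by (intro mult_mono) auto
      have dG: "\<bar>G s (X y s) - G s (X x s)\<bar> \<le> (m s * ?N) * k 0"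
        unfolding kd_total[symmetric]
      proof (rule convolution_difference_abs_le[OF s0 kd_int kd_nonneg])
        fix r show "\<bar>v s (X y s - r) - v s (X x s - r)\<bar> \<le> m s * ?N"
          using osc[of s "X y s - r" "X x s - r"] s \<Delta> by simp
      qed
      have dg: "\<bar>?g2 s - ?g1 s\<bar> \<le> 2 * k 0 * (m s * ?N)"
      proof -
        have "\<bar>k 0 * ?v2 s - k 0 * ?v1 s\<bar> \<le> k 0 * (m s * ?N)"
          unfolding right_diff_distrib[symmetric] abs_mult using dv k_nonneg[of 0] by (simp add: mult_left_mono)
        moreover have "(m s * ?N) * k 0 = k 0 * (m s * ?N)" "2 * k 0 * (m s * ?N) = k 0 * (m s * ?N) + k 0 * (m s * ?N)"
          by (simp_all add: mult.commute)
        ultimately show ?thesis using dG by linarith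
      qed
      have "\<bar>?q1 s * (?g2 s - ?g1 s)\<bar> \<le> Q * (2 * k 0 * (m s * ?N))"
        unfolding abs_mult using dg V'_abs[OF w_bounds, of s "X x s"] Q_pos by (intro mult_mono) auto
      then have t3: "\<bar>?v1 s * (?q1 s * (?g2 s - ?g1 s))\<bar> \<le> umax * (Q * (2 * k 0 * (m s * ?N)))"
        unfolding abs_mult[of "?v1 s"] using v_abs[OF s0] umax_pos by (intro mult_mono) auto
      have "\<bar>?M s * (b s (X y s) - b s (X x s))\<bar> \<le> m s * (K * ?N)"
      proof -
        have "\<bar>b s (X y s) - b s (X x s)\<bar> \<le> K * ?\<Delta> s" using b_lipschitz[of s "X y s" "X x s"] \<Delta> by simp
        also have "\<dots> \<le> K * ?N" using K_pos N by (intro mult_left_mono) auto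
        finally show ?thesis unfolding abs_mult using \<mu>0[OF s0] B m0 K_pos N
          by (intro mult_mono) (auto simp: m_def)
      qed
      moreover have "\<bar>?v2 s * ?q2 s * ?g2 s - ?v1 s * ?q1 s * ?g1 s\<bar>
          \<le> (m s * ?N) * (Q * g0) + umax * ((Q2 * g0 * ?N) * g0) + umax * (Q * (2 * k 0 * (m s * ?N)))"
        unfolding flux_source_difference using t1 t2 t3 by linarith
      moreover have "\<sigma> * (?v2 s * ?q2 s * ?g2 s - ?v1 s * ?q1 s * ?g1 s) \<le> \<bar>?v2 s * ?q2 s * ?g2 s - ?v1 s * ?q1 s * ?g1 s\<bar>"
        using \<sigma> by auto
      moreover have "(m s * ?N) * (Q * g0) + umax * ((Q2 * g0 * ?N) * g0) + umax * (Q * (2 * k 0 * (m s * ?N))) + m s * (K * ?N)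
         \<le> C * (m s + 1) * ?N"
      proof -
        have "C * (m s + 1) * ?N - ((m s * ?N) * (Q * g0) + umax * ((Q2 * g0 * ?N) * g0) + umax * (Q * (2 * k 0 * (m s * ?N))) + m s * (K * ?N))
          = (umax * Q2 * g0 * g0 * m s + (Q * g0 + 2 * umax * Q * k 0 + K)) * ?N"
          unfolding C by (simp add: algebra_simps)
        moreover have "0 \<le> (umax * Q2 * g0 * g0 * m s + (Q * g0 + 2 * umax * Q * k 0 + K)) * ?N"
        proof -
          have "0 \<le> umax * Q2 * g0 * g0 * m s + (Q * g0 + 2 * umax * Q * k 0 + K)"
            using Q_pos g0_nonneg umax_pos k_nonneg[of 0] K_pos Q2_nonneg m0 by simp
          then show ?thesis using less_imp_le[OF N(1)] by (rule mult_nonneg_nonneg)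
        qed
        ultimately show ?thesis by linarith
      qed
      ultimately show "?f' s \<le> 0" by linarith
    qed
    then have "\<sigma> * (?v2 t - ?v1 t) \<le> ?M t * (?\<Delta> t + e)" by simp
    then have "\<sigma> * (?v2 t - ?v1 t) / (?\<Delta> t + e) \<le> ?M t"
      using X_strict_mono[OF xy t(1)] e by (subst pos_divide_le_eq) auto
    then have "\<sigma> * (?v2 t - ?v1 t) / (?\<Delta> t + e) - \<mu> t \<le> B / 2 * exp (2 * C * t)" by linarith
    then show "d i t \<le> B / 2 * exp (2 * C * t)" unfolding d_def ixy by (simp only: split)
  qed
  have **: "\<bar>v t b - v t a\<bar> \<le> \<mu> t * (b - a + e)" if ab: "a < b" for a b
  proof -
    obtain p r where pr: "X p t = a" "X r t = b" using X_surj[OF T(1)] by metis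
    have "p < r" using X_strict_mono[of r p t] T(1) ab pr by (cases p r rule: linorder_cases) auto
    then have "\<tau> * (v t b - v t a) \<le> \<mu> t * (b - a + e)" if "\<tau> = 1 \<or> \<tau> = -1" for \<tau>
      using main[of "(\<tau>, p, r)" t] T that ab e by (simp add: I_def d_def pr pos_divide_le_eq)
    from this[of 1] this[of "-1"] show ?thesis by (simp add: abs_le_iff)
  qed
  show ?thesis unfolding \<mu>_def[symmetric]
    using **[of z1 z2] **[of z2 z1] \<mu>0[OF T(1)] e by (cases z1 z2 rule: linorder_cases) (auto simp: abs_minus_commute)
qed

lemma v_lipschitz:
  assumes u0: "\<And>x y. \<bar>u 0 x - u 0 y\<bar> \<le> K0 * \<bar>x - y\<bar>" and K0: "0 \<le> K0"
  obtains Lv where "0 \<le> Lv" "\<And>t x y. 0 \<le> t \<Longrightarrow> t \<le> T \<Longrightarrow> \<bar>v t y - v t x\<bar> \<le> Lv * \<bar>y - x\<bar>"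
proof -
  define C where "C = Q * g0 + 2 * umax * Q * k 0 + K + umax * Q2 * g0 * g0"
  have C0: "0 \<le> C" unfolding C_def using Q_pos g0_nonneg umax_pos k_nonneg[of 0] K_pos Q2_nonneg by simp
  define Lv where "Lv = (K0 + 1) * exp (C * \<bar>T\<bar>) - 1"
  have "1 * 1 \<le> (K0 + 1) * exp (C * \<bar>T\<bar>)" using K0 C0 by (intro mult_mono) auto
  then have Lv: "0 \<le> Lv" by (simp add: Lv_def)
  have "\<bar>v t y - v t x\<bar> \<le> Lv * \<bar>y - x\<bar>" if t: "0 \<le> t" "t \<le> T" for t x y
  proof (rule field_le_epsilon)
    fix e :: real assume e: "0 < e"
    define e' where "e' = e / (Lv + 1)"
    have e': "0 < e'" using e Lv by (simp add: e'_def)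
    have "(K0 + 1) * exp (C * t) - 1 \<le> Lv"
      unfolding Lv_def using K0 C0 t by (intro diff_right_mono mult_left_mono) (auto intro: mult_left_mono)
    then have "((K0 + 1) * exp (C * t) - 1) * (\<bar>y - x\<bar> + e') \<le> Lv * (\<bar>y - x\<bar> + e')" using e' by (intro mult_right_mono) auto
    also have "\<dots> = Lv * \<bar>y - x\<bar> + Lv * e'" by (simp add: distrib_left)
    also have "Lv * e' \<le> e" using e Lv by (simp add: e'_def field_simps)
    finally show "\<bar>v t y - v t x\<bar> \<le> Lv * \<bar>y - x\<bar> + e"
      using v_almost_lipschitz[OF u0 K0 e' t C_def, of y x] by linarith
  qed
  with Lv that show thesis by blast
qed

section \<open>The one-sided Lipschitz bound for regular data\<close>

text \<open>
  The inequality between the kernel and its derivative, used quantitatively: a nonnegative function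
  integrates against \<open>kd\<close> to at least \<open>1/D\<close> times its integral against \<open>k\<close>. It is applied to differences of \<open>v\<close>
  lifted by their lower bound \<open>c\<close>.
\<close>

lemma kd_domination:
  assumes t: "0 \<le> t" and xy: "x \<le> y" and m: "\<And>r. 0 \<le> v t (y - r) - v t (x - r) + c"
  shows "(w t y - w t x + c) / D \<le> G t y - G t x + c * k 0"
proof -
  have i: "integrable lborel (\<lambda>r. (v t (y - r) - v t (x - r) + c) * f r)" if "integrable lborel f" for f
    using Bochner_Integration.integrable_add[OF convolution_difference(2)[OF t that, of y x] integrable_mult_right[OF that, of c]]
    by (simp add: distrib_right)
  have eq: "(LINT r|lborel. (v t (y - r) - v t (x - r) + c) * f r)
      = convolution (u t) f y - convolution (u t) f x + c * (LINT r|lborel. f r)" if "integrable lborel f" for f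
    unfolding convolution_difference(1)[OF t that]
    by (subst integral_mult_right_zero[symmetric], subst Bochner_Integration.integral_add[symmetric])
      (use that convolution_difference(2)[OF t that] in \<open>auto simp: distrib_right\<close>)
  have "(LINT r|lborel. (v t (y - r) - v t (x - r) + c) * k r) \<le> (LINT r|lborel. D * ((v t (y - r) - v t (x - r) + c) * kd r))"
  proof (rule integral_mono_AE)
    show "integrable lborel (\<lambda>r. (v t (y - r) - v t (x - r) + c) * k r)" by (rule i[OF k_int])
    show "integrable lborel (\<lambda>r. D * ((v t (y - r) - v t (x - r) + c) * kd r))"
      by (rule integrable_mult_right[OF i[OF kd_int]])
    show "AE r in lborel. (v t (y - r) - v t (x - r) + c) * k r \<le> D * ((v t (y - r) - v t (x - r) + c) * kd r)"
      using k_le_kd AE_lborel_singleton[of 0]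
    proof eventually_elim
      case (elim r)
      have "k r \<le> D * kd r"
      proof (cases "r < 0")
        case False
        then show ?thesis using elim k_zero[of r] kd_nonneg[of r] D_pos by auto
      qed (use elim in simp)
      from mult_left_mono[OF this m[of r]] show ?case by (simp add: mult.left_commute)
    qed
  qed
  then have "w t y - w t x + c \<le> D * (G t y - G t x + c * k 0)"
    unfolding integral_mult_right_zero eq[OF k_int] eq[OF kd_int] by (simp add: k_one kd_total)
  then show ?thesis using D_pos by (simp add: pos_divide_le_eq mult.commute)
qed

text \<open>
  The function \<open>g\<close> is the derivative of \<open>w\<close> and has the Lipschitz constant \<open>2 k(0) Lv\<close>.
\<close>

lemma w_increment_close:
  assumes t: "0 \<le> t" and xy: "x \<le> y" and lip: "\<And>x y. \<bar>v t y - v t x\<bar> \<le> Lv * \<bar>y - x\<bar>" and Lv: "0 \<le> Lv"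
  shows "\<bar>w t y - w t x - g t y * (y - x)\<bar> \<le> 2 * k 0 * Lv * (y - x) * (y - x)"
proof -
  have gl: "\<bar>g t z - g t y\<bar> \<le> 2 * k 0 * Lv * (y - x)" if z: "x \<le> z" "z \<le> y" for z
  proof -
    have "\<bar>v t (z - r) - v t (y - r)\<bar> \<le> Lv * (y - x)" for r
      by (rule order_trans[OF lip mult_left_mono[OF _ Lv]]) (use z in auto)
    from convolution_difference_abs_le[OF t kd_int kd_nonneg this]
    have "\<bar>G t z - G t y\<bar> \<le> Lv * (y - x) * k 0" by (simp add: kd_total)
    moreover have "\<bar>v t z - v t y\<bar> \<le> Lv * (y - x)"
      by (rule order_trans[OF lip mult_left_mono[OF _ Lv]]) (use z in auto)
    then have "\<bar>k 0 * v t z - k 0 * v t y\<bar> \<le> k 0 * (Lv * (y - x))"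
      unfolding right_diff_distrib[symmetric] abs_mult using k_nonneg[of 0] by (simp add: mult_left_mono)
    moreover have "Lv * (y - x) * k 0 = k 0 * (Lv * (y - x))" "2 * k 0 * Lv * (y - x) = k 0 * (Lv * (y - x)) + k 0 * (Lv * (y - x))"
      by simp_all
    ultimately show ?thesis by linarith
  qed
  have [measurable]: "v t \<in> borel_measurable borel" by (rule v_measurable[OF t])
  have ig: "set_integrable lborel {x..y} (\<lambda>z. g t z)"
  proof (rule set_integral_diff(1))
    show "set_integrable lborel {x..y} (G t)" by (rule integral_convolution(2)[OF u_measurable u_abs kd_int])
    have "integrable lborel (\<lambda>z. k 0 * (v t z * indicator {x..y} z))"
      by (intro integrable_mult_right integrable_bounded_mult[OF _ v_abs[OF t] integrable_indicator_Icc]) measurable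
    then show "set_integrable lborel {x..y} (\<lambda>z. k 0 * v t z)"
      unfolding set_integrable_def by (simp add: mult_ac)
  qed
  have ic: "set_integrable lborel {x..y} (\<lambda>z. c)" for c :: real
    by (rule borel_integrable_atLeastAtMost') simp
  have "(LINT z:{x..y}|lborel. g t z - g t y) = (LINT z:{x..y}|lborel. g t z) - (LINT z:{x..y}|lborel. g t y)"
    by (rule set_integral_diff(2)[OF ig ic])
  also have "(LINT z:{x..y}|lborel. g t y) = g t y * (y - x)" using xy by (simp add: set_lebesgue_integral_def)
  also have "(LINT z:{x..y}|lborel. g t z) = w t y - w t x" by (rule w_increment_v[OF t xy, symmetric])
  finally have "w t y - w t x - g t y * (y - x) = (LINT z:{x..y}|lborel. g t z - g t y)" by simp
  then show ?thesis using set_integral_bound_interval[OF xy gl] by simp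
qed

text \<open>
  Instance of the algebraic inequality for two characteristics at positions \<open>p < r\<close>. Monotonicity of
  \<open>V'\<close> gives the increment of \<open>- V'(w)\<close> the sign of \<open>W\<close>, so that the term with \<open>V''\<close> helps.
\<close>

lemma one_sided_rate:
  assumes t: "0 \<le> t" and pr: "p < r" and lip: "\<And>x y. \<bar>v t y - v t x\<bar> \<le> Lv * \<bar>y - x\<bar>" and Lv: "0 \<le> Lv"
    and osl: "\<And>x y. x < y \<Longrightarrow> v t x - v t y \<le> m * (y - x)"
    and m: "m = \<mu> + E" and \<mu>: "0 \<le> \<mu>" "2 * D * \<mu> \<le> a0" and N: "\<mu> \<le> N" "N * (r - p) \<le> v t p - v t r"
  shows "- (v t r * - V' (w t r) * g t r - v t p * - V' (w t p) * g t p) - N * (b t r - b t p) \<le>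
     (- 2 * \<delta> * \<mu>\<^sup>2 + (4 * Q * g0 + umax * Q * k 0) * E
       + (2 * Lv * (Q2 * g0) * g0 + Lv * Q * (2 * k 0 * Lv) + umax * (Q2 * g0) * (2 * k 0 * Lv)) * (r - p)) * (r - p)"
proof -
  define \<Delta> where "\<Delta> = r - p"
  have \<Delta>: "0 < \<Delta>" using pr by (simp add: \<Delta>_def)
  define R where "R = (v t p - v t r) / \<Delta>"
  define W where "W = (w t r - w t p) / \<Delta>"
  have R: "v t r = v t p - R * \<Delta>" and W: "w t r - w t p = W * \<Delta>" using \<Delta> by (simp_all add: R_def W_def)
  have Rm: "R \<le> m" using osl[OF pr] \<Delta> by (simp add: R_def \<Delta>_def pos_divide_le_eq)
  have RL: "R \<le> Lv"
  proof -
    have "v t p - v t r \<le> Lv * \<Delta>" using lip[of r p] pr by (simp add: \<Delta>_def abs_le_iff)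
    then show ?thesis using \<Delta> by (simp add: R_def pos_divide_le_eq)
  qed
  have NR: "N \<le> R" using N(2) \<Delta> by (simp add: R_def \<Delta>_def pos_le_divide_eq)
  obtain \<xi> where \<xi>: "\<xi> \<in> {min (w t p) (w t r)..max (w t p) (w t r)}" and dV: "V (w t r) - V (w t p) = V' \<xi> * (w t r - w t p)"
    using V_mvt[OF w_bounds w_bounds] by blast
  have \<xi>01: "\<xi> \<in> {0..umax}" using \<xi> w_bounds[of t p] w_bounds[of t r] by auto
  have Wg: "\<bar>W\<bar> \<le> g0"
  proof -
    have "\<bar>W\<bar> * \<Delta> \<le> g0 * \<Delta>" using w_abs_increment[of t r p] \<Delta> unfolding W by (simp add: abs_mult \<Delta>_def)
    then show ?thesis using \<Delta> by (simp add: mult_le_cancel_right)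
  qed
  have shift: "0 \<le> v t (r - z) - v t (p - z) + m * \<Delta>" for z
    using osl[of "p - z" "r - z"] pr by (simp add: \<Delta>_def algebra_simps)
  have Wm: "0 \<le> W + m"
  proof -
    have "0 \<le> (LINT z|lborel. (v t (r - z) - v t (p - z) + m * \<Delta>) * k z)"
      using shift k_nonneg by (intro integral_nonneg_AE) auto
    also have "\<dots> = (LINT z|lborel. (v t (r - z) - v t (p - z)) * k z) + (LINT z|lborel. (m * \<Delta>) * k z)"
      by (subst Bochner_Integration.integral_add[symmetric])
        (use convolution_difference(2)[OF t k_int] k_int in \<open>auto simp: distrib_right\<close>)
    also have "\<dots> = w t r - w t p + m * \<Delta>" using convolution_difference(1)[OF t k_int, of r p] by (simp add: k_one)
    also have "\<dots> = (W + m) * \<Delta>" unfolding W by (simp add: distrib_right)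
    finally show ?thesis using \<Delta> by (simp add: zero_le_mult_iff)
  qed
  have c2: "\<bar>V' z - V' (w t p)\<bar> \<le> Q2 * g0 * \<Delta>" if z: "z \<in> {min (w t p) (w t r)..max (w t p) (w t r)}" for z
  proof -
    have z01: "z \<in> {0..umax}" using z w_bounds[of t p] w_bounds[of t r] by auto
    have "\<bar>z - w t p\<bar> \<le> \<bar>w t r - w t p\<bar>" using z by auto
    also have "\<dots> \<le> g0 * \<Delta>" using w_abs_increment[of t r p] pr by (simp add: \<Delta>_def)
    finally have "Q2 * \<bar>z - w t p\<bar> \<le> Q2 * (g0 * \<Delta>)" using Q2_nonneg by (intro mult_left_mono)
    with V'_lip[OF z01 w_bounds, of t p] show ?thesis by (simp add: mult.assoc)
  qed
  have "- ((v t p - R * \<Delta>) * - V' (w t r) * g t r - v t p * - V' (w t p) * g t p) + N * (- V' \<xi> * (W * \<Delta>)) \<le>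
     (- 2 * \<delta> * \<mu>\<^sup>2 + (4 * Q * g0 + umax * Q * k 0) * E
       + (2 * Lv * (Q2 * g0) * g0 + Lv * Q * (2 * k 0 * Lv) + umax * (Q2 * g0) * (2 * k 0 * Lv)) * \<Delta>) * \<Delta>"
  proof (rule one_sided_rate_inequality[OF \<Delta> Wg Wm])
    have "\<bar>W * \<Delta> - g t r * \<Delta>\<bar> \<le> 2 * k 0 * Lv * \<Delta> * \<Delta>"
      using w_increment_close[OF t less_imp_le[OF pr] lip Lv] unfolding W \<Delta>_def[symmetric] .
    then have "\<bar>W - g t r\<bar> * \<Delta> \<le> (2 * k 0 * Lv * \<Delta>) * \<Delta>"
      using \<Delta> by (simp add: abs_mult flip: left_diff_distrib)
    then have "\<bar>W - g t r\<bar> \<le> 2 * k 0 * Lv * \<Delta>" using \<Delta> by (simp only: mult_le_cancel_right_pos)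
    then show "\<bar>g t r - W\<bar> \<le> 2 * k 0 * Lv * \<Delta>" by (simp only: abs_minus_commute)
    show "\<bar>g t r\<bar> \<le> g0" by (rule g_abs[OF t])
    show "\<delta> \<le> - V' (w t p)" "- V' (w t p) \<le> Q" using V'_le[OF w_bounds, of t p] V'_ge[OF w_bounds, of t p] by auto
    show "\<bar>- V' (w t r) - - V' (w t p)\<bar> \<le> Q2 * g0 * \<Delta>" using c2[of "w t r"] by auto
    show "\<bar>- V' \<xi> - - V' (w t p)\<bar> \<le> Q2 * g0 * \<Delta>" using c2[OF \<xi>] by auto
    have "0 \<le> (- V' (w t r) - - V' (w t p)) * (W * \<Delta>)"
      unfolding W[symmetric] using V'_antimono[OF w_bounds w_bounds, of t p t r] V'_antimono[OF w_bounds w_bounds, of t r t p]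
      by (cases "w t p \<le> w t r") (auto intro: mult_nonneg_nonneg mult_nonpos_nonpos)
    then show "0 \<le> (- V' (w t r) - - V' (w t p)) * W" using \<Delta> by (simp add: mult.assoc[symmetric] zero_le_mult_iff)
    show "2 * D * \<mu> \<le> v t p" using \<mu>(2) v_lower_bound[OF t, of p] by linarith
    show "v t p \<le> umax" by (rule v_bounds(2)[OF t])
    have "(W * \<Delta> + m * \<Delta>) / D \<le> G t r - G t p + m * \<Delta> * k 0"
      using kd_domination[OF t less_imp_le[OF pr] shift] unfolding W .
    moreover have "g t r - g t p = G t r - G t p + k 0 * (R * \<Delta>)" unfolding R by (simp add: algebra_simps)
    moreover have "((W + m) / D - k 0 * (m - R)) * \<Delta> = (W * \<Delta> + m * \<Delta>) / D - m * \<Delta> * k 0 + k 0 * (R * \<Delta>)"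
      by (simp add: algebra_simps add_divide_distrib)
    ultimately show "((W + m) / D - k 0 * (m - R)) * \<Delta> \<le> g t r - g t p" by linarith
  qed (use \<delta>_pos D_pos k_nonneg[of 0] NR Rm RL N \<mu> m in auto)
  note rate = this[folded R]
  have "N * (b t r - b t p) = - (N * (- V' \<xi> * (W * \<Delta>)))" unfolding b_def dV W by simp
  with rate show ?thesis unfolding \<Delta>_def[symmetric] by linarith
qed

text \<open>
  The halving argument for \<open>- (v(y) - v(x)) / (y - x) - \<mu>(t)\<close>, with \<open>\<mu>\<close> the solution of
  \<open>\<mu>' = - 2 \<delta> \<mu>\<^sup>2\<close>, \<open>\<mu>(0) = L\<close>. The rate inequality is useful for nearby pairs only, as its error
  is proportional to the distance. This suffices: an increment between distant points is the sum of
  the increments over a fine subdivision.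
\<close>

lemma v_one_sided_lipschitz:
  assumes u0_lip: "\<And>x y. \<bar>u 0 x - u 0 y\<bar> \<le> K0 * \<bar>x - y\<bar>" and K0: "0 \<le> K0"
    and u0_osl: "\<And>x y. x < y \<Longrightarrow> u 0 x - u 0 y \<le> L * (y - x)" and L: "0 < L" "2 * D * L \<le> a0"
    and T: "0 \<le> T" and xy: "x < y"
  shows "v T x - v T y \<le> L / (2 * \<delta> * L * T + 1) * (y - x)"
proof -
  obtain Lv where Lv: "0 \<le> Lv" and lip: "\<And>t x y. 0 \<le> t \<Longrightarrow> t \<le> T \<Longrightarrow> \<bar>v t y - v t x\<bar> \<le> Lv * \<bar>y - x\<bar>"
    using v_lipschitz[OF u0_lip K0, of T] by blast
  define \<mu> where "\<mu> t = L / (2 * \<delta> * L * t + 1)" for t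
  have den: "1 \<le> 2 * \<delta> * L * t + 1" if "0 \<le> t" for t using that L \<delta>_pos by simp
  have \<mu>0: "0 \<le> \<mu> t" "\<mu> t \<le> L" if "0 \<le> t" for t
  proof -
    show "0 \<le> \<mu> t" unfolding \<mu>_def using den[OF that] L by (intro divide_nonneg_nonneg) linarith+
    have "L / (2 * \<delta> * L * t + 1) \<le> L / 1" using den[OF that] L by (intro frac_le) linarith+
    then show "\<mu> t \<le> L" by (simp add: \<mu>_def)
  qed
  have d\<mu>: "(\<mu> has_real_derivative - 2 * \<delta> * (\<mu> t)\<^sup>2) (at t)" if "0 \<le> t" for t
  proof -
    have nz: "2 * \<delta> * L * t + 1 \<noteq> 0" using den[OF that] by linarith
    have "((\<lambda>t. 2 * \<delta> * L * t + 1) has_real_derivative 2 * \<delta> * L) (at t)" by (auto intro!: derivative_eq_intros)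
    from DERIV_divide[OF DERIV_const[of L] this nz]
    have "(\<mu> has_real_derivative (0 * (2 * \<delta> * L * t + 1) - L * (2 * \<delta> * L)) / ((2 * \<delta> * L * t + 1) * (2 * \<delta> * L * t + 1))) (at t)"
      unfolding \<mu>_def[abs_def] .
    then show ?thesis by (rule DERIV_cong) (simp add: \<mu>_def power2_eq_square)
  qed
  have c\<mu>: "continuous_on {0..T} \<mu>"
    by (intro continuous_at_imp_continuous_on ballI DERIV_isCont[OF d\<mu>]) simp
  define c where "c = 2 * Lv * (Q2 * g0) * g0 + Lv * Q * (2 * k 0 * Lv) + umax * (Q2 * g0) * (2 * k 0 * Lv)"
  have c: "0 \<le> c" unfolding c_def using Lv Q2_nonneg g0_nonneg Q_pos k_nonneg[of 0] umax_pos by simp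
  define C where "C = 4 * Q * g0 + umax * Q * k 0"
  have C: "0 \<le> C" unfolding C_def using g0_nonneg Q_pos k_nonneg[of 0] umax_pos by simp
  define l where "l = 2 * C + K + 1"
  have l: "1 \<le> l" "K \<le> l" "2 * C \<le> l" using C K_pos by (auto simp: l_def)
  define d where "d = (\<lambda>(x, y) t. (v t (X x t) - v t (X y t)) / (X y t - X x t) - \<mu> t)"
  have main: "d i t \<le> 0" if i: "i \<in> {(x, y). x < y}" and t: "0 \<le> t" "t \<le> T" for i t
  proof (rule family_nonpos_by_halving[where I="{(x, y). x < y}" and T=T and \<kappa>=l and d=d, OF _ _ _ i t])
    show "0 \<le> l" using l by simp
    show "d i t \<le> Lv" if i: "i \<in> {(x, y). x < y}" and t: "0 \<le> t" "t \<le> T" for i t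
    proof -
      obtain x y where ixy: "i = (x, y)" "x < y" using i by auto
      have \<Delta>: "0 < X y t - X x t" using X_strict_mono[OF ixy(2) t(1)] by simp
      have "v t (X x t) - v t (X y t) \<le> Lv * (X y t - X x t)" using lip[OF t, of "X y t" "X x t"] \<Delta> by simp
      then have "(v t (X x t) - v t (X y t)) / (X y t - X x t) \<le> Lv" using \<Delta> by (simp add: pos_divide_le_eq)
      then show ?thesis using \<mu>0[OF t(1)] by (simp add: d_def ixy)
    qed
    fix B i t
    assume B: "0 \<le> B" and hyp: "\<And>i t. i \<in> {(x, y). x < y} \<Longrightarrow> 0 \<le> t \<Longrightarrow> t \<le> T \<Longrightarrow> d i t \<le> B * exp (l * t)"
      and i: "i \<in> {(x::real, y). x < y}" and t: "0 \<le> t" "t \<le> T"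
    have osl: "v s a - v s b \<le> (\<mu> s + B * exp (l * s)) * (b - a)" if s: "0 \<le> s" "s \<le> T" and ab: "a < b" for s a b
    proof -
      obtain p r where pr: "X p s = a" "X r s = b" using X_surj[OF s(1)] by metis
      have "p < r" using X_strict_mono[of r p s] s(1) ab pr by (cases p r rule: linorder_cases) auto
      then have "(v s a - v s b) / (b - a) - \<mu> s \<le> B * exp (l * s)" using hyp[of "(p, r)" s] s by (simp add: d_def pr)
      then have "(v s a - v s b) / (b - a) \<le> \<mu> s + B * exp (l * s)" by simp
      then show ?thesis using ab by (simp add: pos_divide_le_eq)
    qed
    (* the improved bound, up to an error proportional to the mesh h of the labels *)
    let ?M = "\<lambda>s. \<mu> s + B / 2 * exp (l * s)"
    have local: "v t (X p t) - v t (X r t) \<le> (?M t + c * h * exp (l * t)) * (X r t - X p t)"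
      if pr: "p < r" "r - p \<le> h" for p r h
    proof -
      let ?N = "\<lambda>s. ?M s + c * h * exp (l * s)" and ?\<Delta> = "\<lambda>s. X r s - X p s"
      let ?f = "\<lambda>s. (v s (X p s) - v s (X r s)) - ?N s * ?\<Delta> s"
      let ?N' = "\<lambda>s. - 2 * \<delta> * (\<mu> s)\<^sup>2 + B / 2 * (l * exp (l * s)) + c * h * (l * exp (l * s))"
      let ?src = "\<lambda>x s. v s (X x s) * - V' (w s (X x s)) * g s (X x s)"
      let ?f' = "\<lambda>s. (?src p s - ?src r s) - (?N' s * ?\<Delta> s + ?N s * (b s (X r s) - b s (X p s)))"
      have h: "0 < h" using pr by simp
      have "?f t \<le> 0"
      proof (rule nonpos_if_nonincreasing_where_positive[where T=T and f="?f" and f'="?f'", OF _ _ _ _ t])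
        show "continuous_on {0..T} ?f" by (intro continuous_intros v_along_X(1) X_continuous c\<mu>)
        have "u 0 p - u 0 r \<le> L * (r - p)" by (rule u0_osl[OF pr(1)])
        also have "\<dots> \<le> (L + B / 2 + c * h) * (r - p)" using B c h pr by (intro mult_right_mono) auto
        finally show "?f 0 \<le> 0" by (simp add: v_0 X_props(1) \<mu>_def)
        fix s assume s: "0 < s" "s < T"
        then have s0: "0 \<le> s" by simp
        have dN: "(?N has_real_derivative ?N' s) (at s)"
          by (auto intro!: derivative_eq_intros d\<mu>[OF s0] simp: algebra_simps)
        show "(?f has_real_derivative ?f' s) (at s)"
          by (rule DERIV_cong[OF DERIV_diff[OF DERIV_diff[OF v_along_X(2)[OF s(1)] v_along_X(2)[OF s(1)]]
                DERIV_mult[OF dN DERIV_diff[OF X_props(3)[OF s(1)] X_props(3)[OF s(1)]]]]])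
            (simp add: algebra_simps)
        assume pos: "0 < ?f s"
        let ?E = "B * exp (l * s)"
        have \<Delta>: "X p s < X r s" by (rule X_strict_mono[OF pr(1) s0])
        have lips: "\<And>x y. \<bar>v s y - v s x\<bar> \<le> Lv * \<bar>y - x\<bar>" using lip[of s] s by simp
        have osls: "\<And>a b. a < b \<Longrightarrow> v s a - v s b \<le> (\<mu> s + ?E) * (b - a)" using osl[of s] s by simp
        have \<mu>D: "2 * D * \<mu> s \<le> a0" using mult_left_mono[OF \<mu>0(2)[OF s0], of "2 * D"] D_pos L(2) by linarith
        have \<mu>N: "\<mu> s \<le> ?N s" using B c h by simp
        have N\<Delta>: "?N s * (X r s - X p s) \<le> v s (X p s) - v s (X r s)" using pos by simp
        have "- (?src r s - ?src p s) - ?N s * (b s (X r s) - b s (X p s)) \<le>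
          (- 2 * \<delta> * (\<mu> s)\<^sup>2 + C * ?E + c * ?\<Delta> s) * ?\<Delta> s"
          using one_sided_rate[OF s0 \<Delta> lips Lv osls refl \<mu>0(1)[OF s0] \<mu>D \<mu>N N\<Delta>] unfolding C_def[symmetric] c_def[symmetric] .
        also have "\<dots> \<le> ?N' s * ?\<Delta> s"
        proof (rule mult_right_mono)
          have "?\<Delta> s \<le> (r - p) * exp (K * s)" by (rule X_increment_upper[OF less_imp_le[OF pr(1)] s0])
          also have "\<dots> \<le> h * exp (l * s)" using pr l s0 h by (intro mult_mono) (auto intro: mult_right_mono)
          also have "\<dots> \<le> h * (l * exp (l * s))" using l h by (intro mult_left_mono) auto
          finally have "c * ?\<Delta> s \<le> c * (h * (l * exp (l * s)))" using c by (intro mult_left_mono)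
          moreover have "C * ?E \<le> B / 2 * (l * exp (l * s))"
            using mult_right_mono[OF l(3), of "B * exp (l * s)"] B by (simp add: mult_ac)
          ultimately show "- 2 * \<delta> * (\<mu> s)\<^sup>2 + C * ?E + c * ?\<Delta> s \<le> ?N' s" by (simp add: mult.assoc)
        qed (use \<Delta> in simp)
        finally show "?f' s \<le> 0" by simp
      qed
      then show ?thesis by simp
    qed
    obtain x y where ixy: "i = (x, y)" "x < y" using i by auto
    let ?\<Delta> = "X y t - X x t"
    have \<Delta>: "0 < ?\<Delta>" using X_strict_mono[OF ixy(2) t(1)] by simp
    (* increments add up over the n + 1 cells of a subdivision of the labels *)
    have sub: "v t (X x t) - v t (X y t) \<le> (?M t + c * ((y - x) / real (Suc n)) * exp (l * t)) * ?\<Delta>" for n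
    proof -
      define h where "h = (y - x) / real (Suc n)"
      have h: "0 < h" using ixy by (simp add: h_def)
      define p where "p j = x + real j * h" for j :: nat
      have p0: "p 0 = x" by (simp add: p_def)
      have pn: "p (Suc n) = y" by (simp add: p_def h_def del: of_nat_Suc)
      let ?A = "?M t + c * h * exp (l * t)"
      have step: "v t (X (p j) t) - v t (X (p (Suc j)) t) \<le> ?A * (X (p (Suc j)) t - X (p j) t)" for j
        by (rule local) (use h in \<open>auto simp: p_def algebra_simps\<close>)
      have "v t (X (p 0) t) - v t (X (p j) t) \<le> ?A * (X (p j) t - X (p 0) t)" for j
      proof (induction j)
        case (Suc j)
        then show ?case using step[of j] unfolding right_diff_distrib by linarith
      qed simp
      from this[of "Suc n"] show ?thesis unfolding p0 pn h_def .
    qed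
    have "(\<lambda>n. (?M t + c * ((y - x) * inverse (real (Suc n))) * exp (l * t)) * ?\<Delta>) \<longlonglongrightarrow> (?M t + c * ((y - x) * 0) * exp (l * t)) * ?\<Delta>"
      by (intro tendsto_intros LIMSEQ_inverse_real_of_nat)
    then have "v t (X x t) - v t (X y t) \<le> (?M t + c * ((y - x) * 0) * exp (l * t)) * ?\<Delta>"
    proof (rule LIMSEQ_le_const, intro exI allI impI)
      fix n :: nat
      show "v t (X x t) - v t (X y t) \<le> (?M t + c * ((y - x) * inverse (real (Suc n))) * exp (l * t)) * ?\<Delta>"
        using sub[of n] unfolding divide_inverse .
    qed
    then have "v t (X x t) - v t (X y t) \<le> ?M t * ?\<Delta>" by simp
    then have "(v t (X x t) - v t (X y t)) / ?\<Delta> \<le> ?M t" using \<Delta> by (subst pos_divide_le_eq)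
    then have "(v t (X x t) - v t (X y t)) / ?\<Delta> - \<mu> t \<le> B / 2 * exp (l * t)" by linarith
    then show "d i t \<le> B / 2 * exp (l * t)" unfolding d_def ixy by (simp only: split)
  qed
  obtain p r where pr: "X p T = x" "X r T = y" using X_surj[OF T] by metis
  have "p < r" using X_strict_mono[of r p T] T xy pr by (cases p r rule: linorder_cases) auto
  then have "(v T x - v T y) / (y - x) \<le> \<mu> T" using main[of "(p, r)" T] T by (simp add: d_def pr)
  then show ?thesis using xy by (simp add: pos_divide_le_eq \<mu>_def)
qed

end

section \<open>One-sided Lipschitz representatives\<close>

lemma Lip_minus_le_iff:
  "Lip_minus f \<le> ereal c \<longleftrightarrow> (\<forall>x y. x < y \<longrightarrow> f x - f y \<le> c * (y - x))"
proof -
  have "Lip_minus f \<le> ereal c \<longleftrightarrow> ereal (- c) \<le> Inf {ereal ((f y - f x) / (y - x)) | x y. x < y}"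
    unfolding Lip_minus_def by (subst ereal_uminus_le_reorder) simp
  also have "\<dots> \<longleftrightarrow> (\<forall>x y. x < y \<longrightarrow> - c \<le> (f y - f x) / (y - x))"
    unfolding le_Inf_iff by force
  also have "\<dots> \<longleftrightarrow> (\<forall>x y. x < y \<longrightarrow> f x - f y \<le> c * (y - x))"
  proof -
    have "- c \<le> (f y - f x) / (y - x) \<longleftrightarrow> f x - f y \<le> c * (y - x)" if "x < y" for x y
    proof -
      have "- c \<le> (f y - f x) / (y - x) \<longleftrightarrow> - c * (y - x) \<le> f y - f x" using that by (subst pos_le_divide_eq) auto
      then show ?thesis by auto
    qed
    then show ?thesis by blast
  qed
  finally show ?thesis .
qed

lemma ess_inf_le: "AE x in lborel. ess_inf u \<le> ereal (u x)"
proof -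
  have "AE x in lborel. - ereal (u x) \<le> esssup lborel (\<lambda>x. - ereal (u x))" by (rule esssup_AE)
  then show ?thesis
  proof eventually_elim
    case (elim x)
    then show ?case unfolding ess_inf_def by (subst ereal_uminus_le_reorder)
  qed
qed

lemma tot_var_le_iff:
  "tot_var f \<le> ereal c \<longleftrightarrow> (\<forall>n x. mono x \<longrightarrow> (\<Sum>i<n. \<bar>f (x (Suc i)) - f (x i)\<bar>) \<le> c)"
proof
  assume L: "tot_var f \<le> ereal c"
  show "\<forall>n x. mono x \<longrightarrow> (\<Sum>i<n. \<bar>f (x (Suc i)) - f (x i)\<bar>) \<le> c"
  proof (intro allI impI)
    fix n and x :: "nat \<Rightarrow> real" assume "mono x"
    then have "ereal (\<Sum>i<n. \<bar>f (x (Suc i)) - f (x i)\<bar>) \<le> tot_var f"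
      unfolding tot_var_def by (intro Sup_upper) blast
    then have "ereal (\<Sum>i<n. \<bar>f (x (Suc i)) - f (x i)\<bar>) \<le> ereal c" using L by (rule order_trans)
    then show "(\<Sum>i<n. \<bar>f (x (Suc i)) - f (x i)\<bar>) \<le> c" by simp
  qed
next
  assume "\<forall>n x. mono x \<longrightarrow> (\<Sum>i<n. \<bar>f (x (Suc i)) - f (x i)\<bar>) \<le> c"
  then show "tot_var f \<le> ereal c" unfolding tot_var_def by (intro Sup_least) auto
qed

lemma AE_lborel_dense:
  assumes "AE x in lborel. P (x::real)" "a < b"
  obtains x where "a < x" "x < b" "P x"
proof (rule ccontr)
  assume "\<not> thesis"
  with that have none: "\<not> P x" if "x \<in> {a<..<b}" for x using that by auto
  have "AE x in lborel. x \<notin> {a<..<b}"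
    using assms(1) by eventually_elim (use none in blast)
  then have "emeasure lborel {a<..<b} = 0" using AE_iff_null_sets[of "{a<..<b}" lborel] by auto
  with assms(2) show False by simp
qed

text \<open>
  On a set of full measure \<open>f(x) + c x\<close> is an almost everywhere limit of nondecreasing functions.
  Its nondecreasing extension to the line, by suprema from the left, is the representative sought.
\<close>

lemma one_sided_lipschitz_representative:
  fixes f :: "real \<Rightarrow> real" and vn :: "nat \<Rightarrow> real \<Rightarrow> real"
  assumes f: "f \<in> borel_measurable borel" "AE x in lborel. f x \<in> {0..umax}"
    and fn: "\<And>n. fn n \<in> borel_measurable borel" "\<And>n. AE x in lborel. fn n x = vn n x"
    and vn: "\<And>n x. vn n x \<in> {0..umax}" "\<And>n x y. x < y \<Longrightarrow> vn n x - vn n y \<le> c * (y - x)"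
    and lim: "L1loc_tendsto fn f" and c: "0 \<le> c"
  obtains w where "w =\<^sub>a\<^sub>e f" "\<And>x y. x < y \<Longrightarrow> w x - w y \<le> c * (y - x)"
proof -
  have [measurable]: "f \<in> borel_measurable borel" "\<And>n. fn n \<in> borel_measurable borel" using f fn by auto
  have "\<exists>r :: nat \<Rightarrow> nat. AE x in lborel. x \<in> {-real R..real R} \<longrightarrow> (\<lambda>n. vn (r n) x) \<longlonglongrightarrow> f x" for R :: nat
  proof -
    have fb: "AE x in lborel. \<bar>f x\<bar> \<le> umax" using f(2) by eventually_elim auto
    have fnb: "AE x in lborel. \<bar>fn n x\<bar> \<le> umax" for n
      using fn(2)[of n]
    proof eventually_elim
      case (elim x)
      then show ?case using vn(1)[of n x] by simp
    qed
    obtain r :: "nat \<Rightarrow> nat" where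
      r: "AE x in lborel. x \<in> {-real R..real R} \<longrightarrow> (\<lambda>n. fn (r n) x) \<longlonglongrightarrow> f x"
      by (rule L1loc_tendsto_AE_subseq[OF fn(1) f(1) fnb fb lim, of "real R"])
    have "AE x in lborel. \<forall>n. fn n x = vn n x" unfolding AE_all_countable using fn(2) by blast
    with r have "AE x in lborel. x \<in> {-real R..real R} \<longrightarrow> (\<lambda>n. vn (r n) x) \<longlonglongrightarrow> f x"
      by eventually_elim simp
    then show ?thesis by blast
  qed
  then obtain r :: "nat \<Rightarrow> nat \<Rightarrow> nat" where
    r: "\<And>R. AE x in lborel. x \<in> {-real R..real R} \<longrightarrow> (\<lambda>n. vn (r R n) x) \<longlonglongrightarrow> f x" by metis
  define good where "good x \<longleftrightarrow> (\<forall>R::nat. x \<in> {-real R..real R} \<longrightarrow> (\<lambda>n. vn (r R n) x) \<longlonglongrightarrow> f x) \<and> f x \<in> {0..umax}" for x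
  have "AE x in lborel. \<forall>R::nat. x \<in> {-real R..real R} \<longrightarrow> (\<lambda>n. vn (r R n) x) \<longlonglongrightarrow> f x"
    unfolding AE_all_countable using r by blast
  with f(2) have good: "AE x in lborel. good x" by eventually_elim (simp add: good_def)
  have osl: "f x + c * x \<le> f y + c * y" if "good x" "good y" "x < y" for x y
  proof -
    obtain R :: nat where R: "\<bar>x\<bar> + \<bar>y\<bar> \<le> real R" using real_arch_simple by blast
    have "x \<in> {-real R..real R}" "y \<in> {-real R..real R}" using R by auto
    then have lx: "(\<lambda>n. vn (r R n) x) \<longlonglongrightarrow> f x" and ly: "(\<lambda>n. vn (r R n) y) \<longlonglongrightarrow> f y"
      using that unfolding good_def by blast+
    have "f x - f y \<le> c * (y - x)"
      by (rule LIMSEQ_le_const2[OF tendsto_diff[OF lx ly]]) (use vn(2) that in auto)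
    then show ?thesis by (simp add: algebra_simps)
  qed
  define A where "A x = {f z + c * z | z. good z \<and> z \<le> x}" for x
  define w where "w x = Sup (A x) - c * x" for x
  have ne: "A x \<noteq> {}" for x
  proof -
    have "x - 1 < x" by simp
    with good obtain z where "z < x" "good z" by (rule AE_lborel_dense)
    then have "f z + c * z \<in> A x" by (auto simp: A_def)
    then show ?thesis by blast
  qed
  have bd: "bdd_above (A x)" for x
  proof (rule bdd_aboveI)
    fix a assume "a \<in> A x"
    then obtain z where z: "a = f z + c * z" "good z" "z \<le> x" by (auto simp: A_def)
    then have "f z \<le> umax" "c * z \<le> c * x" using c by (auto simp: good_def intro: mult_left_mono)
    then show "a \<le> umax + c * x" using z by linarith
  qed
  show thesis
  proof
    have "AE x in lborel. w x = f x"
      using good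
    proof eventually_elim
      case (elim x)
      have "Sup (A x) = f x + c * x"
      proof (rule cSup_eq_maximum)
        show "f x + c * x \<in> A x" using elim by (auto simp: A_def)
        fix a assume "a \<in> A x"
        then obtain z where z: "a = f z + c * z" "good z" "z \<le> x" by (auto simp: A_def)
        then show "a \<le> f x + c * x" using osl[of z x] elim by (cases "z = x") auto
      qed
      then show ?case by (simp add: w_def)
    qed
    then show "w =\<^sub>a\<^sub>e f" by (simp add: ae_eq_def)
    fix x y :: real assume "x < y"
    then have "Sup (A x) \<le> Sup (A y)" by (intro cSup_subset_mono ne bd) (auto simp: A_def)
    then show "w x - w y \<le> c * (y - x)" by (simp add: w_def algebra_simps)
  qed
qed

lemma AE_translate:
  assumes "AE x in lborel. P (x::real)"
  shows "AE s in lborel. P (x + s)"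
proof -
  from assms obtain N where N: "{x \<in> space lborel. \<not> P x} \<subseteq> N" "emeasure lborel N = 0" "N \<in> sets lborel"
    by (rule AE_E)
  have [measurable]: "N \<in> sets borel" using N by simp
  have "AE y in lborel. y \<notin> N" using N by (intro AE_not_in) (auto simp: null_sets_def)
  then have "AE s in lborel. x + 1 * s \<notin> N" by (intro AE_borel_affine) auto
  then show ?thesis by eventually_elim (use N(1) in auto)
qed

context
  fixes f :: "real \<Rightarrow> real" and lo hi h :: real
  assumes f[measurable]: "f \<in> borel_measurable borel" and f_lo: "\<And>x. lo \<le> f x" and f_hi: "\<And>x. f x \<le> hi"
    and lo: "0 \<le> lo" and h: "0 < h"
begin

lemma abs_le_upper_bound: "\<bar>f x\<bar> \<le> hi"
  using f_lo[of x] f_hi[of x] lo by linarith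

lemma steklov_window_integrable: "integrable lborel (\<lambda>s. indicator {0..h} s * f (x + s))"
  using integrable_bounded_mult[of "\<lambda>s. f (x + s)" hi, OF _ abs_le_upper_bound integrable_indicator_Icc]
  by (simp add: mult.commute)

lemma steklov_alt: "steklov h f x = (LINT s|lborel. indicator {0..h} s * f (x + s)) / h"
  by (simp add: steklov_def set_lebesgue_integral_def)

lemma steklov_bounds: "lo \<le> steklov h f x" "steklov h f x \<le> hi"
proof -
  have "(LINT s|lborel. lo * indicator {0..h} s) \<le> (LINT s|lborel. indicator {0..h} s * f (x + s))"
    by (rule integral_mono[OF integrable_mult_right[OF integrable_indicator_Icc] steklov_window_integrable])
      (use f_lo in \<open>auto simp: indicator_def\<close>)
  then show "lo \<le> steklov h f x" using h by (simp add: steklov_alt pos_le_divide_eq)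
  have "(LINT s|lborel. indicator {0..h} s * f (x + s)) \<le> (LINT s|lborel. hi * indicator {0..h} s)"
    by (rule integral_mono[OF steklov_window_integrable integrable_mult_right[OF integrable_indicator_Icc]])
      (use f_hi in \<open>auto simp: indicator_def\<close>)
  then show "steklov h f x \<le> hi" using h by (simp add: steklov_alt pos_divide_le_eq)
qed

lemma steklov_lipschitz: "\<bar>steklov h f x - steklov h f y\<bar> \<le> 4 * hi / h * \<bar>x - y\<bar>"
proof -
  let ?J = "indicator {-h..0} :: real \<Rightarrow> real"
  have eq: "steklov h f z = convolution f ?J z / h" for z
  proof -
    have "(LINT s|lborel. indicator {0..h} s * f (z + s)) = (LINT s|lborel. f (z - s) * ?J s)"
      unfolding integral_reflect[of "\<lambda>s. indicator {0..h} s * f (z + s)" 0, symmetric]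
      by (intro Bochner_Integration.integral_cong) (auto simp: indicator_def)
    then show ?thesis by (simp add: steklov_alt convolution_def)
  qed
  let ?d = "\<bar>x - y\<bar>"
  have "(LINT s|lborel. \<bar>?J (s + (x - y)) - ?J s\<bar>) \<le> (LINT s|lborel. indicator {-?d..?d} s + indicator {-h-?d..-h+?d} s)"
  proof (rule integral_mono_AE')
    show "integrable lborel (\<lambda>s. indicator {-?d..?d} s + indicator {-h-?d..-h+?d} s :: real)"
      by (intro Bochner_Integration.integrable_add integrable_indicator_Icc)
  qed (auto simp: indicator_def)
  also have "\<dots> = 4 * ?d" using integrable_indicator_Icc by simp
  finally have "hi * (LINT s|lborel. \<bar>?J (s + (x - y)) - ?J s\<bar>) \<le> hi * (4 * ?d)"
    using abs_le_upper_bound[of 0] by (intro mult_left_mono) linarith+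
  with convolution_translate_le[OF f abs_le_upper_bound integrable_indicator_Icc, of "-h" 0 x y]
  have "\<bar>convolution f ?J x - convolution f ?J y\<bar> \<le> hi * (4 * ?d)" by linarith
  then have "\<bar>convolution f ?J x - convolution f ?J y\<bar> / h \<le> hi * (4 * ?d) / h" using h by (intro divide_right_mono) auto
  moreover have "\<bar>steklov h f x - steklov h f y\<bar> = \<bar>convolution f ?J x - convolution f ?J y\<bar> / h"
    unfolding eq diff_divide_distrib[symmetric] abs_divide abs_of_pos[OF h] ..
  ultimately show ?thesis by (simp add: mult_ac)
qed

lemma steklov_continuous: "continuous_on UNIV (steklov h f)"
proof (rule lipschitz_on_continuous_on[of "4 * hi / h"])
  have "0 \<le> hi" using abs_le_upper_bound[of 0] by linarith
  then show "(4 * hi / h)-lipschitz_on UNIV (steklov h f)"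
    using steklov_lipschitz h by (intro lipschitz_onI) (auto simp: dist_real_def)
qed

lemma steklov_one_sided_lipschitz:
  assumes "AE s in lborel. f (x + s) - f (y + s) \<le> c"
  shows "steklov h f x - steklov h f y \<le> c"
proof -
  have "(LINT s|lborel. indicator {0..h} s * f (x + s)) - (LINT s|lborel. indicator {0..h} s * f (y + s))
      = (LINT s|lborel. indicator {0..h} s * f (x + s) - indicator {0..h} s * f (y + s))"
    by (rule Bochner_Integration.integral_diff[OF steklov_window_integrable steklov_window_integrable, symmetric])
  also have "\<dots> \<le> (LINT s|lborel. c * indicator {0..h} s)"
  proof (rule integral_mono_AE)
    show "AE s in lborel. indicator {0..h} s * f (x + s) - indicator {0..h} s * f (y + s) \<le> c * indicator {0..h} s"
      using assms by eventually_elim (auto simp: indicator_def)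
  qed (use steklov_window_integrable integrable_indicator_Icc in auto)
  also have "\<dots> = c * h" using h by simp
  finally have "((LINT s|lborel. indicator {0..h} s * f (x + s)) - (LINT s|lborel. indicator {0..h} s * f (y + s))) / h \<le> c"
    using h by (simp add: pos_divide_le_eq)
  then show ?thesis by (simp add: steklov_alt diff_divide_distrib)
qed

text \<open>
  Translation does not change the variation of \<open>g\<close>, and an average of functions varies no more than
  they do.
\<close>

lemma steklov_tot_var:
  assumes g: "AE x in lborel. f x = g x" and tv: "tot_var g \<le> ereal c"
  shows "tot_var (steklov h f) \<le> ereal c"
  unfolding tot_var_le_iff
proof (intro allI impI)
  fix n and x :: "nat \<Rightarrow> real" assume x: "mono x"
  let ?I = "indicator {0..h} :: real \<Rightarrow> real"
  have i: "integrable lborel (\<lambda>s. \<bar>?I s * f (x (Suc i) + s) - ?I s * f (x i + s)\<bar>)" for i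
    by (intro integrable_abs Bochner_Integration.integrable_diff steklov_window_integrable)
  have "(\<Sum>i<n. \<bar>steklov h f (x (Suc i)) - steklov h f (x i)\<bar>) \<le>
     (\<Sum>i<n. (LINT s|lborel. \<bar>?I s * f (x (Suc i) + s) - ?I s * f (x i + s)\<bar>) / h)"
  proof (rule sum_mono)
    fix i
    have "\<bar>steklov h f (x (Suc i)) - steklov h f (x i)\<bar> = \<bar>LINT s|lborel. ?I s * f (x (Suc i) + s) - ?I s * f (x i + s)\<bar> / h"
      unfolding Bochner_Integration.integral_diff[OF steklov_window_integrable steklov_window_integrable]
        steklov_alt diff_divide_distrib[symmetric] abs_divide abs_of_pos[OF h] ..
    then show "\<bar>steklov h f (x (Suc i)) - steklov h f (x i)\<bar> \<le> (LINT s|lborel. \<bar>?I s * f (x (Suc i) + s) - ?I s * f (x i + s)\<bar>) / h"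
      using h integral_abs_bound[of lborel "\<lambda>s. ?I s * f (x (Suc i) + s) - ?I s * f (x i + s)"] by (simp add: divide_right_mono)
  qed
  also have "\<dots> = (LINT s|lborel. (\<Sum>i<n. \<bar>?I s * f (x (Suc i) + s) - ?I s * f (x i + s)\<bar>)) / h"
    by (simp add: Bochner_Integration.integral_sum[OF i] sum_divide_distrib)
  also have "(LINT s|lborel. (\<Sum>i<n. \<bar>?I s * f (x (Suc i) + s) - ?I s * f (x i + s)\<bar>)) \<le> (LINT s|lborel. c * ?I s)"
  proof (rule integral_mono_AE)
    show "integrable lborel (\<lambda>s. \<Sum>i<n. \<bar>?I s * f (x (Suc i) + s) - ?I s * f (x i + s)\<bar>)" by (intro Bochner_Integration.integrable_sum i)
    show "integrable lborel (\<lambda>s. c * ?I s)" by (intro integrable_mult_right integrable_indicator_Icc)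
    have "AE s in lborel. \<forall>i. f (x i + s) = g (x i + s)" unfolding AE_all_countable using AE_translate[OF g] by blast
    then show "AE s in lborel. (\<Sum>i<n. \<bar>?I s * f (x (Suc i) + s) - ?I s * f (x i + s)\<bar>) \<le> c * ?I s"
    proof eventually_elim
      case (elim s)
      have "mono (\<lambda>i. x i + s)" using x by (simp add: mono_def)
      then have "(\<Sum>i<n. \<bar>g (x (Suc i) + s) - g (x i + s)\<bar>) \<le> c" using tv unfolding tot_var_le_iff by blast
      then show ?case using elim by (auto simp: indicator_def)
    qed
  qed
  also have "(LINT s|lborel. c * ?I s) / h = c" using h by simp
  finally show "(\<Sum>i<n. \<bar>steklov h f (x (Suc i)) - steklov h f (x i)\<bar>) \<le> c" using h by (simp add: divide_right_mono)
qed

end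

section \<open>Trajectories of the semigroup\<close>

lemma data_set_measurable: "z \<in> data_set umax \<Longrightarrow> z \<in> borel_measurable borel"
  by (simp add: data_set_def)

lemma data_set_AE: "z \<in> data_set umax \<Longrightarrow> AE x in lborel. z x \<in> {0..umax}"
  by (simp add: data_set_def)

lemma L1loc_tendsto_cong:
  assumes "\<And>n. AE x in lborel. f n x = f' n x" "AE x in lborel. g x = g' x"
    and [measurable]: "\<And>n. f n \<in> borel_measurable borel" "\<And>n. f' n \<in> borel_measurable borel"
      "g \<in> borel_measurable borel" "g' \<in> borel_measurable borel"
    and "L1loc_tendsto f g"
  shows "L1loc_tendsto f' g'"
proof -
  have "(LINT x:{-R..R}|lborel. \<bar>f n x - g x\<bar>) = (LINT x:{-R..R}|lborel. \<bar>f' n x - g' x\<bar>)" for n R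
    unfolding set_lebesgue_integral_def
  proof (rule integral_cong_AE)
    show "AE x in lborel. indicator {-R..R} x *\<^sub>R \<bar>f n x - g x\<bar> = indicator {-R..R} x *\<^sub>R \<bar>f' n x - g' x\<bar>"
      using assms(1)[of n] assms(2) by eventually_elim simp
  qed measurable
  with assms(7) show ?thesis by (simp add: L1loc_tendsto_def)
qed

lemma convolution_cong_AE:
  assumes "AE x in lborel. u x = u' x" and [measurable]: "u \<in> borel_measurable borel" "u' \<in> borel_measurable borel" "k \<in> borel_measurable borel"
  shows "convolution u k x = convolution u' k x"
  unfolding convolution_alt
proof (rule integral_cong_AE)
  show "AE s in lborel. u s * k (x - s) = u' s * k (x - s)" using assms(1) by eventually_elim simp
qed measurable

lemma semigroup_continuous:
  assumes "solution_semigroup V umax k S" "\<And>n. 0 \<le> \<tau> n" "\<tau> \<longlonglongrightarrow> t"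
    and "\<And>n. v n \<in> data_set umax" "u \<in> data_set umax" "L1loc_tendsto v u"
  shows "L1loc_tendsto (\<lambda>n. S (\<tau> n) (v n)) (S t u)"
proof -
  have "\<forall>\<tau> t v u. (\<forall>n. 0 \<le> \<tau> n) \<longrightarrow> \<tau> \<longlonglongrightarrow> t \<longrightarrow> (\<forall>n. v n \<in> data_set umax) \<longrightarrow> u \<in> data_set umax \<longrightarrow>
      L1loc_tendsto v u \<longrightarrow> L1loc_tendsto (\<lambda>n. S (\<tau> n) (v n)) (S t u)"
    using assms(1) unfolding solution_semigroup_def by (elim conjE)
  from this[rule_format, OF assms(2-6)] show ?thesis .
qed

lemma test_function_partial_derivatives:
  assumes "test_function \<phi>"
  obtains \<phi>t \<phi>x where "continuous_on UNIV \<phi>t" "continuous_on UNIV \<phi>x"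
    "\<And>t x. deriv (\<lambda>s. \<phi> (s, x)) t = \<phi>t (t, x)" "\<And>t x. deriv (\<lambda>y. \<phi> (t, y)) x = \<phi>x (t, x)"
proof -
  have "Ck_plane (Suc 0) \<phi>" using assms unfolding test_function_def by blast
  then obtain \<phi>t \<phi>x where c: "continuous_on UNIV \<phi>t" "continuous_on UNIV \<phi>x"
    and d: "\<And>p. (\<phi> has_derivative (\<lambda>h. \<phi>t p * fst h + \<phi>x p * snd h)) (at p)" by auto
  have "((\<lambda>s. \<phi> (s, x)) has_real_derivative \<phi>t (t, x)) (at t)" for t x
  proof -
    have "((\<lambda>s. (s, x)) has_derivative (\<lambda>h. (h, 0))) (at t)" by (auto intro!: derivative_eq_intros)
    from has_derivative_compose[OF this d] show ?thesis by (simp add: has_field_derivative_def)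
  qed
  moreover have "((\<lambda>y. \<phi> (t, y)) has_real_derivative \<phi>x (t, x)) (at x)" for t x
  proof -
    have "((\<lambda>y. (t, y)) has_derivative (\<lambda>h. (0, h))) (at x)" by (auto intro!: derivative_eq_intros)
    from has_derivative_compose[OF this d] show ?thesis by (simp add: has_field_derivative_def)
  qed
  ultimately show thesis by (intro that[OF c] DERIV_imp_deriv)
qed

lemma L1loc_tendsto_const: "L1loc_tendsto (\<lambda>n. f) f"
  by (simp add: L1loc_tendsto_def set_lebesgue_integral_def)

text \<open>
  Replaces a trajectory of the semigroup by a version with values in \<open>[0, umax]\<close> that starts from the
  given pointwise datum and is constant for \<open>t \<le> 0\<close>.
\<close>

definition trajectory :: "real \<Rightarrow> (real \<Rightarrow> (real \<Rightarrow> real) \<Rightarrow> real \<Rightarrow> real) \<Rightarrow> (real \<Rightarrow> real) \<Rightarrow> real \<Rightarrow> real \<Rightarrow> real" where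
  "trajectory umax S z t x = (if t \<le> 0 then z x else max 0 (min umax (S t z x)))"

context
  fixes V k z :: "real \<Rightarrow> real" and umax :: real and S
  assumes S: "solution_semigroup V umax k S" and z: "z \<in> data_set umax"
    and z01: "\<And>x. z x \<in> {0..umax}" and umax: "0 < umax"
begin

lemma trajectory_measurable: "trajectory umax S z t \<in> borel_measurable borel"
proof (cases "t \<le> 0")
  case True
  then show ?thesis using data_set_measurable[OF z] by (simp add: trajectory_def[abs_def])
next
  case False
  then have "S t z \<in> data_set umax" using S z by (auto simp: solution_semigroup_def)
  from data_set_measurable[OF this] False show ?thesis by (simp add: trajectory_def[abs_def])
qed

lemma trajectory_bounds: "0 \<le> trajectory umax S z t x" "trajectory umax S z t x \<le> umax"
  using z01[of x] umax by (auto simp: trajectory_def)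

lemma trajectory_AE: "0 \<le> t \<Longrightarrow> AE x in lborel. S t z x = trajectory umax S z t x"
proof -
  assume t: "0 \<le> t"
  show ?thesis
  proof (cases "t = 0")
    case True
    have "S 0 z =\<^sub>a\<^sub>e z" using S z by (auto simp: solution_semigroup_def)
    with True show ?thesis by (simp add: trajectory_def ae_eq_def)
  next
    case False
    have "S t z \<in> data_set umax" using S z t by (auto simp: solution_semigroup_def)
    from data_set_AE[OF this] show ?thesis
      by eventually_elim (use False t in \<open>auto simp: trajectory_def\<close>)
  qed
qed

lemma S_measurable: "0 \<le> t \<Longrightarrow> S t z \<in> borel_measurable borel"
  using S z data_set_measurable by (auto simp: solution_semigroup_def)

lemma trajectory_path: "L1loc_path umax (trajectory umax S z)"
  unfolding L1loc_path_def
proof (intro conjI allI impI)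
  show "trajectory umax S z t \<in> borel_measurable borel" for t by (rule trajectory_measurable)
  show "\<bar>trajectory umax S z t x\<bar> \<le> umax" for t x using trajectory_bounds[of t x] by simp
  fix \<tau> :: "nat \<Rightarrow> real" and t assume \<tau>: "\<tau> \<longlonglongrightarrow> t"
  have m: "(\<lambda>n. max 0 (\<tau> n)) \<longlonglongrightarrow> max 0 t" by (intro tendsto_max tendsto_const \<tau>)
  have lim: "L1loc_tendsto (\<lambda>n. S (max 0 (\<tau> n)) z) (S (max 0 t) z)"
    by (rule semigroup_continuous[OF S _ m z z L1loc_tendsto_const]) simp
  have ae: "AE x in lborel. S (max 0 s) z x = trajectory umax S z s x" for s
  proof -
    have "trajectory umax S z (max 0 s) = trajectory umax S z s" by (auto simp: trajectory_def[abs_def] max_def)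
    with trajectory_AE[of "max 0 s"] show ?thesis by simp
  qed
  show "L1loc_tendsto (\<lambda>n. trajectory umax S z (\<tau> n)) (trajectory umax S z t)"
    by (rule L1loc_tendsto_cong[OF ae ae S_measurable trajectory_measurable S_measurable trajectory_measurable lim]) simp_all
qed

lemma trajectory_weak:
  assumes k: "integrable lborel k" and V: "continuous_on UNIV V"
  shows "distributional_solution V k (trajectory umax S z 0) (trajectory umax S z)"
proof -
  have weak: "distributional_solution V k z (\<lambda>t. S t z)" using S z by (auto simp: solution_semigroup_def)
  have [measurable]: "k \<in> borel_measurable borel" "V \<in> borel_measurable borel"
    using k borel_measurable_continuous_onI[OF V] by auto
  have inner: "(LINT x|lborel. S t z x * p x + S t z x * V (convolution (S t z) k x) * q x) =
      (LINT x|lborel. trajectory umax S z t x * p x + trajectory umax S z t x * V (convolution (trajectory umax S z t) k x) * q x)"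
    if t: "0 \<le> t" and [measurable]: "p \<in> borel_measurable borel" "q \<in> borel_measurable borel" for t and p q :: "real \<Rightarrow> real"
  proof -
    have [measurable]: "S t z \<in> borel_measurable borel" "trajectory umax S z t \<in> borel_measurable borel"
      by (rule S_measurable[OF t] trajectory_measurable)+
    have c: "convolution (S t z) k = convolution (trajectory umax S z t) k"
      by (rule ext, rule convolution_cong_AE[OF trajectory_AE[OF t]]) measurable
    have "continuous_on UNIV (\<lambda>x. convolution (trajectory umax S z t) k x)"
      using continuous_on_compose2[OF continuous_convolution_path[OF trajectory_path k], of UNIV "\<lambda>x. (t, x)"]
      by (simp add: continuous_on_Pair)
    then have [measurable]: "convolution (trajectory umax S z t) k \<in> borel_measurable borel"
      by (rule borel_measurable_continuous_onI)
    show ?thesis unfolding c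
    proof (rule integral_cong_AE)
      show "AE x in lborel. S t z x * p x + S t z x * V (convolution (trajectory umax S z t) k x) * q x =
        trajectory umax S z t x * p x + trajectory umax S z t x * V (convolution (trajectory umax S z t) k x) * q x"
        using trajectory_AE[OF t] by eventually_elim simp
    qed measurable
  qed
  have z0: "trajectory umax S z 0 = z" by (auto simp: trajectory_def)
  show ?thesis unfolding distributional_solution_def z0
  proof (intro allI impI)
    fix \<phi> assume \<phi>: "test_function \<phi>"
    obtain \<phi>t \<phi>x where c: "continuous_on UNIV \<phi>t" "continuous_on UNIV \<phi>x"
      and d: "\<And>t x. deriv (\<lambda>s. \<phi> (s, x)) t = \<phi>t (t, x)" "\<And>t x. deriv (\<lambda>y. \<phi> (t, y)) x = \<phi>x (t, x)"
      by (rule test_function_partial_derivatives[OF \<phi>]) blast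
    have slice: "(\<lambda>x. f (t, x)) \<in> borel_measurable borel" if "continuous_on UNIV f" for f :: "real \<times> real \<Rightarrow> real" and t
      by (rule borel_measurable_continuous_onI, rule continuous_on_compose2[OF that]) (auto intro!: continuous_intros)
    have "(LINT t:{0..}|lborel. (LINT x|lborel. S t z x * \<phi>t (t, x) + S t z x * V (convolution (S t z) k x) * \<phi>x (t, x)))
        + (LINT x|lborel. z x * \<phi> (0, x)) = 0"
      using weak[unfolded distributional_solution_def, rule_format, OF \<phi>] unfolding d .
    moreover have "(LINT t:{0..}|lborel. (LINT x|lborel. S t z x * \<phi>t (t, x) + S t z x * V (convolution (S t z) k x) * \<phi>x (t, x)))
      = (LINT t:{0..}|lborel. (LINT x|lborel. trajectory umax S z t x * \<phi>t (t, x)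
          + trajectory umax S z t x * V (convolution (trajectory umax S z t) k x) * \<phi>x (t, x)))"
      unfolding set_lebesgue_integral_def
    proof (intro Bochner_Integration.integral_cong refl)
      fix t :: real
      show "indicator {0..} t *\<^sub>R (LINT x|lborel. S t z x * \<phi>t (t, x) + S t z x * V (convolution (S t z) k x) * \<phi>x (t, x)) =
        indicator {0..} t *\<^sub>R (LINT x|lborel. trajectory umax S z t x * \<phi>t (t, x)
          + trajectory umax S z t x * V (convolution (trajectory umax S z t) k x) * \<phi>x (t, x))"
        using inner[of t, OF _ slice[OF c(1)] slice[OF c(2)]] by (cases "0 \<le> t") simp_all
    qed
    ultimately show "(LINT t:{0..}|lborel. (LINT x|lborel. trajectory umax S z t x * deriv (\<lambda>s. \<phi> (s, x)) t
          + trajectory umax S z t x * V (convolution (trajectory umax S z t) k x) * deriv (\<lambda>y. \<phi> (t, y)) x))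
        + (LINT x|lborel. z x * \<phi> (0, x)) = 0"
      unfolding d by (simp only:)
  qed
qed

end

section \<open>The rescaled kernel and the velocity function\<close>

lemma AE_scale:
  assumes "AE x in lborel. P (x::real)" "c \<noteq> 0"
  shows "AE x in lborel. P (c * x)"
proof -
  from assms(1) obtain N where N: "{x \<in> space lborel. \<not> P x} \<subseteq> N" "emeasure lborel N = 0" "N \<in> sets lborel"
    by (rule AE_E)
  have [measurable]: "N \<in> sets borel" using N by simp
  have "AE y in lborel. y \<notin> N" using N by (intro AE_not_in) (auto simp: null_sets_def)
  then have "AE s in lborel. 0 + c * s \<notin> N" by (intro AE_borel_affine assms(2)) auto
  then show ?thesis by eventually_elim (use N(1) in auto)
qed

text \<open>
  Rescaling turns the constant \<open>D\<close> of the kernel condition into \<open>\<epsilon> D\<close>.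
\<close>

lemma rescale_anticipating_kernel:
  fixes \<eta> :: "real \<Rightarrow> real"
  assumes \<eta>_nonneg: "\<And>x. \<eta> x \<ge> 0"
    and \<eta>_zero: "\<And>x. x > 0 \<Longrightarrow> \<eta> x = 0"
    and \<eta>_integral: "has_bochner_integral lborel \<eta> 1"
    and \<eta>_lipschitz: "C-lipschitz_on {..0} \<eta>"
    and D_pos: "D > 0"
    and \<eta>_deriv: "AE y in lborel. y < 0 \<longrightarrow> \<eta> differentiable (at y) \<and> \<eta> y \<le> D * deriv \<eta> y"
    and \<epsilon>: "\<epsilon> > 0"
  obtains kd where "anticipating_kernel (rescale \<epsilon> \<eta>) kd (\<epsilon> * D)"
proof -
  let ?k = "rescale \<epsilon> \<eta>"
  have k0: "0 \<le> ?k x" for x using \<eta>_nonneg \<epsilon> by (simp add: rescale_def)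
  have kz: "?k x = 0" if "0 < x" for x using \<eta>_zero[of "x / \<epsilon>"] that \<epsilon> by (simp add: rescale_def)
  have i\<eta>: "integrable lborel \<eta>" "(LINT x|lborel. \<eta> x) = 1" using \<eta>_integral by (auto simp: has_bochner_integral_iff)
  have ki: "integrable lborel ?k"
    using lborel_integrable_real_affine[OF i\<eta>(1), of "1 / \<epsilon>" 0] \<epsilon> by (simp add: rescale_def[abs_def])
  have k1: "(LINT x|lborel. ?k x) = 1"
    using lborel_integral_real_affine[of \<epsilon> ?k 0] \<epsilon> i\<eta>(2) by (simp add: rescale_def[abs_def])
  have kl: "(C / (\<epsilon> * \<epsilon>))-lipschitz_on {..0} ?k"
  proof (rule lipschitz_onI)
    show "0 \<le> C / (\<epsilon> * \<epsilon>)" using lipschitz_on_nonneg[OF \<eta>_lipschitz] \<epsilon> by simp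
    fix x y :: real assume xy: "x \<in> {..0}" "y \<in> {..0}"
    have "\<bar>\<eta> (x / \<epsilon>) - \<eta> (y / \<epsilon>)\<bar> \<le> C * \<bar>x / \<epsilon> - y / \<epsilon>\<bar>"
      using lipschitz_onD[OF \<eta>_lipschitz, of "x / \<epsilon>" "y / \<epsilon>"] xy \<epsilon> by (simp add: dist_real_def divide_nonpos_pos)
    then have "\<bar>\<eta> (x / \<epsilon>) - \<eta> (y / \<epsilon>)\<bar> / \<epsilon> \<le> C * \<bar>x / \<epsilon> - y / \<epsilon>\<bar> / \<epsilon>" using \<epsilon> by (intro divide_right_mono) auto
    moreover have "\<bar>x / \<epsilon> - y / \<epsilon>\<bar> = \<bar>x - y\<bar> / \<epsilon>" using \<epsilon> by (simp add: diff_divide_distrib[symmetric])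
    moreover have "\<bar>?k x - ?k y\<bar> = \<bar>\<eta> (x / \<epsilon>) - \<eta> (y / \<epsilon>)\<bar> / \<epsilon>"
      using \<epsilon> by (simp add: rescale_def diff_divide_distrib[symmetric])
    ultimately show "dist (?k x) (?k y) \<le> C / (\<epsilon> * \<epsilon>) * dist x y" by (simp add: dist_real_def mult.commute)
  qed
  have kd: "AE y in lborel. y < 0 \<longrightarrow> ?k differentiable (at y) \<and> ?k y \<le> (\<epsilon> * D) * deriv ?k y"
  proof -
    have "AE y in lborel. (1 / \<epsilon>) * y < 0 \<longrightarrow> \<eta> differentiable (at ((1 / \<epsilon>) * y)) \<and> \<eta> ((1 / \<epsilon>) * y) \<le> D * deriv \<eta> ((1 / \<epsilon>) * y)"
      by (rule AE_scale[OF \<eta>_deriv]) (use \<epsilon> in simp)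
    then show ?thesis
    proof eventually_elim
      case (elim y)
      show ?case
      proof
        assume "y < 0"
        then have e: "\<eta> differentiable (at (y / \<epsilon>))" "\<eta> (y / \<epsilon>) \<le> D * deriv \<eta> (y / \<epsilon>)"
          using elim \<epsilon> by (auto simp: divide_neg_pos)
        from e(1) have "(\<eta> has_real_derivative deriv \<eta> (y / \<epsilon>)) (at (y / \<epsilon>))" by (simp add: DERIV_deriv_iff_real_differentiable)
        then have "((\<lambda>y. \<eta> (y / \<epsilon>)) has_real_derivative deriv \<eta> (y / \<epsilon>) * (1 / \<epsilon>)) (at y)"
          by (rule DERIV_chain2) (rule DERIV_cdivide[OF DERIV_ident])
        from DERIV_cdivide[OF this, of \<epsilon>] have d: "(?k has_real_derivative deriv \<eta> (y / \<epsilon>) / \<epsilon> / \<epsilon>) (at y)"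
          by (simp add: rescale_def[abs_def])
        have "\<epsilon> * D * deriv ?k y = D * deriv \<eta> (y / \<epsilon>) / \<epsilon>" unfolding DERIV_imp_deriv[OF d] using \<open>0 < \<epsilon>\<close> by (simp add: field_simps)
        moreover have "?k y \<le> D * deriv \<eta> (y / \<epsilon>) / \<epsilon>" unfolding rescale_def using e(2) \<epsilon> by (intro divide_right_mono) auto
        ultimately show "?k differentiable (at y) \<and> ?k y \<le> (\<epsilon> * D) * deriv ?k y"
          using d by (auto simp: real_differentiable_def)
      qed
    qed
  qed
  have \<epsilon>D: "0 < \<epsilon> * D" using \<epsilon> D_pos by simp
  show thesis
  proof (rule monotone_kernel_density[OF k0 ki kl \<epsilon>D kd])
    fix kd' assume *: "integrable lborel kd'" "\<And>y. 0 \<le> kd' y" "\<And>y. 0 \<le> y \<Longrightarrow> kd' y = 0"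
      "AE y in lborel. y < 0 \<longrightarrow> ?k y \<le> \<epsilon> * D * kd' y"
      "\<And>a b. a \<le> b \<Longrightarrow> (LINT y:{a..b}|lborel. kd' y) = ?k (min b 0) - ?k (min a 0)"
      "(LINT y|lborel. kd' y) = ?k 0"
    have "anticipating_kernel ?k kd' (\<epsilon> * D)"
      by unfold_locales (simp_all only: * k0 kz ki k1 \<epsilon>D)
    then show thesis by (rule that)
  qed
qed

lemma concave_velocity_facts:
  fixes V :: "real \<Rightarrow> real"
  assumes V_diff: "V differentiable_on UNIV"
    and V'_diff: "deriv V differentiable_on UNIV"
    and V''_cont: "continuous_on UNIV (deriv (deriv V))"
    and V''_nonpos: "\<And>v. deriv (deriv V) v \<le> 0"
    and umax: "0 < umax"
  shows "(V has_real_derivative deriv V w) (at w)"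
    and "\<exists>Q. \<forall>w\<in>{0..umax}. - Q \<le> deriv V w"
    and "w \<le> z \<Longrightarrow> deriv V z \<le> deriv V w"
    and "\<exists>Q2. \<forall>w\<in>{0..umax}. \<forall>z\<in>{0..umax}. \<bar>deriv V w - deriv V z\<bar> \<le> Q2 * \<bar>w - z\<bar>"
proof -
  show "(V has_real_derivative deriv V w) (at w)" for w
    using V_diff by (simp add: differentiable_on_def DERIV_deriv_iff_real_differentiable)
  have d2: "(deriv V has_real_derivative deriv (deriv V) w) (at w)" for w
    using V'_diff by (simp add: differentiable_on_def DERIV_deriv_iff_real_differentiable)
  show anti: "deriv V z \<le> deriv V w" if "w \<le> z" for w z
    by (rule DERIV_nonpos_imp_nonincreasing[OF that]) (use d2 V''_nonpos in blast)
  show "\<exists>Q. \<forall>w\<in>{0..umax}. - Q \<le> deriv V w"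
    by (rule exI[of _ "- deriv V umax"]) (auto intro: anti)
  have "compact (deriv (deriv V) ` {0..umax})"
    by (intro compact_continuous_image continuous_on_subset[OF V''_cont]) auto
  then have "bounded (deriv (deriv V) ` {0..umax})" by (rule compact_imp_bounded)
  then obtain c where "\<forall>y\<in>deriv (deriv V) ` {0..umax}. norm y \<le> c" unfolding bounded_iff by blast
  then have c: "\<bar>deriv (deriv V) w\<bar> \<le> c" if "w \<in> {0..umax}" for w using that by simp
  have "\<bar>deriv V w - deriv V z\<bar> \<le> c * \<bar>w - z\<bar>" if "w \<in> {0..umax}" "z \<in> {0..umax}" for w z
    using field_differentiable_bound[of "{0..umax}" "deriv V" "deriv (deriv V)" c w z] d2 c that
    by (simp add: has_field_derivative_at_within)
  then show "\<exists>Q2. \<forall>w\<in>{0..umax}. \<forall>z\<in>{0..umax}. \<bar>deriv V w - deriv V z\<bar> \<le> Q2 * \<bar>w - z\<bar>" by blast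
qed

section \<open>General data\<close>

lemma (in regular_traffic) one_sided_lipschitz_version:
  assumes u0_lip: "\<And>x y. \<bar>u 0 x - u 0 y\<bar> \<le> K0 * \<bar>x - y\<bar>" and K0: "0 \<le> K0"
    and u0_osl: "\<And>x y. x < y \<Longrightarrow> u 0 x - u 0 y \<le> L * (y - x)" and L: "0 < L" "2 * D * L \<le> a0"
    and T: "0 \<le> T"
  shows "\<exists>v. (\<forall>x. v x \<in> {0..umax}) \<and> (AE x in lborel. u T x = v x) \<and>
    (\<forall>x y. x < y \<longrightarrow> v x - v y \<le> L / (2 * \<delta> * L * T + 1) * (y - x))"
proof (intro exI conjI allI impI)
  show "v T x \<in> {0..umax}" for x using v_bounds[OF T, of x] by simp
  show "AE x in lborel. u T x = v T x" by (rule u_AE_eq_v[OF T])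
  show "v T x - v T y \<le> L / (2 * \<delta> * L * T + 1) * (y - x)" if "x < y" for x y
    by (rule v_one_sided_lipschitz[OF u0_lip K0 u0_osl L T that])
qed

text \<open>
  The data are replaced by Steklov averages. These are Lipschitz and inherit the bounds, the finite
  variation and the one-sided estimate; the lower bound \<open>a0 = 2 \<epsilon> D L\<close>, which is below \<open>inf u0\<close> by
  the smallness of \<open>\<epsilon>\<close>, is exactly the one that the estimate for regular trajectories asks for.
\<close>

theorem theorem3:
  fixes V \<eta> u0 :: "real \<Rightarrow> real"
    and S :: "real \<Rightarrow> (real \<Rightarrow> real) \<Rightarrow> real \<Rightarrow> real"
    and \<delta> umax D L \<epsilon> :: real
  assumes V_diff: "V differentiable_on UNIV"
    and V'_diff: "deriv V differentiable_on UNIV"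
    and V''_cont: "continuous_on UNIV (deriv (deriv V))"
    and V''_nonpos: "\<And>v. deriv (deriv V) v \<le> 0"
    and \<delta>_pos: "\<delta> > 0"
    and umax_pos: "umax > 0"
    and V_umax: "V umax = 0"
    and V'_le: "\<And>v. v \<in> {0..umax} \<Longrightarrow> deriv V v \<le> - \<delta>"
    and \<eta>_nonneg: "\<And>x. \<eta> x \<ge> 0"
    and \<eta>_zero: "\<And>x. x > 0 \<Longrightarrow> \<eta> x = 0"
    and \<eta>_integral: "has_bochner_integral lborel \<eta> 1"
    and \<eta>_lipschitz: "\<exists>C. C-lipschitz_on {..0} \<eta>"
    and D_pos: "D > 0"
    and \<eta>_deriv: "AE y in lborel. y < 0 \<longrightarrow>
                    \<eta> differentiable (at y) \<and> \<eta> y \<le> D * deriv \<eta> y"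
    and u0_data: "u0 \<in> data_set umax"
    and u0_inf: "ess_inf u0 > 0"
    and L_pos: "L > 0"
    and u0_Lip: "\<exists>w. w =\<^sub>a\<^sub>e u0 \<and> Lip_minus w \<le> ereal L"
    and \<epsilon>_pos: "\<epsilon> > 0"
    and \<epsilon>_small: "ereal \<epsilon> < ess_inf u0 / ereal (2 * D * L)"
    and S_semigroup: "solution_semigroup V umax (rescale \<epsilon> \<eta>) S"
  shows "\<forall>t\<ge>0.
           (\<exists>w. w =\<^sub>a\<^sub>e S t u0 \<and> Lip_minus w \<le> ereal (L / (2 * \<delta> * L * t + 1))) \<and>
           ereal (L / (2 * \<delta> * L * t + 1)) < (if t = 0 then \<infinity> else ereal (1 / (2 * \<delta> * t)))"
proof (intro allI impI)
  fix t :: real assume t: "0 \<le> t"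
  obtain C where C: "C-lipschitz_on {..0} \<eta>" using \<eta>_lipschitz by blast
  obtain kd where kernel: "anticipating_kernel (rescale \<epsilon> \<eta>) kd (\<epsilon> * D)"
    by (rule rescale_anticipating_kernel[OF \<eta>_nonneg \<eta>_zero \<eta>_integral C D_pos \<eta>_deriv \<epsilon>_pos])
  note V_facts = concave_velocity_facts[OF V_diff V'_diff V''_cont V''_nonpos umax_pos]
  obtain Q where Q: "\<forall>w\<in>{0..umax}. - Q \<le> deriv V w" using V_facts(2) by blast
  obtain Q2 where Q2: "\<forall>w\<in>{0..umax}. \<forall>z\<in>{0..umax}. \<bar>deriv V w - deriv V z\<bar> \<le> Q2 * \<bar>w - z\<bar>" using V_facts(4) by blast
  have V_cont: "continuous_on UNIV V" by (intro continuous_at_imp_continuous_on ballI DERIV_isCont[OF V_facts(1)])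
  define a0 where "a0 = 2 * (\<epsilon> * D) * L"
  have a0: "0 < a0" using \<epsilon>_pos D_pos L_pos by (simp add: a0_def)
  have "ereal (2 * D * L) * ereal \<epsilon> < ess_inf u0"
    using \<epsilon>_small D_pos L_pos by (subst (asm) ereal_less_divide_pos) auto
  then have a0_inf: "ereal a0 \<le> ess_inf u0" by (simp add: a0_def mult_ac)
  have u0_AE: "AE x in lborel. a0 \<le> u0 x \<and> u0 x \<le> umax"
    using ess_inf_le[of u0] data_set_AE[OF u0_data]
  proof eventually_elim
    case (elim x)
    have "ereal a0 \<le> ereal (u0 x)" using a0_inf elim(1) by (rule order_trans)
    with elim(2) show ?case by simp
  qed
  have a0_umax: "a0 \<le> umax"
    by (rule AE_lborel_dense[OF u0_AE, of 0 1]) auto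
  have u0_m[measurable]: "u0 \<in> borel_measurable borel" by (rule data_set_measurable[OF u0_data])
  define f where "f x = max a0 (min umax (u0 x))" for x
  have f_m[measurable]: "f \<in> borel_measurable borel" unfolding f_def by measurable
  have f_lo: "a0 \<le> f x" and f_hi: "f x \<le> umax" for x using a0_umax by (auto simp: f_def)
  have f_AE: "AE x in lborel. f x = u0 x" using u0_AE by eventually_elim (simp add: f_def)
  define h where "h n = inverse (real (Suc n))" for n
  have h: "0 < h n" for n by (simp add: h_def)
  define z where "z n = steklov (h n) f" for n
  note st = f_m f_lo f_hi less_imp_le[OF a0] h
  have z_bounds: "a0 \<le> z n x" "z n x \<le> umax" for n x
    unfolding z_def by (rule steklov_bounds[OF st])+
  have z_cont: "continuous_on UNIV (z n)" for n unfolding z_def by (rule steklov_continuous[OF st])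
  have z_data: "z n \<in> data_set umax" for n
  proof -
    obtain g where g: "g =\<^sub>a\<^sub>e u0" "tot_var g < \<infinity>" using u0_data by (auto simp: data_set_def)
    obtain c where c: "tot_var g \<le> ereal c" using g(2) by (cases "tot_var g") auto
    have "AE x in lborel. f x = g x" using f_AE g(1)[unfolded ae_eq_def] by eventually_elim simp
    then have "tot_var (z n) \<le> ereal c" unfolding z_def by (rule steklov_tot_var[OF st _ c])
    then have "tot_var (z n) < \<infinity>" by (auto intro: le_less_trans)
    moreover have "z n x \<in> {0..umax}" for x using z_bounds[of n x] a0 by auto
    ultimately show ?thesis using borel_measurable_continuous_onI[OF z_cont]
      by (auto simp: data_set_def ae_eq_def intro!: exI[of _ "z n"])
  qed
  have z_osl: "z n x - z n y \<le> L * (y - x)" if xy: "x < y" for n x y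
  proof -
    obtain w where w: "w =\<^sub>a\<^sub>e u0" "Lip_minus w \<le> ereal L" using u0_Lip by blast
    have "AE x in lborel. f x = w x" using f_AE w(1)[unfolded ae_eq_def] by eventually_elim simp
    from AE_translate[OF this, of x] AE_translate[OF this, of y]
    have "AE s in lborel. f (x + s) - f (y + s) \<le> L * (y - x)"
    proof eventually_elim
      case (elim s)
      have "w (x + s) - w (y + s) \<le> L * ((y + s) - (x + s))" using w(2)[unfolded Lip_minus_le_iff, rule_format, of "x + s" "y + s"] xy by simp
      with elim show ?case by simp
    qed
    then show ?thesis unfolding z_def by (rule steklov_one_sided_lipschitz[OF st])
  qed
  have z_lim: "L1loc_tendsto z u0"
  proof -
    have "L1loc_tendsto z f" unfolding z_def[abs_def] h_def
      by (rule steklov_L1loc_tendsto[OF f_m abs_le_upper_bound[OF st]])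
    then show ?thesis
      by (rule L1loc_tendsto_cong[rotated -1]) (use f_AE borel_measurable_continuous_onI[OF z_cont] in auto)
  qed
  have version: "\<exists>v. (\<forall>x. v x \<in> {0..umax}) \<and> (AE x in lborel. S t (z n) x = v x) \<and>
    (\<forall>x y. x < y \<longrightarrow> v x - v y \<le> L / (2 * \<delta> * L * t + 1) * (y - x))" for n
  proof -
    have z01: "z n x \<in> {0..umax}" for x using z_bounds[of n x] a0 by auto
    let ?u = "trajectory umax S (z n)"
    note tr = S_semigroup z_data[of n] z01 umax_pos
    have u_0: "?u 0 = z n" by (auto simp: trajectory_def)
    interpret anticipating_kernel "rescale \<epsilon> \<eta>" kd "\<epsilon> * D" by (rule kernel)
    interpret regular_traffic "rescale \<epsilon> \<eta>" kd "\<epsilon> * D" V "deriv V" umax \<delta> Q Q2 ?u a0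
    proof unfold_locales
      show "distributional_solution V (rescale \<epsilon> \<eta>) (?u 0) ?u" by (rule trajectory_weak[OF tr k_int V_cont])
      show "L1loc_path umax ?u" by (rule trajectory_path[OF tr])
      show "0 \<le> ?u s x" for s x by (rule trajectory_bounds[OF tr])
      show "a0 \<le> ?u 0 x" for x unfolding u_0 by (rule z_bounds)
      show "continuous_on UNIV (?u 0)" unfolding u_0 by (rule z_cont)
    qed (use umax_pos \<delta>_pos a0 V_facts V'_le Q Q2 in auto)
    have "\<exists>v. (\<forall>x. v x \<in> {0..umax}) \<and> (AE x in lborel. ?u t x = v x) \<and>
      (\<forall>x y. x < y \<longrightarrow> v x - v y \<le> L / (2 * \<delta> * L * t + 1) * (y - x))"
    proof (rule one_sided_lipschitz_version[OF _ _ _ L_pos _ t])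
      show "\<bar>?u 0 x - ?u 0 y\<bar> \<le> 4 * umax / h n * \<bar>x - y\<bar>" for x y
        unfolding u_0 unfolding z_def by (rule steklov_lipschitz[OF st])
      show "0 \<le> 4 * umax / h n" using umax_pos h[of n] by simp
      show "?u 0 x - ?u 0 y \<le> L * (y - x)" if "x < y" for x y unfolding u_0 by (rule z_osl[OF that])
      show "2 * (\<epsilon> * D) * L \<le> a0" by (simp add: a0_def)
    qed
    then obtain v where v: "\<forall>x. v x \<in> {0..umax}" "AE x in lborel. ?u t x = v x"
      "\<forall>x y. x < y \<longrightarrow> v x - v y \<le> L / (2 * \<delta> * L * t + 1) * (y - x)" by blast
    from trajectory_AE[OF tr t] v(2) have "AE x in lborel. S t (z n) x = v x" by eventually_elim simp
    with v show ?thesis by blast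
  qed
  then obtain vn where vn: "\<And>n x. vn n x \<in> {0..umax}" "\<And>n. AE x in lborel. S t (z n) x = vn n x"
    "\<And>n x y. x < y \<Longrightarrow> vn n x - vn n y \<le> L / (2 * \<delta> * L * t + 1) * (y - x)" by metis
  have St: "S t y \<in> data_set umax" if "y \<in> data_set umax" for y
    using S_semigroup t that by (auto simp: solution_semigroup_def)
  have lim: "L1loc_tendsto (\<lambda>n. S t (z n)) (S t u0)"
    by (rule semigroup_continuous[OF S_semigroup t tendsto_const z_data u0_data z_lim])
  have den: "1 \<le> 2 * \<delta> * L * t + 1" using \<delta>_pos L_pos t by simp
  then have c: "0 \<le> L / (2 * \<delta> * L * t + 1)" using L_pos by (intro divide_nonneg_nonneg) linarith+
  obtain w where w: "w =\<^sub>a\<^sub>e S t u0" "\<And>x y. x < y \<Longrightarrow> w x - w y \<le> L / (2 * \<delta> * L * t + 1) * (y - x)"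
    using one_sided_lipschitz_representative[OF data_set_measurable[OF St[OF u0_data]] data_set_AE[OF St[OF u0_data]]
      data_set_measurable[OF St[OF z_data]] vn(2,1,3) lim c] by blast
  have "Lip_minus w \<le> ereal (L / (2 * \<delta> * L * t + 1))" unfolding Lip_minus_le_iff using w(2) by blast
  moreover have "L / (2 * \<delta> * L * t + 1) < 1 / (2 * \<delta> * t)" if "t \<noteq> 0"
  proof -
    have "0 < 2 * \<delta> * t" using that t \<delta>_pos by simp
    then have "L < 1 / (2 * \<delta> * t) * (2 * \<delta> * L * t + 1)" by (simp add: field_simps)
    moreover have "0 < 2 * \<delta> * L * t + 1" using den by linarith
    ultimately show ?thesis by (subst pos_divide_less_eq)
  qed
  ultimately show "(\<exists>w. w =\<^sub>a\<^sub>e S t u0 \<and> Lip_minus w \<le> ereal (L / (2 * \<delta> * L * t + 1))) \<and>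
           ereal (L / (2 * \<delta> * L * t + 1)) < (if t = 0 then \<infinity> else ereal (1 / (2 * \<delta> * t)))"
    using w(1) by auto
qed

end
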